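(* Let $(n_k)_{k\ge1}$ be a sequence of positive integers with $n_{k+1}/n_k\to\infty$ as $k\to\infty$. Then for every permutation $\sigma:\mathbb{N}\to\mathbb{N}$ and every measurable $f:\mathbb{R}\to\mathbb{R}$ with $f(x+1)=f(x)$, $\int_0^1f(x)\,dx=0$, $\operatorname{Var}_{[0,1]}f<\infty$, we have $$\limsup_{N\to\infty}\frac{\sum_{k=1}^N f(n_{\sigma(k)}x)}{\sqrt{2N\log\log N}}=\|f\|\quad\text{for a.e. }x\in(0,1),$$ and moreover $$\limsup_{N\to\infty}\frac{N D_N(n_{\sigma(k)}x)}{\sqrt{2N\log\log N}}=\frac12\quad\text{for a.e. }x\in(0,1).$$
   Context: $\|f\|$ is the $L^2(0,1)$ norm. $\operatorname{Var}_{[0,1]}f$ is the total variation on $[0,1]$. For reals $x_1,\dots,x_N$, $D_N(x_1,\dots,x_N)=\sup_{0\le a<b<1}\left|\frac1N\sum_{k=1}^N\mathbf 1_{[a,b)}(\{x_k\})-(b-a)\right|$ with $\{\cdot\}$ the fractional part; $D_N(n_{\sigma(k)}x)=D_N(n_{\sigma(1)}x,\dots,n_{\sigma(N)}x)$. *)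

theory Defs
  imports "HOL-Analysis.Analysis"
begin

definition total_variation :: "(real \<Rightarrow> real) \<Rightarrow> real \<Rightarrow> real \<Rightarrow> ereal" where
  "total_variation f a b =
     (SUP tm \<in> {(t, m). t 0 = a \<and> t m = b \<and> (\<forall>i<m. t i \<le> t (Suc i))}.
        ereal (\<Sum>i<snd tm. \<bar>f (fst tm (Suc i)) - f (fst tm i)\<bar>))"

definition discrepancy :: "nat \<Rightarrow> (nat \<Rightarrow> real) \<Rightarrow> real" where
  "discrepancy N x =
     (SUP ab \<in> {(a, b). 0 \<le> a \<and> a < b \<and> b < 1}.
        \<bar>real (card {k \<in> {1..N}. frac (x k) \<in> {fst ab..<snd ab}}) / real N
          - (snd ab - fst ab)\<bar>)"

definition L2_norm01 :: "(real \<Rightarrow> real) \<Rightarrow> real" where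
  "L2_norm01 f = sqrt (LBINT x=0..1. (f x)\<^sup>2)"

end

theory Submission
  imports Defs "HOL-Probability.Probability" "HOL-Real_Asymp.Real_Asymp"
begin

text \<open>
  If \<open>n (k + 1) / n k\<close> is large compared with \<open>d\<close>, then a product of trigonometric polynomials of degree at
  most \<open>d\<close>, the \<open>k\<close>-th one evaluated at \<open>n k * x\<close>, has no resonant frequencies and integrates exactly like
  a product of independent factors. Only the set of indices enters, never their order, so permutations
  are harmless. Exponential moments of a trigonometric polynomial therefore obey the bounds known for
  independent variables, which gives the upper half of the law of the iterated logarithm. For the lower
  half, the indicator of \<open>{S \<le> u}\<close> for a block sum \<open>S\<close> is majorised by a combination of three polynomial
  tilts. The integral of the product of these majorants over disjoint blocks factorises exactly, and it tends to 0.

  A function of bounded variation is smoothed by a positive trigonometric kernel at rapidly increasing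
  degrees. The \<open>i\<close>-th increment is tiny in \<open>L\<^sup>2\<close> and behaves independently along residue classes modulo
  \<open>i + 1\<close>. Jensen's inequality recombines the scales into one exponential moment bound, whose variance
  proxy is small when the \<open>L\<^sup>1\<close> norm of the function is small. Chaining over dyadic blocks of indices
  makes the smoothing remainder negligible. Chaining in addition over dyadic intervals reduces the
  discrepancy to finitely many intervals, each of variance at most \<open>1/4\<close>.
\<close>

subsection \<open>Periodic functions on the unit interval\<close>

text \<open>The permutation turns a stretch of positions into an arbitrary set of indices, and
  disjoint stretches may interleave, so there is no filtration along which to condition. What
  survives is the exact factorisation of integrals of polynomials. Exponentials and indicators are
  not polynomials; both halves therefore work with quadratic Taylor factors that bound the
  exponential from the required side. A second obstacle: bounded variation needs a degree that grows
  with the number of terms, while the place \<open>k0\<close> from which the gaps suffice is fixed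
  in advance. The fixed ratio \<open>2 ^ 130\<close> is reconciled with the degrees
  \<open>2 ^ (128 * i)\<close> by keeping only every \<open>(i + 1)\<close>-st index at scale
  \<open>i\<close>; the \<open>i + 1\<close> classes are paid for by the weights
  \<open>1 / 4 ^ (i + 1)\<close>. The exponent \<open>1/8\<close> in the block bounds is a
  compromise. For a dyadic block of length \<open>2 ^ l\<close>, a function of level
  \<open>r\<close> and \<open>s = n - l + r\<close>, the threshold decays like
  \<open>2 powr (- s / 8)\<close>, so chaining converges, yet it exceeds the standard deviation by
  \<open>2 powr (s / 8)\<close>, which makes a union bound over \<open>2 powr s\<close> events
  summable.\<close>

definition U :: "real measure" where "U = uniform_measure lborel {0..<1}"

lemma sets_U [simp, measurable_cong]: "sets U = sets borel"
  by (simp add: U_def)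

lemma space_U [simp]: "space U = UNIV"
  by (simp add: U_def)

interpretation U: prob_space U
  unfolding U_def by (rule prob_space_uniform_measure) auto

lemma measurable_U [simp]: "borel_measurable U = borel_measurable borel"
  by (rule measurable_cong_sets) auto

lemma U_density: "U = density lborel (\<lambda>x. ennreal (indicator {0..<1} x))"
  unfolding U_def uniform_measure_def
  by (rule density_cong) (auto simp: indicator_def divide_ennreal_def)

lemma integral_U:
  fixes f :: "real \<Rightarrow> 'b::{banach, second_countable_topology}"
  assumes "f \<in> borel_measurable borel"
  shows "(\<integral>x. f x \<partial>U) = (\<integral>x. indicator {0..<1} x *\<^sub>R f x \<partial>lborel)"
  unfolding U_density using assms by (subst integral_density) auto

lemma AE_U: "(AE x in U. P x) \<longleftrightarrow> (AE x in lborel. x \<in> {0..<1} \<longrightarrow> P x)"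
  unfolding U_def by (rule AE_uniform_measure) auto

lemma integrable_U:
  fixes f :: "real \<Rightarrow> 'b::{banach, second_countable_topology}"
  assumes "f \<in> borel_measurable borel" "\<And>x. norm (f x) \<le> c"
  shows "integrable U f"
  by (rule U.integrable_const_bound[where B=c]) (use assms in auto)

section \<open>Shifts and integer dilations of periodic functions\<close>

definition periodic1 :: "(real \<Rightarrow> 'b) \<Rightarrow> bool" where
  "periodic1 f \<longleftrightarrow> (\<forall>x. f (x + 1) = f x)"

lemma periodic1_of_nat: "periodic1 f \<Longrightarrow> f (x + real k) = f x"
proof (induction k)
  case (Suc k)
  have "f (x + real (Suc k)) = f ((x + real k) + 1)" by (simp add: add_ac)
  also have "\<dots> = f (x + real k)" using Suc.prems by (simp only: periodic1_def)
  finally show ?case using Suc by simp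
qed simp

lemma periodic1_of_int: assumes "periodic1 f" shows "f (x + of_int k) = f x"
proof (cases "k \<ge> 0")
  case True
  then show ?thesis using periodic1_of_nat[OF assms, of x "nat k"] by simp
next
  case False
  then show ?thesis using periodic1_of_nat[OF assms, of "x + of_int k" "nat (-k)"] by simp
qed

lemma periodic1_frac: "periodic1 f \<Longrightarrow> f (frac x) = f x"
  using periodic1_of_int[of f x "- \<lfloor>x\<rfloor>"] by (simp add: frac_def)

lemma integrable_lborel_bounded:
  fixes f :: "real \<Rightarrow> 'b::{banach, second_countable_topology}"
  assumes [measurable]: "f \<in> borel_measurable borel" and "\<And>x. norm (f x) \<le> c"
  shows "integrable lborel (\<lambda>x. indicator {a..<b::real} x *\<^sub>R f x)"
proof (rule integrableI_bounded_set_indicator[where B=c])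
  show "AE x in lborel. x \<in> {a..<b} \<longrightarrow> norm (f x) \<le> c" using assms by auto
  show "emeasure lborel {a..<b} < \<infinity>" by (cases "a \<le> b") auto
qed auto

lemma integral_indicator_translate:
  fixes f :: "real \<Rightarrow> 'b::{banach, second_countable_topology}"
  shows "(\<integral>x. indicator {a..<b} x *\<^sub>R f (x + t) \<partial>lborel) = (\<integral>x. indicator {a+t..<b+t} x *\<^sub>R f x \<partial>lborel)"
  by (subst lborel_integral_real_affine[where c=1 and t=t and f="\<lambda>x. indicator {a+t..<b+t} x *\<^sub>R f x"])
     (auto intro!: Bochner_Integration.integral_cong simp: indicator_def add.commute)

lemma integral_U_shift:
  fixes f :: "real \<Rightarrow> 'b::{banach, second_countable_topology}"
  assumes [measurable]: "f \<in> borel_measurable borel" and b: "\<And>x. norm (f x) \<le> c" and p: "periodic1 f"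
  shows "(\<integral>x. f (x + t) \<partial>U) = (\<integral>x. f x \<partial>U)"
proof -
  \<comment> \<open>A shift by at most one period moves a single piece across the point 1; general
    shifts reduce to their fractional part.\<close>
  have *: "(\<integral>x. f (x + t) \<partial>U) = (\<integral>x. f x \<partial>U)" if "0 \<le> t" "t \<le> 1" for t
  proof -
    note i = integrable_lborel_bounded[OF assms(1) b]
    have "(\<integral>x. f (x + t) \<partial>U) = (\<integral>x. indicator {t..<1+t} x *\<^sub>R f x \<partial>lborel)"
      by (subst integral_U) (simp_all add: integral_indicator_translate)
    also have "\<dots> = (\<integral>x. indicator {t..<1} x *\<^sub>R f x + indicator {1..<1+t} x *\<^sub>R f x \<partial>lborel)"
      using that by (intro Bochner_Integration.integral_cong) (auto simp: indicator_def)
    also have "\<dots> = (\<integral>x. indicator {t..<1} x *\<^sub>R f x \<partial>lborel) + (\<integral>x. indicator {1..<1+t} x *\<^sub>R f x \<partial>lborel)"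
      by (intro Bochner_Integration.integral_add i)
    also have "(\<integral>x. indicator {1..<1+t} x *\<^sub>R f x \<partial>lborel) = (\<integral>x. indicator {0..<t} x *\<^sub>R f (x + 1) \<partial>lborel)"
      by (subst integral_indicator_translate) (simp add: add.commute)
    also have "\<dots> = (\<integral>x. indicator {0..<t} x *\<^sub>R f x \<partial>lborel)"
      using p by (simp add: periodic1_def)
    also have "(\<integral>x. indicator {t..<1} x *\<^sub>R f x \<partial>lborel) + (\<integral>x. indicator {0..<t} x *\<^sub>R f x \<partial>lborel)
        = (\<integral>x. indicator {t..<1} x *\<^sub>R f x + indicator {0..<t} x *\<^sub>R f x \<partial>lborel)"
      by (intro Bochner_Integration.integral_add[symmetric] i)
    also have "\<dots> = (\<integral>x. indicator {0..<1} x *\<^sub>R f x \<partial>lborel)"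
      using that by (intro Bochner_Integration.integral_cong) (auto simp: indicator_def)
    finally show ?thesis by (simp add: integral_U)
  qed
  have "f (x + t) = f (x + frac t)" for x
    using periodic1_of_int[OF p, of "x + t" "- \<lfloor>t\<rfloor>"] by (simp add: frac_def add_diff_eq)
  then show ?thesis using *[of "frac t"] frac_lt_1[of t] frac_ge_0[of t] by simp
qed

text \<open>The dilate runs through \<open>m\<close> full periods, each contributing the same
  amount. This carries integrals of \<open>h\<close> over to \<open>h (a k * x)\<close>.\<close>

lemma integral_U_scale:
  fixes f :: "real \<Rightarrow> 'b::{banach, second_countable_topology}"
  assumes [measurable]: "f \<in> borel_measurable borel" and b: "\<And>x. norm (f x) \<le> c" and p: "periodic1 f" and m: "m > 0"
  shows "(\<integral>x. f (real m * x) \<partial>U) = (\<integral>x. f x \<partial>U)"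
proof -
  note i = integrable_lborel_bounded[OF assms(1) b]
  have ind: "(indicator {0..<real k} x :: real) = (\<Sum>i<k. indicator {real i..<real i + 1} x)" for k and x :: real
    by (induction k) (auto simp: indicator_def)
  have "(\<integral>x. f x \<partial>U) = (\<integral>x. indicator {real i..<real i + 1} x *\<^sub>R f x \<partial>lborel)" for i
    using integral_indicator_translate[of 0 1 f "real i"] periodic1_of_nat[OF p]
    by (simp add: integral_U add.commute)
  then have "(\<Sum>i<m. (\<integral>x. indicator {real i..<real i + 1} x *\<^sub>R f x \<partial>lborel)) = real m *\<^sub>R (\<integral>x. f x \<partial>U)"
    by (simp add: sum_constant_scaleR)
  also have "(\<Sum>i<m. (\<integral>x. indicator {real i..<real i + 1} x *\<^sub>R f x \<partial>lborel))
      = (\<integral>x. indicator {0..<real m} x *\<^sub>R f x \<partial>lborel)"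
    by (subst Bochner_Integration.integral_sum[symmetric]) (auto simp: ind scaleR_sum_left i)
  also have "\<dots> = real m *\<^sub>R (\<integral>x. indicator {0..<1} x *\<^sub>R f (real m * x) \<partial>lborel)"
    using m by (subst lborel_integral_real_affine[where c="real m" and t=0])
       (auto intro!: Bochner_Integration.integral_cong arg_cong[where f="\<lambda>x. real m *\<^sub>R x"] simp: indicator_def zero_le_mult_iff)
  also have "(\<integral>x. indicator {0..<1} x *\<^sub>R f (real m * x) \<partial>lborel) = (\<integral>x. f (real m * x) \<partial>U)"
    by (simp add: integral_U)
  finally show ?thesis using m by simp
qed

subsection \<open>Trigonometric polynomials\<close>

definition trigpoly :: "nat \<Rightarrow> (real \<Rightarrow> complex) \<Rightarrow> bool" where
  "trigpoly d p \<longleftrightarrow> (\<exists>c. \<forall>t. p t = (\<Sum>j\<in>{- int d..int d}. c j * cis (2 * pi * of_int j * t)))"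

lemma borel_measurable_cis_linear [measurable]: "(\<lambda>t. cis (a * t)) \<in> borel_measurable borel"
  by (intro borel_measurable_continuous_onI continuous_intros)

lemma integral_cis: "(\<integral>x. cis (2 * pi * of_int j * x) \<partial>U) = (if j = 0 then 1 else 0)"
proof (cases "j = 0")
  case True
  then show ?thesis using U.prob_space by simp
next
  case False
  let ?f = "\<lambda>x. cis (2 * pi * of_int j * x)"
  have m: "?f \<in> borel_measurable borel" by (rule borel_measurable_cis_linear)
  have sh: "?f (x + t) = ?f x * cis (2 * pi * of_int j * t)" for x t
    by (simp add: cis_mult distrib_left)
  have "periodic1 ?f"
    unfolding periodic1_def sh using cis_multiple_2pi[of "of_int j"] by simp
  then have "(\<integral>x. ?f (x + 1 / (2 * of_int j)) \<partial>U) = (\<integral>x. ?f x \<partial>U)"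
    by (intro integral_U_shift[where c=1] m) auto
  \<comment> \<open>A shift by half a period of the character changes its sign but not its
    integral.\<close>
  moreover have "cis (2 * pi * of_int j * (1 / (2 * of_int j))) = -1"
    using False by simp
  ultimately have "- (\<integral>x. ?f x \<partial>U) = (\<integral>x. ?f x \<partial>U)" unfolding sh by simp
  then have "2 * (\<integral>x. ?f x \<partial>U) = 0" by (metis add.right_inverse mult_2)
  then show ?thesis using False by simp
qed

lemma integrable_cis: "integrable U (\<lambda>x. cis (2 * pi * of_int j * x))"
  by (rule integrable_U[where c=1, OF borel_measurable_cis_linear]) simp

lemma trigpoly_measurable: "trigpoly d p \<Longrightarrow> p \<in> borel_measurable borel"
  unfolding trigpoly_def fun_eq_iff[symmetric] by auto

lemma trigpoly_periodic: assumes "trigpoly d p" shows "periodic1 p"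
proof -
  have "cis (2 * pi * of_int j * (x + 1)) = cis (2 * pi * of_int j * x)" for x j
    using cis_multiple_2pi[of "of_int j"] by (simp add: distrib_left flip: cis_mult)
  then show ?thesis using assms by (auto simp: trigpoly_def periodic1_def)
qed

lemma trigpoly_iff_span:
  "trigpoly d p \<longleftrightarrow> (\<exists>c. \<exists>J. finite J \<and> J \<subseteq> {- int d..int d} \<and> (\<forall>t. p t = (\<Sum>j\<in>J. c j * cis (2 * pi * of_int j * t))))"
proof
  assume "\<exists>c. \<exists>J. finite J \<and> J \<subseteq> {- int d..int d} \<and> (\<forall>t. p t = (\<Sum>j\<in>J. c j * cis (2 * pi * of_int j * t)))"
  then obtain c J where J: "J \<subseteq> {- int d..int d}" "\<And>t. p t = (\<Sum>j\<in>J. c j * cis (2 * pi * of_int j * t))" by blast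
  have "p t = (\<Sum>j\<in>{- int d..int d}. (if j \<in> J then c j else 0) * cis (2 * pi * of_int j * t))" for t
    unfolding J(2) using J(1) by (intro sum.mono_neutral_cong_left) auto
  then show "trigpoly d p" unfolding trigpoly_def by (intro exI[of _ "\<lambda>j. if j \<in> J then c j else 0"]) auto
qed (auto simp: trigpoly_def)

lemma trigpoly_mono: "trigpoly d p \<Longrightarrow> d \<le> d' \<Longrightarrow> trigpoly d' p"
  unfolding trigpoly_iff_span by (meson atLeastatMost_subset_iff neg_le_iff_le of_nat_le_iff order_trans)

lemma trigpoly_add: "trigpoly d p \<Longrightarrow> trigpoly d q \<Longrightarrow> trigpoly d (\<lambda>t. p t + q t)"
proof -
  assume "trigpoly d p" "trigpoly d q"
  then obtain a b where "\<And>t. p t = (\<Sum>j\<in>{- int d..int d}. a j * cis (2 * pi * of_int j * t))"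
    "\<And>t. q t = (\<Sum>j\<in>{- int d..int d}. b j * cis (2 * pi * of_int j * t))"
    unfolding trigpoly_def by blast
  then show ?thesis unfolding trigpoly_def
    by (intro exI[of _ "\<lambda>j. a j + b j"]) (auto simp: sum.distrib distrib_right)
qed

lemma trigpoly_cmult: "trigpoly d p \<Longrightarrow> trigpoly d (\<lambda>t. c * p t)"
proof -
  assume "trigpoly d p"
  then obtain a where "\<And>t. p t = (\<Sum>j\<in>{- int d..int d}. a j * cis (2 * pi * of_int j * t))"
    unfolding trigpoly_def by blast
  then show ?thesis unfolding trigpoly_def
    by (intro exI[of _ "\<lambda>j. c * a j"]) (auto simp: sum_distrib_left mult_ac)
qed

lemma trigpoly_cis: "\<bar>j\<bar> \<le> int d \<Longrightarrow> trigpoly d (\<lambda>t. cis (2 * pi * of_int j * t))"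
  unfolding trigpoly_iff_span by (rule exI[of _ "\<lambda>_. 1"], rule exI[of _ "{j}"]) auto

lemma trigpoly_const: "trigpoly d (\<lambda>t. c)"
  using trigpoly_cmult[OF trigpoly_cis[of 0 d], of c] by simp

lemma trigpoly_sum: "finite I \<Longrightarrow> (\<And>i. i \<in> I \<Longrightarrow> trigpoly d (p i)) \<Longrightarrow> trigpoly d (\<lambda>t. \<Sum>i\<in>I. p i t)"
  by (induction I rule: finite_induct) (auto intro: trigpoly_add trigpoly_const)

lemma trigpoly_mult: assumes "trigpoly d p" "trigpoly e q" shows "trigpoly (d + e) (\<lambda>t. p t * q t)"
proof -
  obtain a b where p: "\<And>t. p t = (\<Sum>j\<in>{- int d..int d}. a j * cis (2 * pi * of_int j * t))"
    and q: "\<And>t. q t = (\<Sum>j\<in>{- int e..int e}. b j * cis (2 * pi * of_int j * t))"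
    using assms unfolding trigpoly_def by blast
  have "p t * q t = (\<Sum>j\<in>{- int d..int d}. \<Sum>k\<in>{- int e..int e}. a j * b k * cis (2 * pi * of_int (j + k) * t))" for t
    unfolding p q sum_product by (intro sum.cong) (simp_all add: cis_mult[symmetric] distrib_left distrib_right mult_ac)
  then show ?thesis by (auto intro!: trigpoly_sum trigpoly_cmult trigpoly_cis simp del: of_int_add)
qed

lemma trigpoly_scale: assumes "trigpoly d p" shows "trigpoly (m * d) (\<lambda>t. p (real m * t))"
proof -
  obtain a where p: "\<And>t. p t = (\<Sum>j\<in>{- int d..int d}. a j * cis (2 * pi * of_int j * t))"
    using assms unfolding trigpoly_def by blast
  have "p (real m * t) = (\<Sum>j\<in>{- int d..int d}. a j * cis (2 * pi * of_int (int m * j) * t))" for t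
    unfolding p by (simp add: mult_ac)
  moreover have "\<bar>int m * j\<bar> \<le> int (m * d)" if "j \<in> {- int d..int d}" for j
    using that by (auto simp: abs_mult intro!: mult_left_mono)
  ultimately show ?thesis by (auto intro!: trigpoly_sum trigpoly_cmult trigpoly_cis simp del: of_int_mult)
qed

text \<open>A product of characters has frequency \<open>j + m * k\<close> with
  \<open>\<bar>j\<bar> \<le> e < m\<close>, which vanishes only for \<open>j = k = 0\<close>. Hence
  only the product of the two constant coefficients remains.\<close>

lemma integral_trigpoly_mult_scale:
  assumes "trigpoly e q" "trigpoly d p" "e < m"
  shows "(\<integral>x. q x * p (real m * x) \<partial>U) = (\<integral>x. q x \<partial>U) * (\<integral>x. p x \<partial>U)"
proof -
  obtain a b where q: "\<And>t. q t = (\<Sum>j\<in>{- int e..int e}. a j * cis (2 * pi * of_int j * t))"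
    and p: "\<And>t. p t = (\<Sum>j\<in>{- int d..int d}. b j * cis (2 * pi * of_int j * t))"
    using assms unfolding trigpoly_def by blast
  have iq: "(\<integral>x. q x \<partial>U) = a 0" unfolding q
    by (subst Bochner_Integration.integral_sum) (auto simp: integrable_cis integral_cis if_distrib sum.delta cong: if_cong)
  have ip: "(\<integral>x. p x \<partial>U) = b 0" unfolding p
    by (subst Bochner_Integration.integral_sum) (auto simp: integrable_cis integral_cis if_distrib sum.delta cong: if_cong)
  have z: "j + int m * k = 0 \<longleftrightarrow> j = 0 \<and> k = 0" if "j \<in> {- int e..int e}" for j k
  proof
    assume *: "j + int m * k = 0"
    then have "int m * \<bar>k\<bar> = \<bar>j\<bar>" by (metis abs_minus_cancel abs_mult abs_of_nat add_eq_0_iff)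
    moreover have "\<bar>j\<bar> < int m" using that assms(3) by auto
    ultimately have "k = 0" by (smt (verit) mult_less_cancel_left2 zero_less_abs_iff)
    then show "j = 0 \<and> k = 0" using * by simp
  qed auto
  have "q x * p (real m * x) = (\<Sum>j\<in>{- int e..int e}. \<Sum>k\<in>{- int d..int d}. a j * b k * cis (2 * pi * of_int (j + int m * k) * x))" for x
    unfolding p q sum_product by (intro sum.cong) (simp_all add: cis_mult[symmetric] distrib_left distrib_right mult_ac)
  then have "(\<integral>x. q x * p (real m * x) \<partial>U)
      = (\<Sum>j\<in>{- int e..int e}. \<Sum>k\<in>{- int d..int d}. a j * b k * (if j + int m * k = 0 then 1 else 0))"
    by (simp add: Bochner_Integration.integral_sum integrable_cis integral_cis del: of_int_add of_int_mult)
  also have "\<dots> = (\<Sum>j\<in>{- int e..int e}. \<Sum>k\<in>{- int d..int d}. if k = 0 then (if j = 0 then a j * b k else 0) else 0)"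
    by (intro sum.cong refl) (auto simp: z)
  also have "\<dots> = a 0 * b 0" by (simp add: sum.delta)
  finally show ?thesis by (simp add: iq ip)
qed

text \<open>A product of trigonometric polynomials sampled at rapidly growing multiples of the variable
  has degree below the next multiplier, so the next factor contributes no resonant frequency.\<close>
lemma integral_trigpoly_prod:
  fixes a :: "nat \<Rightarrow> nat"
  assumes "finite A" "\<And>k. k \<in> A \<Longrightarrow> trigpoly d (P k)"
    and "\<And>k k'. k \<in> A \<Longrightarrow> k' \<in> A \<Longrightarrow> k < k' \<Longrightarrow> (d + 1) * a k < a k'" "\<And>k. k \<in> A \<Longrightarrow> a k > 0"
  shows "(\<integral>x. (\<Prod>k\<in>A. P k (real (a k) * x)) \<partial>U) = (\<Prod>k\<in>A. (\<integral>x. P k x \<partial>U))"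
proof -
  have "(\<exists>e. trigpoly e (\<lambda>x. \<Prod>k\<in>A. P k (real (a k) * x)) \<and>
      (A \<noteq> {} \<longrightarrow> e \<le> (d + 1) * a (Max A)) \<and> (A = {} \<longrightarrow> e = 0)) \<and>
    (\<integral>x. (\<Prod>k\<in>A. P k (real (a k) * x)) \<partial>U) = (\<Prod>k\<in>A. (\<integral>x. P k x \<partial>U))"
    using assms
  proof (induction A rule: finite_linorder_max_induct)
    case empty
    then show ?case using U.prob_space by (auto intro: trigpoly_const)
  next
    case (insert b A)
    have "(\<exists>e. trigpoly e (\<lambda>x. \<Prod>k\<in>A. P k (real (a k) * x)) \<and>
      (A \<noteq> {} \<longrightarrow> e \<le> (d + 1) * a (Max A)) \<and> (A = {} \<longrightarrow> e = 0)) \<and>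
    (\<integral>x. (\<Prod>k\<in>A. P k (real (a k) * x)) \<partial>U) = (\<Prod>k\<in>A. (\<integral>x. P k x \<partial>U))"
      by (rule insert.IH) (use insert.prems in auto)
    then obtain e where e: "trigpoly e (\<lambda>x. \<Prod>k\<in>A. P k (real (a k) * x))"
      "A \<noteq> {} \<Longrightarrow> e \<le> (d + 1) * a (Max A)" "A = {} \<Longrightarrow> e = 0"
      and I: "(\<integral>x. (\<Prod>k\<in>A. P k (real (a k) * x)) \<partial>U) = (\<Prod>k\<in>A. (\<integral>x. P k x \<partial>U))" by blast
    have lt: "e < a b"
    proof (cases "A = {}")
      case True
      then show ?thesis using e(3) insert.prems(3)[of b] by simp
    next
      case False
      then have "(d + 1) * a (Max A) < a b"
        using insert.hyps Max_in[of A] by (intro insert.prems(2)) auto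
      then show ?thesis using e(2) False by linarith
    qed
    have nb: "b \<notin> A" using insert.hyps by auto
    have [simp]: "Max (insert b A) = b"
      using insert.hyps by (intro Max_eqI) (auto simp: less_imp_le)
    have "trigpoly (e + a b * d) (\<lambda>x. (\<Prod>k\<in>A. P k (real (a k) * x)) * P b (real (a b) * x))"
      by (intro trigpoly_mult trigpoly_scale e insert.prems) auto
    then have "trigpoly (e + a b * d) (\<lambda>x. \<Prod>k\<in>insert b A. P k (real (a k) * x))"
      using insert.hyps nb by (simp add: mult.commute)
    \<comment> \<open>Since the earlier product has degree below \<open>a b\<close>, the new factor
      restores the invariant: the degree is at most \<open>d + 1\<close> times the largest
      multiplier.\<close>
    moreover have "e + a b * d \<le> (d + 1) * a b" using lt by (simp add: algebra_simps)
    moreover have "(\<integral>x. (\<Prod>k\<in>A. P k (real (a k) * x)) * P b (real (a b) * x) \<partial>U)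
       = (\<integral>x. (\<Prod>k\<in>A. P k (real (a k) * x)) \<partial>U) * (\<integral>x. P b x \<partial>U)"
      by (rule integral_trigpoly_mult_scale[OF e(1) _ lt]) (use insert.prems in auto)
    ultimately show ?case using insert.hyps nb I by (auto simp: mult.commute)
  qed
  then show ?thesis by blast
qed

section \<open>Comparison of the exponential with quadratic polynomials\<close>

lemma exp_taylor2:
  fixes y :: real assumes "\<bar>y\<bar> \<le> 1"
  shows "exp y \<le> 1 + y + y\<^sup>2/2 + \<bar>y\<bar>^3/2" "1 + y + y\<^sup>2/2 - \<bar>y\<bar>^3/2 \<le> exp y"
proof -
  obtain t where t: "\<bar>t\<bar> \<le> \<bar>y\<bar>" "exp y = (\<Sum>m<3. y ^ m / fact m) + exp t / fact 3 * y ^ 3"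
    using Maclaurin_exp_le[of y 3] by blast
  have e: "exp y = 1 + y + y\<^sup>2/2 + exp t / 6 * y^3"
    using t(2) by (simp add: numeral_3_eq_3 power2_eq_square fact_numeral)
  have "exp t \<le> exp 1" using t(1) assms by simp
  also have "\<dots> \<le> 3" by (rule exp_le)
  finally have "\<bar>exp t / 6 * y^3\<bar> \<le> 3 / 6 * \<bar>y\<bar>^3"
    unfolding abs_mult power_abs by (intro mult_right_mono) auto
  then show "exp y \<le> 1 + y + y\<^sup>2/2 + \<bar>y\<bar>^3/2" "1 + y + y\<^sup>2/2 - \<bar>y\<bar>^3/2 \<le> exp y"
    unfolding e by (auto simp: abs_le_iff)
qed

text \<open>With the cubic error inside the exponent, errors add up over a product: for the tilts
  used on an index set \<open>A\<close> they total
  \<open>card A * \<bar>l\<bar> ^ 3\<close>.\<close>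

lemma exp_quadratic_ge:
  fixes y :: real assumes "\<bar>y\<bar> \<le> 1/2"
  shows "1 + y + y\<^sup>2/2 \<le> exp (y + \<bar>y\<bar>^3)"
proof -
  have "1/2 \<le> 1 + y" using assms by auto
  also have "\<dots> \<le> exp y" by (rule exp_ge_add_one_self)
  finally have h: "1/2 \<le> exp y" .
  have "1 + y + y\<^sup>2/2 \<le> exp y + \<bar>y\<bar>^3 * (1/2)" using exp_taylor2(2)[of y] assms by simp
  also have "\<dots> \<le> exp y + \<bar>y\<bar>^3 * exp y" using h by (intro add_left_mono mult_left_mono) auto
  also have "\<dots> = exp y * (1 + \<bar>y\<bar>^3)" by (simp add: algebra_simps)
  also have "\<dots> \<le> exp y * exp (\<bar>y\<bar>^3)" by (intro mult_left_mono exp_ge_add_one_self) auto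
  finally show ?thesis by (simp add: exp_add)
qed

lemma exp_quadratic_le:
  fixes y :: real assumes "\<bar>y\<bar> \<le> 1/2"
  shows "exp (y - \<bar>y\<bar>^3) \<le> 1 + y + y\<^sup>2/2"
proof -
  define q where "q = 1 + y + y\<^sup>2/2"
  define z where "z = \<bar>y\<bar>^3"
  have z: "z \<ge> 0" by (simp add: z_def)
  have "1/2 \<le> 1 + y" using assms by auto
  then have q: "1/2 \<le> q" unfolding q_def by (smt (verit) zero_le_power2 half_gt_zero_iff divide_nonneg_pos)
  have "exp y \<le> q + z / 2" using exp_taylor2(1)[of y] assms by (simp add: q_def z_def)
  also have "\<dots> \<le> q * (1 + z)" using q z mult_right_mono[of "1/2" q z] by (simp add: algebra_simps)
  also have "\<dots> \<le> q * exp z" using q by (intro mult_left_mono exp_ge_add_one_self) auto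
  finally show ?thesis by (simp add: exp_diff q_def z_def divide_le_eq)
qed

section \<open>Real trigonometric polynomials and their exponential moments\<close>

abbreviation rtrig :: "nat \<Rightarrow> (real \<Rightarrow> real) \<Rightarrow> bool" where
  "rtrig d p \<equiv> trigpoly d (\<lambda>x. complex_of_real (p x))"

lemma rtrig_measurable: "rtrig d p \<Longrightarrow> p \<in> borel_measurable borel"
  using measurable_compose[OF trigpoly_measurable borel_measurable_Re, of d "\<lambda>x. complex_of_real (p x)"] by simp

lemma rtrig_periodic: "rtrig d p \<Longrightarrow> periodic1 p"
  using trigpoly_periodic[of d "\<lambda>x. complex_of_real (p x)"] by (simp add: periodic1_def)

lemma rtrig_add: "rtrig d p \<Longrightarrow> rtrig d q \<Longrightarrow> rtrig d (\<lambda>x. p x + q x)"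
  using trigpoly_add[of d "\<lambda>x. complex_of_real (p x)" "\<lambda>x. complex_of_real (q x)"] by simp

lemma rtrig_cmult: "rtrig d p \<Longrightarrow> rtrig d (\<lambda>x. c * p x)"
  using trigpoly_cmult[of d "\<lambda>x. complex_of_real (p x)" "complex_of_real c"] by simp

lemma rtrig_diff: "rtrig d p \<Longrightarrow> rtrig d q \<Longrightarrow> rtrig d (\<lambda>x. p x - q x)"
  using rtrig_add[of d p "\<lambda>x. -1 * q x"] rtrig_cmult[of d q "-1"] by simp

lemma rtrig_power2: "rtrig d p \<Longrightarrow> rtrig (2 * d) (\<lambda>x. (p x)\<^sup>2)"
  using trigpoly_mult[of d "\<lambda>x. complex_of_real (p x)" d "\<lambda>x. complex_of_real (p x)"]
  by (simp add: power2_eq_square mult_2)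

lemma rtrig_const: "rtrig d (\<lambda>x. c)"
  by (rule trigpoly_const)

lemma rtrig_quadratic: "rtrig d p \<Longrightarrow> rtrig (2 * d) (\<lambda>x. 1 + b * p x + c * (p x)\<^sup>2)"
  by (intro rtrig_add rtrig_cmult rtrig_const rtrig_power2 trigpoly_mono[of d _ "2*d"]) auto

lemma rtrig_bounded: assumes "rtrig d p" obtains c where "c > 0" "\<And>x. \<bar>p x\<bar> \<le> c"
proof -
  obtain a where a: "\<And>t. complex_of_real (p t) = (\<Sum>j\<in>{- int d..int d}. a j * cis (2 * pi * of_int j * t))"
    using assms unfolding trigpoly_def by blast
  have "\<bar>p x\<bar> \<le> (\<Sum>j\<in>{- int d..int d}. norm (a j))" for x
  proof -
    have "\<bar>p x\<bar> = norm (complex_of_real (p x))" by simp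
    also have "\<dots> \<le> (\<Sum>j\<in>{- int d..int d}. norm (a j))"
      unfolding a by (rule order_trans[OF norm_sum]) (simp add: norm_mult)
    finally show ?thesis .
  qed
  then have "\<bar>p x\<bar> \<le> (\<Sum>j\<in>{- int d..int d}. norm (a j)) + 1" for x
    by (rule order_trans) simp
  moreover have "(\<Sum>j\<in>{- int d..int d}. norm (a j)) + 1 > 0" by (intro add_nonneg_pos sum_nonneg) auto
  ultimately show ?thesis using that by blast
qed

lemma integral_rtrig_prod:
  fixes a :: "nat \<Rightarrow> nat"
  assumes "finite A" "\<And>k. k \<in> A \<Longrightarrow> rtrig d (P k)"
    and "\<And>k k'. k \<in> A \<Longrightarrow> k' \<in> A \<Longrightarrow> k < k' \<Longrightarrow> (d + 1) * a k < a k'" "\<And>k. k \<in> A \<Longrightarrow> a k > 0"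
  shows "(\<integral>x. (\<Prod>k\<in>A. P k (real (a k) * x)) \<partial>U) = (\<Prod>k\<in>A. (\<integral>x. P k x \<partial>U))"
proof -
  have "complex_of_real (\<integral>x. (\<Prod>k\<in>A. P k (real (a k) * x)) \<partial>U) = of_real (\<Prod>k\<in>A. (\<integral>x. P k x \<partial>U))"
    using integral_trigpoly_prod[of A d "\<lambda>k x. complex_of_real (P k x)" a, OF assms]
    by (simp flip: of_real_prod)
  then show ?thesis by (simp only: of_real_eq_iff)
qed

text \<open>The quadratic majorant of the exponential is a polynomial of degree at most
  \<open>2 * d\<close>, whence the gap \<open>2 * d + 1\<close>. Its product integrates exactly, and
  \<open>1 + z \<le> exp z\<close> returns to an exponential only after integration. A small
  \<open>e\<close> gives nearly the Gaussian constant, \<open>e = 1/2\<close> a crude one.\<close>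

lemma rtrig_mgf_le:
  fixes a :: "nat \<Rightarrow> nat"
  assumes fin: "finite A" and p: "rtrig d p" "(\<integral>x. p x \<partial>U) = 0" "\<And>x. \<bar>p x\<bar> \<le> B"
    and gap: "\<And>k k'. k \<in> A \<Longrightarrow> k' \<in> A \<Longrightarrow> k < k' \<Longrightarrow> (2 * d + 1) * a k < a k'" "\<And>k. k \<in> A \<Longrightarrow> a k > 0"
    and lam: "\<bar>l\<bar> * B \<le> e" "e \<le> 1/2"
  shows "(\<integral>x. exp (l * (\<Sum>k\<in>A. p (real (a k) * x))) \<partial>U) \<le> exp ((1/2 + e) * l\<^sup>2 * (\<integral>x. (p x)\<^sup>2 \<partial>U) * real (card A))"
proof -
  \<comment> \<open>The Taylor coefficient \<open>1/2\<close>, raised by \<open>e\<close> to absorb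
    the cubic remainder, which is at most \<open>e * (l * p x)^2 / 2\<close>.\<close>
  define c where "c = (1/2 + e) * l\<^sup>2"
  define Q where "Q = (\<lambda>x. 1 + l * p x + c * (p x)\<^sup>2)"
  have [measurable]: "p \<in> borel_measurable borel" by (rule rtrig_measurable[OF p(1)])
  have lp: "\<bar>l * p x\<bar> \<le> e" for x
    using mult_left_mono[OF p(3)[of x], of "\<bar>l\<bar>"] lam(1) by (simp add: abs_mult)
  then have e0: "e \<ge> 0" using abs_ge_zero order_trans by blast
  have eQ: "exp (l * p x) \<le> Q x" for x
  proof -
    have "exp (l * p x) \<le> 1 + l * p x + (l * p x)\<^sup>2/2 + \<bar>l * p x\<bar>^3/2"
      using lp[of x] lam(2) by (intro exp_taylor2) auto
    also have "\<bar>l * p x\<bar>^3 = \<bar>l * p x\<bar> * (l * p x)\<^sup>2" by (simp add: power3_eq_cube power2_eq_square flip: abs_mult)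
    also have "\<dots> \<le> e * (l * p x)\<^sup>2" by (intro mult_right_mono lp) auto
    finally have "exp (l * p x) \<le> 1 + l * p x + (l * p x)\<^sup>2/2 + e * (l * p x)\<^sup>2 / 2" by simp
    also have "e * (l * p x)\<^sup>2 / 2 \<le> e * (l * p x)\<^sup>2" using e0 by simp
    finally show ?thesis by (simp add: Q_def c_def power_mult_distrib algebra_simps)
  qed
  have Q: "rtrig (2 * d) Q" unfolding Q_def by (rule rtrig_quadratic[OF p(1)])
  have [measurable]: "Q \<in> borel_measurable borel" by (rule rtrig_measurable[OF Q])
  have Qpos: "Q x \<ge> 0" for x using eQ[of x] by (meson exp_ge_zero order_trans)
  obtain C where C: "\<And>x. \<bar>Q x\<bar> \<le> C" using rtrig_bounded[OF Q] by blast
  have iQ: "(\<integral>x. Q x \<partial>U) = 1 + c * (\<integral>x. (p x)\<^sup>2 \<partial>U)"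
  proof -
    have "integrable U p" by (rule integrable_U[where c=B]) (use p(3) in auto)
    moreover have "integrable U (\<lambda>x. (p x)\<^sup>2)"
      by (rule integrable_U[where c="B\<^sup>2"]) (use power_mono[OF p(3) abs_ge_zero, where n=2] in auto)
    ultimately show ?thesis unfolding Q_def using U.prob_space by (simp add: p(2))
  qed
  have "(\<integral>x. exp (l * (\<Sum>k\<in>A. p (real (a k) * x))) \<partial>U) \<le> (\<integral>x. (\<Prod>k\<in>A. Q (real (a k) * x)) \<partial>U)"
  proof (rule integral_mono)
    show "integrable U (\<lambda>x. \<Prod>k\<in>A. Q (real (a k) * x))"
      by (rule integrable_U[where c="\<Prod>k\<in>A. C"]) (auto simp: abs_prod simp del: prod_constant intro!: prod_mono C)
    have pt: "exp (l * (\<Sum>k\<in>A. p (real (a k) * x))) \<le> (\<Prod>k\<in>A. Q (real (a k) * x))" for x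
      by (auto simp: sum_distrib_left exp_sum[OF fin] intro!: prod_mono eQ)
    then show "exp (l * (\<Sum>k\<in>A. p (real (a k) * x))) \<le> (\<Prod>k\<in>A. Q (real (a k) * x))" for x .
    show "integrable U (\<lambda>x. exp (l * (\<Sum>k\<in>A. p (real (a k) * x))))"
    proof (rule integrable_U[where c="\<Prod>k\<in>A. C"])
      have "(\<Prod>k\<in>A. Q (real (a k) * x)) \<le> (\<Prod>k\<in>A. C)" for x
        by (intro prod_mono) (use C Qpos in \<open>auto simp: abs_le_iff\<close>)
      then show "norm (exp (l * (\<Sum>k\<in>A. p (real (a k) * x)))) \<le> (\<Prod>k\<in>A. C)" for x
        unfolding real_norm_def abs_exp_cancel by (rule order_trans[OF pt])
    qed measurable
  qed
  also have "\<dots> = (\<Prod>k\<in>A. (\<integral>x. Q x \<partial>U))"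
    by (rule integral_rtrig_prod[OF fin Q]) (use gap in auto)
  also have "\<dots> \<le> (\<Prod>k\<in>A. exp (c * (\<integral>x. (p x)\<^sup>2 \<partial>U)))"
  proof (intro prod_mono conjI)
    show "0 \<le> (\<integral>x. Q x \<partial>U)" using Qpos by (intro integral_nonneg_AE) auto
  qed (simp add: iQ)
  also have "\<dots> = exp ((1/2 + e) * l\<^sup>2 * (\<integral>x. (p x)\<^sup>2 \<partial>U) * real (card A))"
    by (simp add: c_def exp_of_nat_mult[symmetric] mult_ac)
  finally show ?thesis .
qed

subsection \<open>A positive trigonometric kernel\<close>

text \<open>The de la Vallee-Poussin kernel. An even power of the cosine is nonnegative and of
  degree \<open>d\<close> at once; the constant Fourier coefficient of
  \<open>(2 * cos (pi * t)) ^ (2 * d)\<close> is the central binomial coefficient, so the mass is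
  1.\<close>

definition kern :: "nat \<Rightarrow> real \<Rightarrow> real" where
  "kern d t = cos (pi * t) ^ (2 * d) * 4 ^ d / real ((2 * d) choose d)"

lemma kern_nonneg: "kern d t \<ge> 0"
  by (simp add: kern_def)

lemma kern_le: "kern d t \<le> 4 ^ d"
proof -
  have "cos (pi * t) ^ (2 * d) \<le> 1" by (simp add: power_mult power_le_one abs_square_le_1)
  moreover have "1 \<le> real ((2 * d) choose d)" by (simp add: Suc_leI)
  ultimately have "cos (pi * t) ^ (2 * d) / real ((2 * d) choose d) \<le> 1" by (simp add: divide_le_eq)
  then show ?thesis unfolding kern_def using mult_right_mono[of _ 1 "4^d :: real"] by (simp add: divide_simps mult_ac)
qed

lemma kern_measurable [measurable]: "kern d \<in> borel_measurable borel"
  unfolding kern_def[abs_def] by measurable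

lemma kern_trig_sum:
  "complex_of_real (kern d t) =
    (\<Sum>k\<le>2*d. of_nat ((2 * d) choose k) / of_nat ((2 * d) choose d) * cis (2 * pi * of_int (int k - int d) * t))"
proof -
  have "complex_of_real ((2 * cos (pi * t)) ^ (2 * d)) = (cis (pi * t) + cis (- (pi * t))) ^ (2 * d)"
  proof -
    have "complex_of_real (2 * cos (pi * t)) = cis (pi * t) + cis (- (pi * t))"
      by (simp add: complex_eq_iff)
    then show ?thesis by (simp only: of_real_power)
  qed
  also have "\<dots> = (\<Sum>k\<le>2*d. of_nat ((2 * d) choose k) * (cis (pi * t) ^ k * cis (- (pi * t)) ^ (2 * d - k)))"
    by (subst binomial_ring) (simp add: mult.assoc)
  also have "\<dots> = (\<Sum>k\<le>2*d. of_nat ((2 * d) choose k) * cis (2 * pi * of_int (int k - int d) * t))"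
  proof (intro sum.cong refl arg_cong2[where f="(*)"])
    fix k assume "k \<in> {..2 * d}"
    then have "real k * (pi * t) + real (2 * d - k) * (- (pi * t)) = 2 * pi * of_int (int k - int d) * t"
      by (simp add: of_nat_diff algebra_simps)
    then show "cis (pi * t) ^ k * cis (- (pi * t)) ^ (2 * d - k) = cis (2 * pi * of_int (int k - int d) * t)"
      unfolding Complex.DeMoivre cis_mult by metis
  qed
  finally have *: "complex_of_real ((2 * cos (pi * t)) ^ (2 * d)) = \<dots>" .
  have "kern d t = (2 * cos (pi * t)) ^ (2 * d) / real ((2 * d) choose d)"
    by (simp add: kern_def power_mult_distrib power_mult)
  then show ?thesis using * by (simp add: sum_divide_distrib)
qed

lemma kern_rtrig: "rtrig d (kern d)"
  unfolding kern_trig_sum by (intro trigpoly_sum trigpoly_cmult trigpoly_cis) auto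

lemma integral_kern: "(\<integral>t. kern d t \<partial>U) = 1"
proof -
  have "complex_of_real (\<integral>t. kern d t \<partial>U) = (\<integral>t. complex_of_real (kern d t) \<partial>U)" by simp
  also have "\<dots> = (\<Sum>k\<le>2*d. of_nat ((2 * d) choose k) / of_nat ((2 * d) choose d) * (if int k - int d = 0 then 1 else 0))"
    unfolding kern_trig_sum
    by (subst Bochner_Integration.integral_sum) (auto simp: integrable_cis integral_cis simp del: of_int_diff)
  also have "\<dots> = (\<Sum>k\<le>2*d. if k = d then 1 else 0)"
    by (intro sum.cong) auto
  also have "\<dots> = 1" by simp
  finally show ?thesis by simp
qed

text \<open>Multiplication by \<open>cos^2\<close> turns the kernel into \<open>q\<close> times the
  next one, where \<open>q\<close> is the ratio of the normalisations. Both have mass 1, so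
  \<open>sin^2\<close> has mean \<open>1 - q\<close>.\<close>

lemma integral_kern_sin2: "(\<integral>t. (sin (pi * t))\<^sup>2 * kern d t \<partial>U) = 1 / (2 * real d + 2)"
proof -
  have c: "real (Suc d) * real ((2 * Suc d) choose (Suc d)) = 2 * (2 * real d + 1) * real ((2 * d) choose d)"
  proof -
    have "Suc d * ((2 * Suc d) choose (Suc d)) = (2 * Suc d) * ((2 * d + 1) choose d)"
      using Suc_times_binomial_eq[of "2 * d + 1" d] by simp
    moreover have "Suc d * ((2 * d + 1) choose d) = (2 * d + 1) * ((2 * d) choose d)"
      using binomial_absorb_comp[of "2 * d + 1" d] by simp
    ultimately have "Suc d * (Suc d * ((2 * Suc d) choose (Suc d))) = Suc d * (2 * (2 * d + 1) * ((2 * d) choose d))"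
      by (metis (no_types, lifting) mult.assoc mult.left_commute)
    then have "Suc d * ((2 * Suc d) choose (Suc d)) = 2 * (2 * d + 1) * ((2 * d) choose d)"
      using mult_cancel1 by blast
    then have "real (Suc d * ((2 * Suc d) choose (Suc d))) = real (2 * (2 * d + 1) * ((2 * d) choose d))" by (simp only:)
    then show ?thesis unfolding of_nat_mult of_nat_add by simp
  qed
  have pos: "real ((2 * d) choose d) > 0" by simp
  define q where "q = (2 * real d + 1) / (2 * real d + 2)"
  have c2: "4 * real ((2 * d) choose d) * q = real ((2 * Suc d) choose (Suc d))"
    using c by (simp add: q_def field_simps)
  have "(cos (pi * t))\<^sup>2 * kern d t = q * kern (Suc d) t" for t
    unfolding kern_def c2[symmetric] using pos by (simp add: power2_eq_square q_def divide_simps)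
  then have "(sin (pi * t))\<^sup>2 * kern d t = kern d t - q * kern (Suc d) t" for t
    by (simp add: sin_squared_eq left_diff_distrib)
  moreover have "integrable U (kern d)" for d
    by (rule integrable_U[where c="4^d"]) (auto simp: kern_nonneg kern_le)
  ultimately have "(\<integral>t. (sin (pi * t))\<^sup>2 * kern d t \<partial>U) = 1 - q"
    by (simp add: integral_kern)
  then show ?thesis by (simp add: q_def field_simps)
qed

text \<open>Cauchy-Schwarz in the form \<open>u \<le> s / 2 * u^2 + 1 / (2 * s)\<close>. The weight
  \<open>s\<close> is the root of the inverse second moment, so that both terms contribute
  \<open>1 / (2 * s)\<close>.\<close>

lemma integral_kern_sin_le: "(\<integral>t. sin (pi * t) * kern d t \<partial>U) \<le> 1 / sqrt (2 * real d + 2)"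
proof -
  define s where "s = sqrt (2 * real d + 2)"
  have s: "s > 0" "s * s = 2 * real d + 2" by (simp_all add: s_def)
  have ik: "integrable U (kern d)"
    by (rule integrable_U[where c="4^d"]) (auto simp: kern_nonneg kern_le)
  have b: "\<bar>u * kern d t\<bar> \<le> 4 ^ d" if "\<bar>u\<bar> \<le> 1" for u t
    using mult_mono[OF that kern_le[of d t]] by (simp add: abs_mult kern_nonneg)
  have i1: "integrable U (\<lambda>t. sin (pi * t) * kern d t)"
    by (rule integrable_U[where c="4^d"]) (auto intro!: b)
  have i2: "integrable U (\<lambda>t. (sin (pi * t))\<^sup>2 * kern d t)"
    by (rule integrable_U[where c="4^d"]) (auto intro!: b simp: abs_square_le_1)
  have am: "u \<le> s / 2 * u\<^sup>2 + 1 / (2 * s)" for u :: real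
  proof -
    have "s / 2 * u\<^sup>2 + 1 / (2 * s) - u = (s * u - 1)\<^sup>2 / (2 * s)"
      using s(1) by (simp add: field_simps power2_eq_square)
    also have "\<dots> \<ge> 0" using s(1) by simp
    finally show ?thesis by simp
  qed
  have "(\<integral>t. sin (pi * t) * kern d t \<partial>U) \<le> (\<integral>t. s / 2 * ((sin (pi * t))\<^sup>2 * kern d t) + 1 / (2 * s) * kern d t \<partial>U)"
  proof (rule integral_mono[OF i1])
    show "sin (pi * t) * kern d t \<le> s / 2 * ((sin (pi * t))\<^sup>2 * kern d t) + 1 / (2 * s) * kern d t" for t
      using mult_right_mono[OF am[of "sin (pi * t)"] kern_nonneg[of d t]] by (simp add: algebra_simps)
  qed (intro Bochner_Integration.integrable_add integrable_mult_right i2 ik)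
  also have "\<dots> = s / 2 * (1 / (s * s)) + 1 / (2 * s)"
    unfolding s(2) by (simp add: i2 ik integral_kern integral_kern_sin2)
  also have "\<dots> = 1 / s" using s(1) by (simp add: field_simps)
  finally show ?thesis by (simp add: s_def)
qed

section \<open>Averages against the kernel\<close>

lemma Fubini_U:
  fixes f :: "real \<Rightarrow> real \<Rightarrow> real"
  assumes m: "(\<lambda>z. f (fst z) (snd z)) \<in> borel_measurable (borel \<Otimes>\<^sub>M borel)" and b: "\<And>x t. \<bar>f x t\<bar> \<le> c"
  shows "(\<integral>x. (\<integral>t. f x t \<partial>U) \<partial>U) = (\<integral>t. (\<integral>x. f x t \<partial>U) \<partial>U)"
proof -
  interpret P: pair_prob_space U U ..
  have "sets (U \<Otimes>\<^sub>M U) = sets (borel \<Otimes>\<^sub>M borel)" by (intro sets_pair_measure_cong) auto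
  then have "(\<lambda>z. f (fst z) (snd z)) \<in> borel_measurable (U \<Otimes>\<^sub>M U)" using m measurable_cong_sets by blast
  then have "integrable (U \<Otimes>\<^sub>M U) (\<lambda>(x, t). f x t)"
    by (intro P.integrable_const_bound[where B=c]) (auto simp: b split_beta')
  from P.Fubini_integral[OF this] show ?thesis by simp
qed

lemma integral_U_partial_measurable:
  fixes f :: "real \<Rightarrow> real \<Rightarrow> real"
  assumes "(\<lambda>z. f (fst z) (snd z)) \<in> borel_measurable (borel \<Otimes>\<^sub>M borel)"
  shows "(\<lambda>x. \<integral>t. f x t \<partial>U) \<in> borel_measurable borel"
proof -
  have "sets (borel \<Otimes>\<^sub>M U) = sets (borel \<Otimes>\<^sub>M borel)" by (intro sets_pair_measure_cong) auto
  then have "(\<lambda>(x, t). f x t) \<in> borel_measurable (borel \<Otimes>\<^sub>M U)"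
    using assms measurable_cong_sets by (auto simp: split_beta')
  then show ?thesis by (rule U.borel_measurable_lebesgue_integral)
qed

lemma integral_U_le_const: 
  fixes f :: "real \<Rightarrow> real"
  assumes "f \<in> borel_measurable borel" "\<And>x. \<bar>f x\<bar> \<le> c"
  shows "(\<integral>x. f x \<partial>U) \<le> c" "\<bar>\<integral>x. f x \<partial>U\<bar> \<le> c"
proof -
  have "\<bar>\<integral>x. f x \<partial>U\<bar> \<le> (\<integral>x. \<bar>f x\<bar> \<partial>U)" by (rule integral_abs_bound)
  also have "\<dots> \<le> (\<integral>x. c \<partial>U)" by (rule integral_mono) (use assms in \<open>auto intro!: integrable_U[where c=c]\<close>)
  also have "\<dots> = c" using U.prob_space by simp
  finally show "\<bar>\<integral>x. f x \<partial>U\<bar> \<le> c" .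
  then show "(\<integral>x. f x \<partial>U) \<le> c" by simp
qed

lemma integrable_kern: "integrable U (kern d)"
  by (rule integrable_U[where c="4^d"]) (auto simp: kern_nonneg kern_le)

text \<open>As the kernel is even, this correlation is the usual convolution.\<close>

definition conv :: "nat \<Rightarrow> (real \<Rightarrow> real) \<Rightarrow> real \<Rightarrow> real" where
  "conv d h x = (\<integral>t. h (x + t) * kern d t \<partial>U)"

lemma kern_abs_mult_le: "\<bar>u\<bar> \<le> c \<Longrightarrow> \<bar>u * kern d t\<bar> \<le> c * 4 ^ d"
  unfolding abs_mult using kern_le[of d t] kern_nonneg[of d t] by (intro mult_mono) auto

context
  fixes h :: "real \<Rightarrow> real" and c :: real
  assumes hm [measurable]: "h \<in> borel_measurable borel" and hp: "periodic1 h" and hb: "\<And>x. \<bar>h x\<bar> \<le> c"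
begin

text \<open>By periodicity the translation by \<open>x\<close> can be moved from \<open>h\<close>
  into the kernel, whose Fourier expansion separates \<open>x\<close> from the variable of
  integration.\<close>

lemma rtrig_conv: "rtrig d (conv d h)"
proof -
  define j where "j k = int k - int d" for k
  define b where "b k = (of_nat ((2 * d) choose k) / of_nat ((2 * d) choose d) :: complex)" for k
  define I where "I k = (\<integral>s. complex_of_real (h s) * cis (2 * pi * of_int (j k) * s) \<partial>U)" for k
  have kp: "kern d (x + 1) = kern d x" for x
    using rtrig_periodic[OF kern_rtrig] by (simp add: periodic1_def)
  have "complex_of_real (conv d h x) = (\<Sum>k\<le>2*d. (b k * I k) * cis (2 * pi * of_int (- j k) * x))" for x
  proof -
    let ?G = "\<lambda>s. h s * kern d (s - x)"
    have pG: "periodic1 ?G"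
      using hp kp[of "_ - x"] by (auto simp: periodic1_def algebra_simps)
    have "(\<integral>t. ?G (t + x) \<partial>U) = (\<integral>s. ?G s \<partial>U)"
      by (rule integral_U_shift[OF _ _ pG, where c="c * 4^d"]) (auto intro: kern_abs_mult_le hb)
    then have "complex_of_real (conv d h x) = of_real (\<integral>s. ?G s \<partial>U)"
      by (simp add: conv_def add.commute)
    also have "\<dots> = (\<integral>s. complex_of_real (?G s) \<partial>U)" by (rule integral_complex_of_real[symmetric])
    also have "(\<lambda>s. complex_of_real (?G s))
        = (\<lambda>s. \<Sum>k\<le>2*d. b k * cis (2 * pi * of_int (- j k) * x) * (complex_of_real (h s) * cis (2 * pi * of_int (j k) * s)))"
    proof
      fix s
      have "cis (2 * pi * of_int (j k) * (s - x)) = cis (2 * pi * of_int (- j k) * x) * cis (2 * pi * of_int (j k) * s)" for k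
        unfolding cis_mult by (rule arg_cong[where f=cis]) (simp add: algebra_simps)
      then show "complex_of_real (?G s) = (\<Sum>k\<le>2*d. b k * cis (2 * pi * of_int (- j k) * x) * (complex_of_real (h s) * cis (2 * pi * of_int (j k) * s)))"
        unfolding of_real_mult kern_trig_sum j_def[symmetric] b_def[symmetric] sum_distrib_left
        by (intro sum.cong refl) (simp only: mult_ac)
    qed
    also have "(\<integral>s. (\<Sum>k\<le>2*d. b k * cis (2 * pi * of_int (- j k) * x) * (complex_of_real (h s) * cis (2 * pi * of_int (j k) * s))) \<partial>U)
       = (\<Sum>k\<le>2*d. b k * cis (2 * pi * of_int (- j k) * x) * I k)"
    proof -
      have [measurable]: "(\<lambda>s. cis (2 * pi * of_int (j k) * s)) \<in> borel_measurable borel" for k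
        by (rule borel_measurable_cis_linear)
      have "integrable U (\<lambda>s. complex_of_real (h s) * cis (2 * pi * of_int (j k) * s))" for k
        by (rule integrable_U[where c=c]) (auto simp: norm_mult hb)
      then show ?thesis unfolding I_def
        by (subst Bochner_Integration.integral_sum) (auto intro!: integrable_mult_right)
    qed
    also have "\<dots> = (\<Sum>k\<le>2*d. (b k * I k) * cis (2 * pi * of_int (- j k) * x))"
      by (intro sum.cong refl) (simp only: mult_ac)
    finally show ?thesis .
  qed
  then have e: "(\<lambda>x. complex_of_real (conv d h x)) = (\<lambda>x. \<Sum>k\<le>2*d. (b k * I k) * cis (2 * pi * of_int (- j k) * x))" by blast
  show ?thesis unfolding e
    by (intro trigpoly_sum trigpoly_cmult trigpoly_cis) (auto simp: j_def)
qed

lemma conv_measurable [measurable]: "conv d h \<in> borel_measurable borel"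
  by (rule rtrig_measurable[OF rtrig_conv])

lemma conv_periodic: "periodic1 (conv d h)"
  by (rule rtrig_periodic[OF rtrig_conv])

lemma integrable_conv: "integrable U (\<lambda>t. h (x + t) * kern d t)"
  by (rule integrable_U[where c="c * 4^d"]) (auto intro: kern_abs_mult_le hb)

lemma conv_abs_le: "\<bar>conv d h x\<bar> \<le> c"
proof -
  have "\<bar>conv d h x\<bar> \<le> (\<integral>t. \<bar>h (x + t) * kern d t\<bar> \<partial>U)"
    unfolding conv_def by (rule integral_abs_bound)
  also have "\<dots> \<le> (\<integral>t. c * kern d t \<partial>U)"
    by (intro integral_mono integrable_abs integrable_conv integrable_mult_right integrable_kern)
       (auto simp: abs_mult kern_nonneg intro!: mult_right_mono hb)
  also have "\<dots> = c" by (simp add: integral_kern)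
  finally show ?thesis .
qed

lemma integral_conv: "(\<integral>x. conv d h x \<partial>U) = (\<integral>x. h x \<partial>U)"
proof -
  have "(\<integral>x. conv d h x \<partial>U) = (\<integral>t. (\<integral>x. h (x + t) * kern d t \<partial>U) \<partial>U)"
    unfolding conv_def by (rule Fubini_U[where c="c * 4^d"]) (auto intro: kern_abs_mult_le hb)
  also have "\<dots> = (\<integral>t. (\<integral>x. h x \<partial>U) * kern d t \<partial>U)"
    using integral_U_shift[OF hm _ hp, of c] hb by simp
  also have "\<dots> = (\<integral>x. h x \<partial>U)" by (simp add: integral_kern)
  finally show ?thesis .
qed

end

text \<open>Minkowski's inequality for the \<open>L^1\<close> norm, by Fubini. The bound
  \<open>m\<close> is asked for on one period only, which is where the modulus in \<open>bvc\<close>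
  is controlled.\<close>

lemma kern_average_L1:
  fixes g :: "real \<Rightarrow> real \<Rightarrow> real"
  assumes m: "(\<lambda>z. g (fst z) (snd z)) \<in> borel_measurable (borel \<Otimes>\<^sub>M borel)"
    and b: "\<And>x t. \<bar>g x t\<bar> \<le> c"
    and mm: "m \<in> borel_measurable borel" "\<And>t. \<bar>m t\<bar> \<le> C"
    and le: "\<And>t. t \<in> {0..<1} \<Longrightarrow> (\<integral>x. \<bar>g x t\<bar> \<partial>U) \<le> m t"
  shows "(\<integral>x. \<bar>\<integral>t. g x t * kern d t \<partial>U\<bar> \<partial>U) \<le> (\<integral>t. m t * kern d t \<partial>U)"
proof -
  note [measurable] = m mm(1)
  have [measurable]: "g x \<in> borel_measurable borel" for x
    using measurable_compose[OF measurable_Pair1' m, of x] by simp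
  have [measurable]: "(\<lambda>x. g x t) \<in> borel_measurable borel" for t
    using measurable_compose[OF measurable_Pair2' m, of t] by simp
  have [measurable]: "(\<lambda>z. g (snd z) (fst z)) \<in> borel_measurable (borel \<Otimes>\<^sub>M borel)"
    using measurable_compose[OF measurable_Pair[OF measurable_snd measurable_fst] m] by simp
  have [measurable]: "(\<lambda>z. kern d (fst z)) \<in> borel_measurable (borel \<Otimes>\<^sub>M (borel :: real measure))"
    "(\<lambda>z. kern d (snd z)) \<in> borel_measurable ((borel :: real measure) \<Otimes>\<^sub>M borel)"
    using measurable_compose[OF measurable_fst kern_measurable] measurable_compose[OF measurable_snd kern_measurable] by auto
  have "(\<integral>x. \<bar>\<integral>t. g x t * kern d t \<partial>U\<bar> \<partial>U) \<le> (\<integral>x. (\<integral>t. \<bar>g x t\<bar> * kern d t \<partial>U) \<partial>U)"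
  proof (rule integral_mono)
    have 1: "(\<lambda>x. \<integral>t. g x t * kern d t \<partial>U) \<in> borel_measurable borel"
      by (rule integral_U_partial_measurable) measurable
    have 2: "(\<lambda>x. \<integral>t. \<bar>g x t\<bar> * kern d t \<partial>U) \<in> borel_measurable borel"
      by (rule integral_U_partial_measurable) measurable
    show "integrable U (\<lambda>x. \<bar>\<integral>t. g x t * kern d t \<partial>U\<bar>)"
      by (rule integrable_U[where c="c * 4^d"]) (use 1 in \<open>auto intro!: integral_U_le_const kern_abs_mult_le b\<close>)
    show "integrable U (\<lambda>x. \<integral>t. \<bar>g x t\<bar> * kern d t \<partial>U)"
      by (rule integrable_U[where c="c * 4^d"]) (use 2 in \<open>auto intro!: integral_U_le_const kern_abs_mult_le b\<close>)
    show "\<bar>\<integral>t. g x t * kern d t \<partial>U\<bar> \<le> (\<integral>t. \<bar>g x t\<bar> * kern d t \<partial>U)" for x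
      using integral_abs_bound[of U "\<lambda>t. g x t * kern d t"] by (simp add: abs_mult kern_nonneg)
  qed
  also have "\<dots> = (\<integral>t. (\<integral>x. \<bar>g x t\<bar> * kern d t \<partial>U) \<partial>U)"
    by (rule Fubini_U[where c="c * 4^d"]) (measurable, rule kern_abs_mult_le, simp add: b)
  also have "\<dots> \<le> (\<integral>t. m t * kern d t \<partial>U)"
  proof (rule integral_mono_AE)
    have 3: "(\<lambda>t. \<integral>x. \<bar>g x t\<bar> * kern d t \<partial>U) \<in> borel_measurable borel"
      by (rule integral_U_partial_measurable) measurable
    show "integrable U (\<lambda>t. \<integral>x. \<bar>g x t\<bar> * kern d t \<partial>U)"
      by (rule integrable_U[where c="c * 4^d"]) (use 3 in \<open>auto intro!: integral_U_le_const kern_abs_mult_le b\<close>)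
    show "integrable U (\<lambda>t. m t * kern d t)"
      by (rule integrable_U[where c="C * 4^d"]) (auto intro!: kern_abs_mult_le mm(2))
    show "AE t in U. (\<integral>x. \<bar>g x t\<bar> * kern d t \<partial>U) \<le> m t * kern d t"
      unfolding AE_U using mult_right_mono[OF le kern_nonneg] by auto
  qed
  finally show ?thesis .
qed

text \<open>The modulus \<open>sin (\<pi> t)\<close> is symmetric under \<open>t \<mapsto> 1 - t\<close>, is inherited by convolutions, and has
  a closed-form second moment against the kernel.\<close>
definition bvc :: "real \<Rightarrow> (real \<Rightarrow> real) \<Rightarrow> bool" where
  "bvc V h \<longleftrightarrow> h \<in> borel_measurable borel \<and> periodic1 h \<and> (\<forall>x. \<bar>h x\<bar> \<le> 1) \<and> (\<integral>x. h x \<partial>U) = 0 \<and>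
    (\<forall>t\<in>{0..<1}. (\<integral>x. \<bar>h (x + t) - h x\<bar> \<partial>U) \<le> V * sin (pi * t))"

section \<open>Smoothing within the class of controlled modulus\<close>

lemma bvcD:
  assumes "bvc V h"
  shows "h \<in> borel_measurable borel" "periodic1 h" "\<bar>h x\<bar> \<le> 1" "(\<integral>x. h x \<partial>U) = 0"
    "t \<in> {0..<1} \<Longrightarrow> (\<integral>x. \<bar>h (x + t) - h x\<bar> \<partial>U) \<le> V * sin (pi * t)"
  using assms by (auto simp: bvc_def)

lemma bvc_conv:
  assumes "bvc V h" shows "bvc V (conv d h)"
proof -
  note h = bvcD[OF assms]
  note [measurable] = h(1) conv_measurable[OF h(1-3)]
  have "(\<integral>x. \<bar>conv d h (x + s) - conv d h x\<bar> \<partial>U) \<le> V * sin (pi * s)" if s: "s \<in> {0..<1}" for s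
  proof -
    have "conv d h (x + s) - conv d h x = (\<integral>t. (h (x + t + s) - h (x + t)) * kern d t \<partial>U)" for x
      unfolding conv_def left_diff_distrib
      using integrable_conv[OF h(1-3), of "x + s" d] integrable_conv[OF h(1-3), of x d]
      by (subst Bochner_Integration.integral_diff) (simp_all add: add_ac)
    then have "(\<integral>x. \<bar>conv d h (x + s) - conv d h x\<bar> \<partial>U) = (\<integral>x. \<bar>\<integral>t. (h (x + t + s) - h (x + t)) * kern d t \<partial>U\<bar> \<partial>U)"
      by simp
    also have "\<dots> \<le> (\<integral>t. V * sin (pi * s) * kern d t \<partial>U)"
    proof (rule kern_average_L1[where c=2 and C="\<bar>V * sin (pi * s)\<bar>"])
      show "(\<lambda>z. h (fst z + snd z + s) - h (fst z + snd z)) \<in> borel_measurable (borel \<Otimes>\<^sub>M borel)" by measurable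
      show "\<bar>h (x + t + s) - h (x + t)\<bar> \<le> 2" for x t
        using h(3)[of "x + t + s"] h(3)[of "x + t"] by linarith
      have "(\<integral>x. \<bar>h (x + t + s) - h (x + t)\<bar> \<partial>U) = (\<integral>x. \<bar>h (x + s) - h x\<bar> \<partial>U)" for t
      proof (rule integral_U_shift[where f="\<lambda>x. \<bar>h (x + s) - h x\<bar>" and c=2])
        show "norm \<bar>h (x + s) - h x\<bar> \<le> 2" for x using h(3)[of "x + s"] h(3)[of x] by simp
        show "periodic1 (\<lambda>x. \<bar>h (x + s) - h x\<bar>)"
          using h(2) unfolding periodic1_def by (metis add.commute add.left_commute)
      qed auto
      then show "(\<integral>x. \<bar>h (x + t + s) - h (x + t)\<bar> \<partial>U) \<le> V * sin (pi * s)" for t using h(5)[OF s] by simp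
    qed auto
    also have "\<dots> = V * sin (pi * s)" by (simp add: integral_kern)
    finally show ?thesis .
  qed
  then show ?thesis unfolding bvc_def
    using conv_abs_le[OF h(1-3)] conv_periodic[OF h(1-3)] integral_conv[OF h(1-3)] h(4) by auto
qed

lemma conv_L1_le:
  assumes "bvc V h" shows "(\<integral>x. \<bar>conv d h x\<bar> \<partial>U) \<le> (\<integral>x. \<bar>h x\<bar> \<partial>U)"
proof -
  note h = bvcD[OF assms]
  note [measurable] = h(1)
  have "(\<integral>x. \<bar>conv d h x\<bar> \<partial>U) \<le> (\<integral>t. (\<integral>x. \<bar>h x\<bar> \<partial>U) * kern d t \<partial>U)"
    unfolding conv_def
  proof (rule kern_average_L1[where c=1 and C="(\<integral>x. \<bar>h x\<bar> \<partial>U)"])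
    show "(\<integral>x. \<bar>h (x + t)\<bar> \<partial>U) \<le> (\<integral>x. \<bar>h x\<bar> \<partial>U)" for t
      using integral_U_shift[where f="\<lambda>x. \<bar>h x\<bar>" and c=1 and t=t] h by (auto simp: periodic1_def)
  qed (use h in auto)
  then show ?thesis by (simp add: integral_kern)
qed

text \<open>The error is an average of increments, so its \<open>L^1\<close> norm is at most the
  first moment of \<open>sin (pi * t)\<close> against the kernel, which decays like the inverse
  square root of the degree.\<close>

lemma conv_approx:
  assumes "bvc V h" "V \<ge> 0" shows "(\<integral>x. \<bar>conv d h x - h x\<bar> \<partial>U) \<le> V / sqrt (2 * real d + 2)"
proof -
  note h = bvcD[OF assms(1)]
  note [measurable] = h(1)
  have "conv d h x - h x = (\<integral>t. (h (x + t) - h x) * kern d t \<partial>U)" for x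
    unfolding conv_def left_diff_distrib
    using integrable_conv[OF h(1-3), of x d] integrable_kern
    by (subst Bochner_Integration.integral_diff) (simp_all add: integral_kern)
  then have "(\<integral>x. \<bar>conv d h x - h x\<bar> \<partial>U) = (\<integral>x. \<bar>\<integral>t. (h (x + t) - h x) * kern d t \<partial>U\<bar> \<partial>U)" by simp
  also have "\<dots> \<le> (\<integral>t. V * sin (pi * t) * kern d t \<partial>U)"
  proof (rule kern_average_L1[where c=2 and C="V"])
    show "\<bar>h (x + t) - h x\<bar> \<le> 2" for x t using h(3)[of "x + t"] h(3)[of x] by linarith
    show "\<bar>V * sin (pi * t)\<bar> \<le> V" for t using assms(2) by (simp add: abs_mult mult_left_le)
  qed (use h(5) in auto)
  also have "\<dots> = V * (\<integral>t. sin (pi * t) * kern d t \<partial>U)" by (simp add: mult.assoc)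
  also have "\<dots> \<le> V * (1 / sqrt (2 * real d + 2))"
    by (intro mult_left_mono integral_kern_sin_le assms)
  finally show ?thesis by simp
qed

subsection \<open>Exponential moments of smoothed functions\<close>

text \<open>The missing mass sits at the point 0, where the exponential is 1.\<close>
lemma exp_jensen:
  fixes w y :: "'a \<Rightarrow> real"
  assumes "\<And>j. j \<in> J \<Longrightarrow> w j \<ge> 0" "(\<Sum>j\<in>J. w j) \<le> 1"
  shows "exp (\<Sum>j\<in>J. w j * y j) \<le> (\<Sum>j\<in>J. w j * exp (y j)) + (1 - (\<Sum>j\<in>J. w j))"
proof -
  define z where "z = (\<Sum>j\<in>J. w j * y j)"
  define W where "W = (\<Sum>j\<in>J. w j)"
  have t: "exp z * (1 + (u - z)) \<le> exp u" for u
    using mult_left_mono[OF exp_ge_add_one_self[of "u - z"], of "exp z"] by (simp flip: exp_add)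
  have "exp z = exp z * ((W + z - W * z) + (1 - W) * (1 - z))" by (simp add: algebra_simps)
  also have "W + z - W * z = (\<Sum>j\<in>J. w j * (1 + (y j - z)))"
  proof -
    have "w j * (1 + (y j - z)) = w j + w j * y j - w j * z" for j by (simp add: algebra_simps)
    then show ?thesis by (simp add: W_def z_def[symmetric] sum.distrib sum_subtractf flip: sum_distrib_right)
  qed
  also have "exp z * (\<dots> + (1 - W) * (1 - z)) = (\<Sum>j\<in>J. w j * (exp z * (1 + (y j - z)))) + (1 - W) * (exp z * (1 + (0 - z)))"
    by (simp add: distrib_left sum_distrib_left mult_ac)
  also have "\<dots> \<le> (\<Sum>j\<in>J. w j * exp (y j)) + (1 - W) * exp 0"
    using assms by (intro add_mono sum_mono mult_left_mono t) (auto simp: W_def)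
  finally show ?thesis by (simp add: z_def W_def)
qed

text \<open>The increment of the smoothings from degree \<open>deg (i - 1)\<close> to \<open>deg i\<close> has \<open>L\<^sup>1\<close> norm of order
  \<open>2 ^ (- 64 i)\<close>. This beats the squares \<open>16 ^ (i + 1)\<close> of the inverse Jensen weights in the exponential moment bound.\<close>
definition deg :: "nat \<Rightarrow> nat" where "deg i = 2 ^ (128 * i)"

fun piece :: "(real \<Rightarrow> real) \<Rightarrow> nat \<Rightarrow> real \<Rightarrow> real" where
  "piece h 0 = conv (deg 0) h"
| "piece h (Suc i) = (\<lambda>x. conv (deg (Suc i)) h x - conv (deg i) h x)"

lemma sum_piece: "(\<Sum>i\<le>I. piece h i x) = conv (deg I) h x"
  by (induction I) auto

lemma conv_deg_approx:
  assumes "bvc V h" "V \<ge> 0" shows "(\<integral>x. \<bar>conv (deg i) h x - h x\<bar> \<partial>U) \<le> V / 2 ^ (64 * i)"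
proof -
  have "(2::real) ^ (64 * i) = sqrt ((2 ^ (64 * i))\<^sup>2)" by simp
  also have "(2 ^ (64 * i))\<^sup>2 = real (deg i)"
  proof -
    have "64 * i * 2 = 128 * i" by simp
    then show ?thesis by (simp only: deg_def of_nat_power of_nat_numeral flip: power_mult)
  qed
  also have "sqrt (real (deg i)) \<le> sqrt (2 * real (deg i) + 2)" by (intro real_sqrt_le_mono) simp
  finally have "V / sqrt (2 * real (deg i) + 2) \<le> V / 2 ^ (64 * i)" using assms(2) by (intro divide_left_mono) auto
  then show ?thesis using conv_approx[OF assms, of "deg i"] by linarith
qed

section \<open>Size of the increments between smoothings\<close>

lemma integral_square_le_L1:
  fixes p :: "real \<Rightarrow> real"
  assumes [measurable]: "p \<in> borel_measurable borel" and b: "\<And>x. \<bar>p x\<bar> \<le> B"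
  shows "(\<integral>x. (p x)\<^sup>2 \<partial>U) \<le> B * (\<integral>x. \<bar>p x\<bar> \<partial>U)"
proof -
  have s: "(p x)\<^sup>2 \<le> B * \<bar>p x\<bar>" for x
    using mult_right_mono[OF b[of x], of "\<bar>p x\<bar>"] by (simp add: power2_eq_square flip: abs_mult)
  have "B * \<bar>p x\<bar> \<le> B * B" for x
    using b[of x] by (intro mult_left_mono) auto
  then have "(p x)\<^sup>2 \<le> B * B" for x using s order_trans by blast
  then have "(\<integral>x. (p x)\<^sup>2 \<partial>U) \<le> (\<integral>x. B * \<bar>p x\<bar> \<partial>U)"
    by (intro integral_mono s integrable_mult_right integrable_U[where c="B * B"] integrable_U[where c=B]) (auto simp: b)
  then show ?thesis by simp
qed

context
  fixes V \<rho> :: real and h :: "real \<Rightarrow> real"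
  assumes bv: "bvc V h" and V: "V \<ge> 1" and rho: "(\<integral>x. \<bar>h x\<bar> \<partial>U) \<le> \<rho>" "\<rho> \<le> 1"
begin

lemma piece_rtrig: "rtrig (deg i) (piece h i)"
proof (cases i)
  case 0
  then show ?thesis using rtrig_conv[OF bvcD(1-3)[OF bv]] by simp
next
  case (Suc j)
  have "rtrig (deg i) (conv (deg j) h)"
    by (rule trigpoly_mono[OF rtrig_conv[OF bvcD(1-3)[OF bv]]]) (simp add: deg_def Suc)
  then show ?thesis using rtrig_diff[OF rtrig_conv[OF bvcD(1-3)[OF bv]]] Suc by simp
qed

lemma piece_measurable: "piece h i \<in> borel_measurable borel"
  by (rule rtrig_measurable[OF piece_rtrig])

lemma piece_abs_le: "\<bar>piece h i x\<bar> \<le> 2"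
proof -
  have c: "\<bar>conv d h x\<bar> \<le> 1" for d by (rule conv_abs_le[OF bvcD(1-3)[OF bv]])
  show ?thesis
  proof (cases i)
    case 0
    then show ?thesis using c[of "deg 0"] by simp
  next
    case (Suc j)
    then show ?thesis using c[of "deg i"] c[of "deg j"] by simp
  qed
qed

lemma integrable_conv_U: "integrable U (conv d h)"
  by (rule integrable_U[where c=1]) (use conv_measurable[OF bvcD(1-3)[OF bv]] conv_abs_le[OF bvcD(1-3)[OF bv]] in auto)

lemma integrable_bvc: "integrable U h"
  by (rule integrable_U[where c=1]) (use bvcD[OF bv] in auto)

lemma piece_integral: "(\<integral>x. piece h i x \<partial>U) = 0"
proof -
  have c: "(\<integral>x. conv d h x \<partial>U) = 0" for d
    using integral_conv[OF bvcD(1-3)[OF bv]] bvcD(4)[OF bv] by simp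
  show ?thesis by (cases i) (simp_all add: c integrable_conv_U)
qed

lemma rho_nonneg: "\<rho> \<ge> 0"
proof -
  have "0 \<le> (\<integral>x. \<bar>h x\<bar> \<partial>U)" by simp
  then show ?thesis using rho(1) by linarith
qed

text \<open>A piece is small for two unrelated reasons: it inherits the \<open>L^1\<close> size
  \<open>\<rho>\<close> of \<open>h\<close>, and it is the difference of two good approximations of
  \<open>h\<close>. The geometric mean of the two bounds keeps \<open>sqrt \<rho>\<close> together
  with the decay \<open>2 ^ (- 32 * j)\<close>. The constant is
  \<open>16 ^ (j + 2) * 4 = 2 ^ 10 * 16 ^ j\<close>.\<close>

lemma piece_square: "16 ^ (i + 1) * (\<integral>x. (piece h i x)\<^sup>2 \<partial>U) \<le> 2 ^ 10 * V * sqrt \<rho>"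
proof (cases i)
  case 0
  have c: "\<bar>conv d h x\<bar> \<le> 1" for d x by (rule conv_abs_le[OF bvcD(1-3)[OF bv]])
  have "(\<integral>x. (piece h i x)\<^sup>2 \<partial>U) \<le> 1 * (\<integral>x. \<bar>piece h i x\<bar> \<partial>U)"
    by (rule integral_square_le_L1[OF piece_measurable]) (simp add: 0 c)
  also have "\<dots> \<le> \<rho>" using conv_L1_le[OF bv, of "deg 0"] rho(1) 0 by simp
  also have "\<rho> = sqrt \<rho> * sqrt \<rho>" using rho_nonneg by simp
  also have "\<dots> \<le> 1 * sqrt \<rho>" using rho rho_nonneg by (intro mult_right_mono) auto
  also have "\<dots> \<le> V * sqrt \<rho>" using V rho_nonneg by (intro mult_right_mono) auto
  finally have *: "(\<integral>x. (piece h i x)\<^sup>2 \<partial>U) \<le> V * sqrt \<rho>" .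
  moreover have "0 \<le> V * sqrt \<rho>" using V rho_nonneg by simp
  ultimately show ?thesis using 0 by simp
next
  case (Suc j)
  define m where "m = (\<integral>x. \<bar>piece h i x\<bar> \<partial>U)"
  have m0: "m \<ge> 0" by (simp add: m_def)
  have tri: "m \<le> (\<integral>x. \<bar>conv (deg i) h x - u x\<bar> \<partial>U) + (\<integral>x. \<bar>conv (deg j) h x - u x\<bar> \<partial>U)"
    if u: "integrable U u" for u
  proof -
    have "m \<le> (\<integral>x. \<bar>conv (deg i) h x - u x\<bar> + \<bar>conv (deg j) h x - u x\<bar> \<partial>U)"
      unfolding m_def Suc piece.simps
      by (intro integral_mono integrable_abs Bochner_Integration.integrable_add Bochner_Integration.integrable_diff integrable_conv_U u) auto
    also have "\<dots> = (\<integral>x. \<bar>conv (deg i) h x - u x\<bar> \<partial>U) + (\<integral>x. \<bar>conv (deg j) h x - u x\<bar> \<partial>U)"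
      by (intro Bochner_Integration.integral_add integrable_abs Bochner_Integration.integrable_diff integrable_conv_U u)
    finally show ?thesis .
  qed
  have "m \<le> 2 * \<rho>"
    using tri[of "\<lambda>x. 0"] conv_L1_le[OF bv, of "deg i"] conv_L1_le[OF bv, of "deg j"] rho(1) by simp
  moreover have "m \<le> 2 * V / 2 ^ (64 * j)"
  proof -
    have "V / 2 ^ (64 * i) \<le> V / 2 ^ (64 * j)" using V Suc by (intro divide_left_mono power_increasing) auto
    then show ?thesis
      using tri[OF integrable_bvc] conv_deg_approx[OF bv, of i] conv_deg_approx[OF bv, of j] V by simp
  qed
  ultimately have "m * m \<le> (2 * \<rho>) * (2 * V / 2 ^ (64 * j))" using m0 V by (intro mult_mono) auto
  \<comment> \<open>Replacing \<open>V\<close> by \<open>V * V\<close> makes the right side a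
    perfect square and the final bound linear in \<open>V\<close>.\<close>
  also have "\<dots> \<le> (2 * \<rho>) * (2 * (V * V) / 2 ^ (64 * j))"
    using V rho_nonneg by (intro mult_left_mono divide_right_mono) auto
  also have "\<dots> = (2 * V * sqrt \<rho> / 2 ^ (32 * j)) * (2 * V * sqrt \<rho> / 2 ^ (32 * j))"
  proof -
    have p: "(2::real) ^ (64 * j) = 2 ^ (32 * j) * 2 ^ (32 * j)" by (simp flip: power_add)
    have r: "\<rho> = sqrt \<rho> * sqrt \<rho>" using rho_nonneg by simp
    show ?thesis unfolding p by (subst r) (simp add: mult_ac)
  qed
  finally have m: "m \<le> 2 * V * sqrt \<rho> / 2 ^ (32 * j)"
    using V rho_nonneg by (intro power2_le_imp_le[of m]) (auto simp: power2_eq_square)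
  have "(\<integral>x. (piece h i x)\<^sup>2 \<partial>U) \<le> 2 * m"
    unfolding m_def by (rule integral_square_le_L1[OF piece_measurable piece_abs_le])
  also have "\<dots> \<le> 2 * (2 * V * sqrt \<rho> / 2 ^ (32 * j))" using m by simp
  finally have "16 ^ (i + 1) * (\<integral>x. (piece h i x)\<^sup>2 \<partial>U) \<le> 16 ^ (i + 1) * (2 * (2 * V * sqrt \<rho> / 2 ^ (32 * j)))"
    by (intro mult_left_mono) auto
  also have "\<dots> = 2 ^ 10 * V * sqrt \<rho> * (16 ^ j / 2 ^ (32 * j))" by (simp add: Suc)
  also have "\<dots> \<le> 2 ^ 10 * V * sqrt \<rho> * 1"
  proof (intro mult_left_mono)
    have "(16::real) ^ j \<le> (2 ^ 32) ^ j" by (intro power_mono) auto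
    then show "16 ^ j / 2 ^ (32 * j) \<le> (1::real)" by (simp only: power_mult) simp
  qed (use V rho_nonneg in auto)
  finally show ?thesis by simp
qed

text \<open>Level \<open>i\<close> has \<open>i + 1\<close> residue classes, each with Jensen weight
  \<open>1 / 4 ^ (i + 1)\<close>; the sum is the total mass of these weights.\<close>

lemma class_weights: "(\<Sum>i\<le>I. (real i + 1) / 4 ^ (i + 1)) \<le> 1"
proof -
  have le: "(real i + 1) / 4 ^ (i + 1) \<le> 1 / 2 ^ (i + 1)" for i
  proof -
    have r: "real i + 1 \<le> 2 ^ (i + 1)"
      using of_nat_less_two_power[of "i + 1", where ?'a=real] by simp
    have e: "(4::real) ^ (i + 1) = 2 ^ (i + 1) * 2 ^ (i + 1)"
      by (simp only: flip: power_mult_distrib) simp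
    have "(real i + 1) / 4 ^ (i + 1) \<le> 2 ^ (i + 1) / 4 ^ (i + 1)"
      by (rule divide_right_mono[OF r]) simp
    then show ?thesis unfolding e by simp
  qed
  have "(\<Sum>i\<le>I. (real i + 1) / 4 ^ (i + 1)) \<le> (\<Sum>i\<le>I. 1 / 2 ^ (i + 1))" by (intro sum_mono le)
  also have "\<dots> = 1 - 1 / 2 ^ (I + 1)" by (induction I) (simp_all add: divide_simps)
  also have "\<dots> \<le> 1" by simp
  finally show ?thesis .
qed

text \<open>Within a residue class modulo \<open>i + 1\<close> the gaps exceed the degree of the \<open>i\<close>-th piece.\<close>
lemma conv_mgf_le:
  fixes a :: "nat \<Rightarrow> nat"
  assumes fin: "finite A"
    and gap: "\<And>k k'. k \<in> A \<Longrightarrow> k' \<in> A \<Longrightarrow> k < k' \<Longrightarrow> 2 ^ (130 * (k' - k)) * a k \<le> a k'" "\<And>k. k \<in> A \<Longrightarrow> a k > 0"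
    and lam: "\<bar>l\<bar> * 4 ^ (I + 2) \<le> 1"
  shows "(\<integral>x. exp (l * (\<Sum>k\<in>A. conv (deg I) h (real (a k) * x))) \<partial>U)
     \<le> exp (l\<^sup>2 * (2 ^ 10 * V * sqrt \<rho>) * real (card A))"
proof -
  define J where "J = Sigma {..I} (\<lambda>i. {..i})"
  define w where "w = (\<lambda>(i::nat, c::nat). 1 / (4::real) ^ (i + 1))"
  define C where "C = (\<lambda>(i, c). {k \<in> A. k mod (i + 1) = c})"
  define X where "X = (\<lambda>j x. \<Sum>k\<in>C j. piece h (fst j) (real (a k) * x))"
  define M where "M = l\<^sup>2 * (2 ^ 10 * V * sqrt \<rho>) * real (card A)"
  have M: "M \<ge> 0" using V rho_nonneg by (simp add: M_def)
  have finC: "finite (C j)" for j using fin by (auto simp: C_def split: prod.split)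
  have [measurable]: "piece h i \<in> borel_measurable borel" for i by (rule piece_measurable)
  have [measurable]: "X j \<in> borel_measurable borel" for j unfolding X_def by measurable
  have w0: "w j \<ge> 0" for j by (simp add: w_def split: prod.split)
  have "(\<Sum>j\<in>J. w j) = (\<Sum>i\<le>I. \<Sum>c\<le>i. 1 / (4::real) ^ (i + 1))"
    unfolding J_def w_def by (subst sum.Sigma) auto
  also have "\<dots> = (\<Sum>i\<le>I. (real i + 1) / 4 ^ (i + 1))"
    by (intro sum.cong refl) (simp add: add.commute)
  also have "\<dots> \<le> 1" by (rule class_weights)
  finally have w1: "(\<Sum>j\<in>J. w j) \<le> 1" .
  have split: "(\<Sum>k\<in>A. conv (deg I) h (real (a k) * x)) = (\<Sum>j\<in>J. X j x)" for x
  proof -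
    have "(\<Sum>k\<in>A. conv (deg I) h (real (a k) * x)) = (\<Sum>i\<le>I. \<Sum>k\<in>A. piece h i (real (a k) * x))"
      unfolding sum_piece[symmetric] by (rule sum.swap)
    also have "\<dots> = (\<Sum>i\<le>I. \<Sum>c\<le>i. X (i, c) x)"
    proof (rule sum.cong[OF refl])
      fix i
      show "(\<Sum>k\<in>A. piece h i (real (a k) * x)) = (\<Sum>c\<le>i. X (i, c) x)"
        unfolding X_def C_def
        using sum.group[of A "{..i}" "\<lambda>k. k mod (i + 1)" "\<lambda>k. piece h i (real (a k) * x)"] fin
        by (simp add: less_Suc_eq_le[symmetric] image_subset_iff)
    qed
    also have "\<dots> = (\<Sum>j\<in>J. X j x)" unfolding J_def by (subst sum.Sigma) auto
    finally show ?thesis .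
  qed
  have mgf: "(\<integral>x. exp (l * X j x / w j) \<partial>U) \<le> exp M" if j: "j \<in> J" for j
  proof -
    obtain i c where ic: "j = (i, c)" "i \<le> I" "c \<le> i" using j by (auto simp: J_def)
    have w: "l * X j x / w j = (l * 4 ^ (i + 1)) * (\<Sum>k\<in>C j. piece h i (real (a k) * x))" for x
      by (simp add: ic w_def X_def)
    have "(\<integral>x. exp ((l * 4 ^ (i + 1)) * (\<Sum>k\<in>C j. piece h i (real (a k) * x))) \<partial>U)
      \<le> exp ((1/2 + 1/2) * (l * 4 ^ (i + 1))\<^sup>2 * (\<integral>x. (piece h i x)\<^sup>2 \<partial>U) * real (card (C j)))"
    proof (rule rtrig_mgf_le[OF finC piece_rtrig piece_integral piece_abs_le])
      \<comment> \<open>The tilt is divided by the Jensen weight and the pieces are bounded by 2, so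
        \<open>\<bar>l\<bar> * 4 ^ (i + 1) * 2 \<le> 1/2\<close> is required. This is the origin of
        the exponent \<open>I + 2\<close>.\<close>
      have "\<bar>l\<bar> * 4 ^ (i + 2) \<le> \<bar>l\<bar> * 4 ^ (I + 2)" using ic by (intro mult_left_mono power_increasing) auto
      then show "\<bar>l * 4 ^ (i + 1)\<bar> * 2 \<le> 1 / 2" using lam by (simp add: abs_mult)
    next
      fix k k' assume k: "k \<in> C j" "k' \<in> C j" "k < k'"
      then have kA: "k \<in> A" "k' \<in> A" and "k mod (i + 1) = k' mod (i + 1)" by (auto simp: C_def ic)
      then have "(i + 1) dvd (k' - k)" using k(3) by (metis mod_eq_dvd_iff_nat less_imp_le)
      then have "i + 1 \<le> k' - k" using k(3) by (intro dvd_imp_le) auto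
      then have "(2::nat) ^ (130 * (i + 1)) \<le> 2 ^ (130 * (k' - k))" by (intro power_increasing mult_le_mono) auto
      then have le: "2 ^ (130 * (i + 1)) * a k \<le> a k'"
        using gap(1)[OF kA k(3)] by (meson mult_le_mono1 order_trans)
      \<comment> \<open>Members of one class differ by at least \<open>i + 1\<close>, so their ratio
        is at least \<open>2 ^ (130 * (i + 1))\<close>. The surplus of 130 over 128 covers the
        doubled degree of the quadratic majorant for every \<open>i\<close>.\<close>
      have "2 * deg i + 1 < (2::nat) ^ (128 * i + 2)" 
      proof -
        have "(1::nat) \<le> 2 ^ (128 * i)" by simp
        then show ?thesis unfolding deg_def power_add power2_eq_square by linarith
      qed
      also have "\<dots> \<le> 2 ^ (130 * (i + 1))" by (intro power_increasing) auto
      finally have "(2 * deg i + 1) * a k < 2 ^ (130 * (i + 1)) * a k" by (rule mult_strict_right_mono[OF _ gap(2)[OF kA(1)]])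
      then show "(2 * deg i + 1) * a k < a k'" using le by linarith
    qed (use gap in \<open>auto simp: C_def ic\<close>)
    also have "\<dots> \<le> exp M"
    proof -
      have "card (C j) \<le> card A" using fin by (intro card_mono) (auto simp: C_def ic)
      then have cc: "real (card (C j)) \<le> real (card A)" by simp
      have "l\<^sup>2 * (16 ^ (i + 1) * (\<integral>x. (piece h i x)\<^sup>2 \<partial>U)) \<le> l\<^sup>2 * (2 ^ 10 * V * sqrt \<rho>)"
        by (rule mult_left_mono[OF piece_square]) simp
      moreover have "0 \<le> l\<^sup>2 * (2 ^ 10 * V * sqrt \<rho>)" using V rho_nonneg by simp
      ultimately have "l\<^sup>2 * (16 ^ (i + 1) * (\<integral>x. (piece h i x)\<^sup>2 \<partial>U)) * real (card (C j)) \<le> M"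
        unfolding M_def using cc mult_mono[of _ _ "real (card (C j))" "real (card A)"] by (metis of_nat_0_le_iff)
      moreover have "(l * 4 ^ (i + 1))\<^sup>2 = l\<^sup>2 * 16 ^ (i + 1)"
        using power_mult_distrib[of "4::real" 4 i] by (simp add: power2_eq_square)
      ultimately show ?thesis by (simp add: mult_ac del: power_Suc)
    qed
    finally show ?thesis unfolding w .
  qed
  \<comment> \<open>Pointwise convexity takes the place of independence between different levels and
    classes, whose frequencies may overlap.\<close>
  have pt: "exp (l * (\<Sum>j\<in>J. X j x)) \<le> (\<Sum>j\<in>J. w j * exp (l * X j x / w j)) + (1 - (\<Sum>j\<in>J. w j))" for x
  proof -
    have "w j * (l * X j x / w j) = l * X j x" for j by (simp add: w_def split: prod.split)
    then have "l * (\<Sum>j\<in>J. X j x) = (\<Sum>j\<in>J. w j * (l * X j x / w j))" by (simp add: sum_distrib_left)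
    then show ?thesis using exp_jensen[of J w "\<lambda>j. l * X j x / w j"] w0 w1 by simp
  qed
  have Xb: "\<bar>X j x\<bar> \<le> 2 * real (card (C j))" for j x
    unfolding X_def using sum_norm_bound[of "C j" "\<lambda>k. piece h (fst j) (real (a k) * x)" 2] piece_abs_le by (simp add: mult.commute)
  have iexp: "integrable U (\<lambda>x. exp (r * X j x / w j))" for r j
  proof (rule integrable_U)
    show "norm (exp (r * X j x / w j)) \<le> exp (\<bar>r\<bar> * (2 * real (card (C j))) / w j)" for x
    proof -
      have "r * X j x \<le> \<bar>r\<bar> * (2 * real (card (C j)))"
        by (rule order_trans[OF abs_ge_self]) (auto simp: abs_mult intro!: mult_left_mono Xb)
      then show ?thesis using w0[of j] by (simp add: divide_right_mono)
    qed
  qed measurable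
  have iS: "integrable U (\<lambda>x. exp (l * (\<Sum>j\<in>J. X j x)))"
  proof (rule integrable_U)
    show "norm (exp (l * (\<Sum>j\<in>J. X j x))) \<le> exp (\<bar>l\<bar> * (\<Sum>j\<in>J. 2 * real (card (C j))))" for x
    proof -
      have "\<bar>\<Sum>j\<in>J. X j x\<bar> \<le> (\<Sum>j\<in>J. 2 * real (card (C j)))"
        by (rule order_trans[OF sum_abs]) (intro sum_mono Xb)
      then have "l * (\<Sum>j\<in>J. X j x) \<le> \<bar>l\<bar> * (\<Sum>j\<in>J. 2 * real (card (C j)))"
        by (intro order_trans[OF abs_ge_self[of "l * (\<Sum>j\<in>J. X j x)"]]) (simp add: abs_mult mult_left_mono)
      then show ?thesis by simp
    qed
  qed measurable
  have "(\<integral>x. exp (l * (\<Sum>j\<in>J. X j x)) \<partial>U)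
      \<le> (\<integral>x. (\<Sum>j\<in>J. w j * exp (l * X j x / w j)) + (1 - (\<Sum>j\<in>J. w j)) \<partial>U)"
    by (rule integral_mono[OF iS _ pt])
       (intro Bochner_Integration.integrable_add Bochner_Integration.integrable_sum integrable_mult_right iexp, simp)
  also have "\<dots> = (\<Sum>j\<in>J. w j * (\<integral>x. exp (l * X j x / w j) \<partial>U)) + (1 - (\<Sum>j\<in>J. w j))"
    using U.prob_space by (simp add: iexp)
  also have "\<dots> \<le> (\<Sum>j\<in>J. w j * exp M) + (1 - (\<Sum>j\<in>J. w j)) * exp M"
    using w1 M by (intro add_mono sum_mono mult_left_mono mgf w0) (auto simp: mult_le_cancel_left1)
  also have "\<dots> = exp M" unfolding sum_distrib_right[symmetric] by (simp add: algebra_simps)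
  finally show ?thesis unfolding split M_def .
qed

end

subsection \<open>Dyadic blocks of the permuted sequence\<close>

lemma U_Chernoff:
  fixes f :: "real \<Rightarrow> real"
  assumes [measurable]: "f \<in> borel_measurable borel" and b: "\<And>x. \<bar>f x\<bar> \<le> c" and s: "s > 0"
    and M: "(\<integral>x. exp (s * f x) \<partial>U) \<le> M"
  shows "measure U {x. y \<le> f x} \<le> M * exp (- s * y)"
proof -
  have "measure U {x \<in> space U. f x \<ge> y} = measure U {x \<in> space U. exp (s * f x) \<ge> exp (s * y)}"
    using s by simp
  also have "\<dots> \<le> (\<integral>x. exp (s * f x) \<partial>U) / exp (s * y)"
  proof (rule integral_Markov_inequality_measure[where A="{}"])
    have "s * f x \<le> s * c" for x using b[of x] s by simp
    then show "integrable U (\<lambda>x. exp (s * f x))"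
      by (intro integrable_U[where c="exp (s * c)"]) auto
  qed auto
  also have "\<dots> \<le> M / exp (s * y)" by (intro divide_right_mono M) auto
  finally show ?thesis by (simp add: exp_minus field_simps)
qed

lemma U_Chernoff_abs:
  fixes f :: "real \<Rightarrow> real"
  assumes [measurable]: "f \<in> borel_measurable borel" and b: "\<And>x. \<bar>f x\<bar> \<le> c" and s: "s > 0"
    and M: "\<And>s'. \<bar>s'\<bar> = s \<Longrightarrow> (\<integral>x. exp (s' * f x) \<partial>U) \<le> exp M"
  shows "measure U {x. y \<le> \<bar>f x\<bar>} \<le> 2 * exp (M - s * y)"
proof -
  have "measure U {x. y \<le> f x} \<le> exp M * exp (- s * y)"
    using s by (intro U_Chernoff[OF _ b s M]) auto
  moreover have "measure U {x. y \<le> - f x} \<le> exp M * exp (- s * y)"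
    using M[of "- s"] b s by (intro U_Chernoff[where c=c]) auto
  moreover have "measure U ({x. y \<le> f x} \<union> {x. y \<le> - f x}) \<le> measure U {x. y \<le> f x} + measure U {x. y \<le> - f x}"
    by (rule measure_Un_le) auto
  moreover have "{x. y \<le> \<bar>f x\<bar>} = {x. y \<le> f x} \<union> {x. y \<le> - f x}" by (auto simp: abs_if)
  ultimately show ?thesis by (simp add: exp_diff exp_minus divide_inverse)
qed

lemma U_Markov:
  fixes f :: "real \<Rightarrow> real"
  assumes [measurable]: "f \<in> borel_measurable borel" and b: "\<And>x. \<bar>f x\<bar> \<le> c" "\<And>x. 0 \<le> f x" and M: "(\<integral>x. f x \<partial>U) \<le> M"
  shows "measure U {x. 1 < f x} \<le> M"
proof -
  have "measure U {x. 1 < f x} \<le> measure U {x \<in> space U. 1 \<le> f x}"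
    by (rule U.finite_measure_mono) auto
  also have "\<dots> \<le> (\<integral>x. f x \<partial>U) / 1"
    by (rule integral_Markov_inequality_measure[where A="{}"]) (use b in \<open>auto intro!: integrable_U[where c=c]\<close>)
  finally show ?thesis using M by simp
qed

lemma U_union_le:
  assumes "finite I" "\<And>i. i \<in> I \<Longrightarrow> A i \<in> sets borel" "\<And>i. i \<in> I \<Longrightarrow> measure U (A i) \<le> (B::real)"
  shows "measure U (\<Union>i\<in>I. A i) \<le> real (card I) * B"
proof -
  have "measure U (\<Union>i\<in>I. A i) \<le> (\<Sum>i\<in>I. measure U (A i))"
    using assms by (intro U.finite_measure_subadditive_finite) auto
  also have "\<dots> \<le> real (card I) * B" using assms(3) by (rule sum_bounded_above)
  finally show ?thesis .
qed

lemma AE_eventually_U: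
  assumes "\<And>n. A n \<in> sets borel" "eventually (\<lambda>n. measure U (A n) \<le> g n) sequentially" "summable g"
  shows "AE x in U. eventually (\<lambda>n. x \<notin> A n) sequentially"
proof -
  have "summable (\<lambda>n. measure U (A n))"
    by (rule summable_comparison_test_ev[OF _ assms(3)]) (use assms(2) in simp)
  from borel_cantelli_AE1[of A U, OF _ _ this] show ?thesis
    using assms(1) by (simp add: U.emeasure_finite less_top[symmetric])
qed

text \<open>The inequality \<open>12 + 1 \<le> 12 * 2 powr (1/8)\<close> is what sums the geometric
  series of both chaining arguments; the constant 12 in their bounds comes from here.\<close>

lemma two_powr_eighth: "(13/12 :: real) \<le> 2 powr (1/8)"
proof -
  have e: "(2 powr (1/8) :: real) ^ 8 = 2" by (simp add: powr_power)
  have "(13/12 :: real) ^ Suc 7 \<le> (2 powr (1/8)) ^ Suc 7" using e by (simp add: power_divide)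
  then show ?thesis by (rule power_le_imp_le_base) simp
qed

text \<open>Chaining along the binary digits of \<open>M\<close>.\<close>
lemma dyadic_chain:
  fixes F :: "nat \<Rightarrow> real"
  assumes Y: "Y \<ge> 0"
    and block: "\<And>l i. l0 \<le> l \<Longrightarrow> l \<le> n \<Longrightarrow> i < 2 ^ (n - l) \<Longrightarrow>
      \<bar>F ((i + 1) * 2 ^ l) - F (i * 2 ^ l)\<bar> \<le> Y * 2 powr (- (real n - real l) / 8)"
    and inc: "\<And>u v. u \<le> v \<Longrightarrow> \<bar>F v - F u\<bar> \<le> real (v - u)"
    and L: "l0 \<le> L" "L \<le> n" and M: "M < 2 ^ n"
  shows "\<bar>F M - F (M div 2 ^ L * 2 ^ L)\<bar> \<le> 12 * Y * 2 powr (- (real n - real L) / 8) + real (M mod 2 ^ l0)"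
  using L
proof (induction L rule: dec_induct)
  case base
  have "\<bar>F M - F (M div 2 ^ l0 * 2 ^ l0)\<bar> \<le> real (M - M div 2 ^ l0 * 2 ^ l0)" by (intro inc) simp
  also have "M - M div 2 ^ l0 * 2 ^ l0 = M mod 2 ^ l0" by (simp add: minus_div_mult_eq_mod)
  also have "real (M mod 2 ^ l0) \<le> 12 * Y * 2 powr (- (real n - real l0) / 8) + real (M mod 2 ^ l0)" using Y by simp
  finally show ?case .
next
  case (step L)
  define q where "q = M div 2 ^ L"
  define z where "z = 2 powr (- (real n - real L) / 8)"
  have q2: "M div 2 ^ Suc L = q div 2" by (simp only: q_def power_Suc2 div_mult2_eq)
  have "q < 2 ^ (n - L)"
    unfolding q_def using M step.prems by (simp add: less_mult_imp_div_less flip: power_add)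
  \<comment> \<open>A binary digit 0 leaves the rounded value unchanged; a digit 1 costs exactly one
    dyadic block of length \<open>2 ^ L\<close>.\<close>
  have d: "\<bar>F (q * 2 ^ L) - F (M div 2 ^ Suc L * 2 ^ Suc L)\<bar> \<le> Y * z"
  proof (cases "even q")
    case True
    then have eq: "M div 2 ^ Suc L * 2 ^ Suc L = q * 2 ^ L" unfolding q2 by (elim evenE) simp
    show ?thesis unfolding eq using Y by (simp add: z_def)
  next
    case False
    then have eq: "M div 2 ^ Suc L * 2 ^ Suc L = (q - 1) * 2 ^ L"
      unfolding q2 by (elim oddE) simp
    have q1: "q - 1 + 1 = q" using False by (cases q) auto
    have "\<bar>F ((q - 1 + 1) * 2 ^ L) - F ((q - 1) * 2 ^ L)\<bar> \<le> Y * z"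
      unfolding z_def by (rule block) (use step \<open>q < 2 ^ (n - L)\<close> in auto)
    then show ?thesis unfolding eq q1 .
  qed
  have zS: "2 powr (- (real n - real (Suc L)) / 8) = z * 2 powr (1/8)"
    unfolding z_def by (subst powr_add[symmetric]) (simp add: field_simps)
  have "Y * z * (13 / 12) \<le> Y * z * 2 powr (1/8)" using Y by (intro mult_left_mono two_powr_eighth) (auto simp: z_def)
  then have zz: "12 * Y * z + Y * z \<le> 12 * Y * (z * 2 powr (1/8))" by simp
  have "\<bar>F M - F (M div 2 ^ Suc L * 2 ^ Suc L)\<bar>
      \<le> \<bar>F M - F (q * 2 ^ L)\<bar> + \<bar>F (q * 2 ^ L) - F (M div 2 ^ Suc L * 2 ^ Suc L)\<bar>" by simp
  also have "\<dots> \<le> (12 * Y * z + real (M mod 2 ^ l0)) + Y * z"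
    using step d by (intro add_mono) (auto simp: q_def z_def)
  also have "\<dots> \<le> 12 * Y * (z * 2 powr (1/8)) + real (M mod 2 ^ l0)" using zz by simp
  finally show ?case unfolding zS .
qed

section \<open>The gap condition and sums over sets of positions\<close>

locale permuted_lacunary =
  fixes a :: "nat \<Rightarrow> nat" and \<sigma> :: "nat \<Rightarrow> nat"
  assumes apos: "\<And>k. k \<ge> 1 \<Longrightarrow> a k > 0"
    and agap: "filterlim (\<lambda>k. real (a (Suc k)) / real (a k)) at_top sequentially"
    and perm: "bij_betw \<sigma> {1..} {1..}"
begin

lemma gap_power:
  assumes "G \<ge> (1::nat)"
  obtains k0 where "k0 \<ge> 1" "\<And>k k'. k0 \<le> k \<Longrightarrow> k \<le> k' \<Longrightarrow> G ^ (k' - k) * a k \<le> a k'"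
proof -
  from agap have "eventually (\<lambda>k. real (a (Suc k)) / real (a k) \<ge> real G) sequentially"
    by (simp add: filterlim_at_top)
  then obtain k1 where k1: "\<And>k. k \<ge> k1 \<Longrightarrow> real (a (Suc k)) / real (a k) \<ge> real G"
    by (auto simp: eventually_sequentially)
  define k0 where "k0 = max 1 k1"
  have s: "G * a k \<le> a (Suc k)" if "k \<ge> k0" for k
  proof -
    have "real G * real (a k) \<le> real (a (Suc k))"
      using k1[of k] apos[of k] that by (simp add: k0_def pos_le_divide_eq)
    then show ?thesis by (simp flip: of_nat_mult)
  qed
  have "G ^ (k' - k) * a k \<le> a k'" if "k0 \<le> k" "k \<le> k'" for k k'
    using that(2,1)
  proof (induction k' rule: dec_induct)
    case (step m)
    have "G ^ (Suc m - k) * a k = G * (G ^ (m - k) * a k)" using step by (simp add: Suc_diff_le)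
    also have "\<dots> \<le> G * a m" using step by (intro mult_left_mono) auto
    also have "\<dots> \<le> a (Suc m)" using step by (intro s) auto
    finally show ?case .
  qed simp
  then show ?thesis using that[of k0] by (simp add: k0_def)
qed

text \<open>The exponent \<open>k' - k\<close> records that skipping indices enlarges the gap.
  Residue classes exploit this; for a polynomial of fixed degree one factor \<open>G\<close> is
  enough.\<close>

definition gap_from :: "nat \<Rightarrow> nat \<Rightarrow> bool" where
  "gap_from G k0 \<longleftrightarrow> k0 \<ge> 1 \<and> (\<forall>k k'. k0 \<le> k \<longrightarrow> k \<le> k' \<longrightarrow> G ^ (k' - k) * a k \<le> a k')"

lemma gap_from_exists: "G \<ge> 1 \<Longrightarrow> \<exists>k0. gap_from G k0"
  unfolding gap_from_def by (metis gap_power)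

lemma gap_from_less:
  assumes "gap_from (G + 1) k0" "k0 \<le> k" "k < k'"
  shows "G * a k < a k'"
proof -
  have "a k > 0" using assms by (intro apos) (auto simp: gap_from_def)
  moreover have "(G + 1) ^ 1 * a k \<le> (G + 1) ^ (k' - k) * a k"
    using assms(3) by (intro mult_right_mono power_increasing) auto
  moreover have "(G + 1) ^ (k' - k) * a k \<le> a k'" using assms by (auto simp: gap_from_def)
  ultimately show ?thesis by (simp add: algebra_simps)
qed

lemma gap_from_pos: "gap_from G k0 \<Longrightarrow> k0 \<le> k \<Longrightarrow> a k > 0"
  by (auto simp: gap_from_def intro: apos)

definition psum :: "(real \<Rightarrow> real) \<Rightarrow> nat set \<Rightarrow> real \<Rightarrow> real" where
  "psum h B x = (\<Sum>k\<in>B. h (real (a (\<sigma> k)) * x))"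

text \<open>The finitely many other positions only contribute a bounded amount.\<close>
definition late :: "nat \<Rightarrow> nat set" where "late k0 = {k. k \<ge> 1 \<and> \<sigma> k \<ge> k0}"

lemma inj_sigma: "B \<subseteq> {1..} \<Longrightarrow> inj_on \<sigma> B"
  using perm by (meson bij_betw_imp_inj_on inj_on_subset)

lemma sigma_ge: "k \<ge> 1 \<Longrightarrow> \<sigma> k \<ge> 1"
  using perm by (auto simp: bij_betw_def)

lemma psum_image: "B \<subseteq> {1..} \<Longrightarrow> psum h B x = (\<Sum>k\<in>\<sigma> ` B. h (real (a k) * x))"
  unfolding psum_def by (subst sum.reindex[OF inj_sigma]) auto

lemma psum_measurable [measurable (raw)]:
  assumes [measurable]: "h \<in> borel_measurable borel"
  shows "psum h B \<in> borel_measurable borel"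
  unfolding psum_def[abs_def] by measurable

lemma psum_abs_le:
  assumes "\<And>x. \<bar>h x\<bar> \<le> c"
  shows "\<bar>psum h B x\<bar> \<le> c * real (card B)"
  unfolding psum_def using sum_norm_bound[of B "\<lambda>k. h (real (a (\<sigma> k)) * x)" c] assms by (simp add: mult.commute)

lemma early_finite: "finite {k. k \<ge> 1 \<and> \<sigma> k < k0}" "card {k. k \<ge> 1 \<and> \<sigma> k < k0} \<le> k0"
proof -
  have "\<sigma> ` {k. k \<ge> 1 \<and> \<sigma> k < k0} \<subseteq> {..<k0}" by auto
  moreover have i: "inj_on \<sigma> {k. k \<ge> 1 \<and> \<sigma> k < k0}" by (rule inj_sigma) auto
  ultimately show "finite {k. k \<ge> 1 \<and> \<sigma> k < k0}" by (meson finite_imageD finite_lessThan finite_subset)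
  show "card {k. k \<ge> 1 \<and> \<sigma> k < k0} \<le> k0"
    using card_inj_on_le[OF i \<open>\<sigma> ` _ \<subseteq> {..<k0}\<close>] by simp
qed

lemma card_late:
  assumes "finite B" "B \<subseteq> {1..}" shows "card B \<le> card (B \<inter> late k0) + k0"
proof -
  have "card B \<le> card (B \<inter> late k0 \<union> {k. k \<ge> 1 \<and> \<sigma> k < k0})"
    using assms early_finite(1)[of k0] by (intro card_mono) (auto simp: late_def)
  also have "\<dots> \<le> card (B \<inter> late k0) + card {k. k \<ge> 1 \<and> \<sigma> k < k0}" by (rule card_Un_le)
  finally show ?thesis using early_finite(2)[of k0] by simp
qed

lemma psum_split: "M \<le> N \<Longrightarrow> psum h {1..N} x = psum h {1..M} x + psum h {M<..N} x"
proof -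
  assume "M \<le> N"
  then have "{1..N} = {1..M} \<union> {M<..N}" by auto
  then show ?thesis unfolding psum_def by (simp add: sum.union_disjoint[symmetric] ivl_disj_int)
qed

lemma psum_late:
  assumes "\<And>x. \<bar>h x\<bar> \<le> c" "finite B" "B \<subseteq> {1..}"
  shows "\<bar>psum h B x - psum h (B \<inter> late k0) x\<bar> \<le> c * real k0"
proof -
  have c: "c \<ge> 0" using assms(1)[of 0] by simp
  have "psum h B x - psum h (B \<inter> late k0) x = psum h (B - late k0) x"
    unfolding psum_def using sum.Int_Diff[OF assms(2), of "\<lambda>k. h (real (a (\<sigma> k)) * x)" "late k0"] by simp
  also have "\<bar>\<dots>\<bar> \<le> c * real (card (B - late k0))" by (rule psum_abs_le) (rule assms)
  also have "\<dots> \<le> c * real k0"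
  proof -
    have "card (B - late k0) \<le> card {k. k \<ge> 1 \<and> \<sigma> k < k0}"
      using early_finite assms(3) by (intro card_mono) (auto simp: late_def)
    then show ?thesis using early_finite(2)[of k0] c by (intro mult_left_mono) auto
  qed
  finally show ?thesis .
qed

section \<open>Tails of smoothed sums and uniform block bounds\<close>

lemma psum_conv_tail:
  assumes bv: "bvc V h" "V \<ge> 1" "(\<integral>x. \<bar>h x\<bar> \<partial>U) \<le> \<rho>" "\<rho> \<le> 1"
    and k0: "gap_from (2 ^ 130) k0"
    and B: "finite B" "B \<subseteq> late k0" and l: "l > 0" "l * 4 ^ (I + 2) \<le> 1"
  shows "measure U {x. y \<le> \<bar>psum (conv (deg I) h) B x\<bar>} \<le> 2 * exp (l\<^sup>2 * (2 ^ 10 * V * sqrt \<rho>) * real (card B) - l * y)"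
proof -
  let ?X = "psum (conv (deg I) h) B"
  define M where "M = l\<^sup>2 * (2 ^ 10 * V * sqrt \<rho>) * real (card B)"
  note h = bvcD[OF bv(1)]
  have [measurable]: "conv (deg I) h \<in> borel_measurable borel" by (rule conv_measurable[OF h(1-3)])
  have B1: "B \<subseteq> {1..}" using B(2) by (auto simp: late_def)
  have mgf: "(\<integral>x. exp (l' * ?X x) \<partial>U) \<le> exp M" if "\<bar>l'\<bar> = l" for l'
  proof -
    have "(\<integral>x. exp (l' * (\<Sum>k\<in>\<sigma> ` B. conv (deg I) h (real (a k) * x))) \<partial>U)
       \<le> exp (l'\<^sup>2 * (2 ^ 10 * V * sqrt \<rho>) * real (card (\<sigma> ` B)))"
      by (rule conv_mgf_le[OF bv]) (use B k0 that l in \<open>auto simp: late_def gap_from_def power_mult intro!: apos\<close>)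
    also have "l'\<^sup>2 = l\<^sup>2" using that by (metis power2_abs)
    finally show ?thesis using card_image[OF inj_sigma[OF B1]] by (simp add: psum_image[OF B1] M_def)
  qed
  have b: "\<bar>?X x\<bar> \<le> 1 * real (card B)" for x by (rule psum_abs_le) (rule conv_abs_le[OF h(1-3)])
  show ?thesis unfolding M_def[symmetric] by (rule U_Chernoff_abs[OF _ b l(1) mgf]) auto
qed

text \<open>Every dilate of the error has the same integral, so Markov's inequality suffices.
  Absolute values are taken termwise to make the sum monotone in \<open>B\<close>: one event for the
  whole range then serves all its sub-blocks.\<close>

lemma smoothing_error_tail:
  assumes bv: "bvc V h" "V \<ge> 0" and B: "finite B" "B \<subseteq> {1..}"
  shows "measure U {x. 1 < psum (\<lambda>x. \<bar>conv (deg I) h x - h x\<bar>) B x} \<le> real (card B) * (V / 2 ^ (64 * I))"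
proof -
  note h = bvcD[OF bv(1)]
  let ?g = "\<lambda>x. \<bar>conv (deg I) h x - h x\<bar>"
  have [measurable]: "conv (deg I) h \<in> borel_measurable borel" "h \<in> borel_measurable borel"
    by (rule conv_measurable[OF h(1-3)]) (rule h)
  have g2: "\<bar>?g x\<bar> \<le> 2" for x using conv_abs_le[OF h(1-3), of "deg I" x] h(3)[of x] by simp
  have gp: "periodic1 ?g" using h(2) conv_periodic[OF h(1-3), of "deg I"] by (simp add: periodic1_def)
  have ig: "(\<integral>x. ?g (real (a (\<sigma> k)) * x) \<partial>U) \<le> V / 2 ^ (64 * I)" if "k \<in> B" for k
    using integral_U_scale[where f="?g" and c=2, OF _ _ gp, of "a (\<sigma> k)"] g2 apos[OF sigma_ge[of k]] that B(2) conv_deg_approx[OF bv, of I]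
    by auto
  show ?thesis
  proof (rule U_Markov)
    show "\<bar>psum ?g B x\<bar> \<le> 2 * real (card B)" for x by (rule psum_abs_le[OF g2])
    show "0 \<le> psum ?g B x" for x by (auto simp: psum_def intro!: sum_nonneg)
    have "(\<integral>x. psum ?g B x \<partial>U) = (\<Sum>k\<in>B. \<integral>x. ?g (real (a (\<sigma> k)) * x) \<partial>U)"
      unfolding psum_def by (rule Bochner_Integration.integral_sum) (rule integrable_U[where c=2], use g2 in auto)
    also have "\<dots> \<le> real (card B) * (V / 2 ^ (64 * I))" by (rule sum_bounded_above[OF ig])
    finally show "(\<integral>x. psum ?g B x \<partial>U) \<le> real (card B) * (V / 2 ^ (64 * I))" .
  qed measurable
qed

text \<open>Modelled on dyadic intervals: from one level to the next the number of functions may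
  double while the bound on their \<open>L^1\<close> norms halves. A single function is handled by
  placing it at one level and leaving the others empty.\<close>

definition small_family :: "real \<Rightarrow> (nat \<Rightarrow> (real \<Rightarrow> real) set) \<Rightarrow> bool" where
  "small_family V H \<longleftrightarrow> (\<forall>r. finite (H r) \<and> card (H r) \<le> 2 ^ r \<and>
     (\<forall>h\<in>H r. bvc V h \<and> (\<integral>x. \<bar>h x\<bar> \<partial>U) \<le> (1 / 2) ^ r))"

text \<open>One statement for two uses: \<open>L = n\<close> bounds the whole sum up to
  \<open>M\<close>, and \<open>L = n - s\<close> bounds what follows a checkpoint. The last term is
  kept explicit because it vanishes when \<open>M\<close> is a multiple of a large power of
  2.\<close>

definition block_bound :: "real \<Rightarrow> (nat \<Rightarrow> (real \<Rightarrow> real) set) \<Rightarrow> real \<Rightarrow> nat \<Rightarrow> bool" where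
  "block_bound C H x n \<longleftrightarrow> (\<forall>r h L M. 2 * r \<le> n \<longrightarrow> h \<in> H r \<longrightarrow> n \<le> 2 * L \<longrightarrow> L \<le> n \<longrightarrow> M < 2 ^ n \<longrightarrow>
       \<bar>psum h {M div 2 ^ L * 2 ^ L<..M} x\<bar> \<le>
         C * 2 powr (- (real n - real L + real r) / 8) * sqrt (2 powr real n * ln (real n)) + C + real (M mod 2 ^ ((n + 1) div 2)))"

text \<open>Smoothing level \<open>n div 32\<close>: low enough for tilts of size \<open>2 ^ (- n / 8) sqrt (ln n)\<close> to be admissible, high enough
  for an \<open>L\<^sup>1\<close> smoothing error of order \<open>2 ^ (- 2 n)\<close>.\<close>
definition smooth_block_bound :: "real \<Rightarrow> nat \<Rightarrow> (nat \<Rightarrow> (real \<Rightarrow> real) set) \<Rightarrow> real \<Rightarrow> nat \<Rightarrow> bool" where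
  "smooth_block_bound K k0 H x n \<longleftrightarrow>
     (\<forall>l r i h. n \<le> 2 * l \<longrightarrow> l \<le> n \<longrightarrow> 2 * r \<le> n \<longrightarrow> i < 2 ^ (n - l) \<longrightarrow> h \<in> H r \<longrightarrow>
        \<bar>psum (conv (deg (n div 32)) h) ({i * 2 ^ l<..(i + 1) * 2 ^ l} \<inter> late k0) x\<bar>
        < K * 2 powr (- (real n - real l + real r) / 8) * sqrt (2 powr real n * ln (real n))) \<and>
     (\<forall>r h. 2 * r \<le> n \<longrightarrow> h \<in> H r \<longrightarrow> psum (\<lambda>x. \<bar>conv (deg (n div 32)) h x - h x\<bar>) ({1..2 ^ n} \<inter> late k0) x \<le> 1)"

text \<open>The variance proxy is at most of order \<open>2 powr (n - s / 2)\<close>. The threshold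
  exceeds its root by \<open>2 powr (s / 8)\<close> and a logarithmic factor, so the Chernoff
  exponent is of order \<open>2 powr (s / 4) * ln n\<close>. The hypothesis on \<open>I\<close> is
  the admissibility of the tilt in the worst case \<open>s = n\<close>.\<close>

lemma block_tail:
  assumes V: "V \<ge> 1" and h: "bvc V h" "(\<integral>x. \<bar>h x\<bar> \<partial>U) \<le> (1 / 2) ^ r"
    and k0: "gap_from (2 ^ 130) k0"
    and n: "n \<ge> 3" "n \<le> 2 * l" "l \<le> n" "2 * r \<le> n"
    and I: "2 powr (3 * real n / 8) * sqrt (ln (real n) / 2 powr real n) * 4 ^ (I + 2) \<le> 1"
    and s: "s = real n - real l + real r"
  shows "measure U {x. (2 ^ 10 * V + 6) * 2 powr (- s / 8) * sqrt (2 powr real n * ln (real n))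
      \<le> \<bar>psum (conv (deg I) h) ({i * 2 ^ l<..(i + 1) * 2 ^ l} \<inter> late k0) x\<bar>}
    \<le> 2 * exp (- 6 * 2 powr (s / 4) * ln (real n))"
proof -
  define K where "K = 2 ^ 10 * V"
  define B where "B = {i * 2 ^ l<..(i + 1) * 2 ^ l} \<inter> late k0"
  \<comment> \<open>Up to a constant the optimal tilt: the threshold
    \<open>2 powr (- s / 8) * sqrt (2 powr n * ln n)\<close> divided by the variance proxy
    \<open>2 powr (n - s / 2)\<close>.\<close>
  define lam where "lam = 2 powr (3 * s / 8) * sqrt (ln (real n) / 2 powr real n)"
  define y where "y = (K + 6) * 2 powr (- s / 8) * sqrt (2 powr real n * ln (real n))"
  have ln: "ln (real n) > 0" using n(1) by simp
  have sn: "s \<le> real n" using n by (simp add: s)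
  have lam0: "lam > 0" using ln by (simp add: lam_def)
  have lamI: "lam * 4 ^ (I + 2) \<le> 1"
  proof -
    have "lam \<le> 2 powr (3 * real n / 8) * sqrt (ln (real n) / 2 powr real n)"
      unfolding lam_def using sn ln by (intro mult_right_mono powr_mono) auto
    then have "lam * 4 ^ (I + 2) \<le> 2 powr (3 * real n / 8) * sqrt (ln (real n) / 2 powr real n) * 4 ^ (I + 2)"
      by (rule mult_right_mono) simp
    then show ?thesis using I by linarith
  qed
  have cB: "real (card B) \<le> 2 powr real l"
  proof -
    have "card B \<le> card {i * 2 ^ l<..(i + 1) * 2 ^ l}" unfolding B_def by (intro card_mono) auto
    then have "real (card B) \<le> real (2 ^ l)" by (intro of_nat_mono) simp
    then show ?thesis by (simp add: powr_realpow)
  qed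
  have rho: "sqrt ((1 / 2) ^ r) = 2 powr (- real r / 2)"
  proof -
    have "(1 / 2 :: real) ^ r = 2 powr (- real r)" by (simp add: powr_minus powr_realpow power_divide inverse_eq_divide)
    then show ?thesis by (simp add: powr_half_sqrt[symmetric] powr_powr)
  qed
  have lam2: "lam\<^sup>2 = 2 powr (3 * s / 4) * (ln (real n) / 2 powr real n)"
  proof -
    have "(2 powr (3 * s / 8))\<^sup>2 = (2::real) powr (3 * s / 4)" by (simp add: power2_eq_square flip: powr_add)
    then show ?thesis using ln by (simp add: lam_def power_mult_distrib)
  qed
  have q: "lam\<^sup>2 * (2 ^ 10 * V * sqrt ((1 / 2) ^ r)) * real (card B) \<le> K * (2 powr (s / 4) * ln (real n))"
  proof -
    have "lam\<^sup>2 * (2 ^ 10 * V * sqrt ((1 / 2) ^ r)) * real (card B) \<le> lam\<^sup>2 * (2 ^ 10 * V * sqrt ((1 / 2) ^ r)) * 2 powr real l"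
      using V by (intro mult_left_mono cB mult_nonneg_nonneg) auto
    also have "\<dots> = K * ln (real n) * (2 powr (3 * s / 4) * 2 powr (- real n) * 2 powr (- real r / 2) * 2 powr real l)"
    proof -
      have "ln (real n) / 2 powr real n = ln (real n) * 2 powr (- real n)" by (simp add: powr_minus_divide)
      then show ?thesis unfolding lam2 rho by (simp only: K_def mult_ac)
    qed
    also have "2 powr (3 * s / 4) * 2 powr (- real n) * 2 powr (- real r / 2) * 2 powr real l
       = 2 powr (3 * s / 4 + (- real n) + (- real r / 2) + real l)"
      by (simp only: powr_add)
    \<comment> \<open>The root of the \<open>L^1\<close> norm saves only \<open>r / 2\<close> in the
      exponent, but \<open>n - l + r / 2\<close> is still at least \<open>s / 2\<close>.\<close>
    also have "K * ln (real n) * 2 powr (3 * s / 4 + (- real n) + (- real r / 2) + real l) \<le> K * ln (real n) * 2 powr (s / 4)"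
      using V ln n(3) by (intro mult_left_mono powr_mono mult_nonneg_nonneg) (auto simp: s K_def field_simps)
    finally show ?thesis by (simp add: mult_ac)
  qed
  have ly: "lam * y = (K + 6) * (2 powr (s / 4) * ln (real n))"
  proof -
    have "sqrt (ln (real n) / 2 powr real n) * sqrt (2 powr real n * ln (real n)) = sqrt (ln (real n) * ln (real n))"
      by (subst real_sqrt_mult[symmetric]) simp
    then have r: "sqrt (ln (real n) / 2 powr real n) * sqrt (2 powr real n * ln (real n)) = ln (real n)" using ln by simp
    have "lam * y = (K + 6) * (2 powr (3 * s / 8) * 2 powr (- s / 8)) * (sqrt (ln (real n) / 2 powr real n) * sqrt (2 powr real n * ln (real n)))"
      unfolding lam_def y_def by (simp only: mult_ac)
    also have "2 powr (3 * s / 8) * 2 powr (- s / 8) = 2 powr (s / 4)" by (simp flip: powr_add)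
    finally show ?thesis unfolding r by simp
  qed
  have "measure U {x. y \<le> \<bar>psum (conv (deg I) h) B x\<bar>}
     \<le> 2 * exp (lam\<^sup>2 * (2 ^ 10 * V * sqrt ((1 / 2) ^ r)) * real (card B) - lam * y)"
    by (rule psum_conv_tail[OF h(1) V h(2) _ k0 _ _ lam0 lamI]) (auto simp: B_def power_le_one)
  also have "\<dots> \<le> 2 * exp (- 6 * 2 powr (s / 4) * ln (real n))"
    using q unfolding ly by (simp add: algebra_simps)
  finally show ?thesis by (simp add: y_def B_def K_def)
qed

text \<open>There are \<open>2 powr s\<close> pairs of a block and a function, at most
  \<open>exp (s * ln n)\<close>, while \<open>6 * 2 powr (s / 4)\<close> is at least
  \<open>s + 6\<close>. Thus the summand 6 in the threshold leaves \<open>n powr (- 6)\<close>,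
  enough to sum over \<open>l\<close>, \<open>r\<close> and \<open>n\<close>.\<close>

lemma block_count_bound:
  assumes "n \<ge> 2" "l \<le> n" and s: "s = real n - real l + real r"
  shows "real (2 ^ (n - l)) * (real (2 ^ r) * (2 * exp (- 6 * 2 powr (s / 4) * ln (real n)))) \<le> 2 * real n powr (-6)"
proof -
  have l2: "ln 2 \<le> ln (real n)" using assms(1) by simp
  have s0: "s \<ge> 0" using assms by simp
  have "real (2 ^ (n - l)) * real (2 ^ r) = 2 powr s"
    using assms(2) by (simp add: s powr_add of_nat_diff flip: powr_realpow)
  also have "\<dots> = exp (s * ln 2)" by (simp add: powr_def)
  also have "\<dots> \<le> exp (s * ln (real n))" using l2 s0 by (simp add: mult_left_mono)
  finally have 1: "real (2 ^ (n - l)) * real (2 ^ r) \<le> exp (s * ln (real n))" .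
  have "1 + s / 6 \<le> 1 + s / 4 * ln 2"
    using ln2_ge_two_thirds s0 mult_left_mono[of "2/3" "ln 2" "s / 4"] by simp
  also have "\<dots> \<le> exp (s / 4 * ln 2)" by (rule exp_ge_add_one_self)
  also have "\<dots> = 2 powr (s / 4)" by (simp add: powr_def)
  finally have 2: "s + 6 \<le> 6 * 2 powr (s / 4)" by simp
  have "real (2 ^ (n - l)) * (real (2 ^ r) * (2 * exp (- 6 * 2 powr (s / 4) * ln (real n))))
      = 2 * (real (2 ^ (n - l)) * real (2 ^ r)) * exp (- 6 * 2 powr (s / 4) * ln (real n))" by simp
  also have "\<dots> \<le> 2 * exp (s * ln (real n)) * exp (- (s + 6) * ln (real n))"
  proof (intro mult_mono)
    have "(s + 6) * ln (real n) \<le> 6 * 2 powr (s / 4) * ln (real n)"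
      using assms(1) by (intro mult_right_mono 2) simp
    then show "exp (- 6 * 2 powr (s / 4) * ln (real n)) \<le> exp (- (s + 6) * ln (real n))" by (simp add: algebra_simps)
  qed (use 1 in auto)
  also have "\<dots> = 2 * real n powr (-6)"
    using assms(1) by (simp add: powr_def algebra_simps flip: exp_add)
  finally show ?thesis .
qed

text \<open>Rounding in \<open>n div 32\<close> loses at most 31, hence the factor
  \<open>2 ^ 62\<close>. The denominator beats the \<open>2 powr n\<close> summands and the at most
  \<open>2 powr (n / 2)\<close> functions of a level together.\<close>

lemma smoothing_scale_bound: "V \<ge> 0 \<Longrightarrow> V / 2 ^ (64 * (n div 32)) \<le> V * 2 ^ 62 / 2 powr (2 * real n)"
proof -
  assume V: "V \<ge> 0"
  have "2 * n \<le> 64 * (n div 32) + 62" by presburger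
  then have "(2::real) ^ (2 * n) \<le> 2 ^ (64 * (n div 32) + 62)" by (intro power_increasing) auto
  then have "2 powr (2 * real n) \<le> 2 ^ (64 * (n div 32)) * 2 ^ 62"
    using powr_realpow[of 2 "2 * n"] by (simp add: power_add)
  then have "V * 2 powr (2 * real n) \<le> V * (2 ^ (64 * (n div 32)) * 2 ^ 62)" using V by (rule mult_left_mono)
  then show ?thesis by (simp add: divide_simps mult_ac)
qed

lemma AE_smooth_block_bound:
  assumes V: "V \<ge> 1" and H: "small_family V H"
    and k0: "gap_from (2 ^ 130) k0"
  shows "AE x in U. eventually (smooth_block_bound (2 ^ 10 * V + 6) k0 H x) sequentially"
proof -
  define y where "y = (\<lambda>n l r. (2 ^ 10 * V + 6) * 2 powr (- (real n - real l + real r) / 8) * sqrt (2 powr real n * ln (real n)))"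
  define E1 where "E1 = (\<lambda>n l r i h. {x. y n l r \<le> \<bar>psum (conv (deg (n div 32)) h) ({i * 2 ^ l<..(i + 1) * 2 ^ l} \<inter> late k0) x\<bar>})"
  define E2 where "E2 = (\<lambda>n h. {x. 1 < psum (\<lambda>x. \<bar>conv (deg (n div 32)) h x - h x\<bar>) ({1..2 ^ n} \<inter> late k0) x})"
  define LL where "LL = (\<lambda>n::nat. {l. n \<le> 2 * l \<and> l \<le> n})"
  define RR where "RR = (\<lambda>n::nat. {r. 2 * r \<le> n})"
  define A1 where "A1 = (\<lambda>n. \<Union>l\<in>LL n. \<Union>r\<in>RR n. \<Union>i\<in>{..<2 ^ (n - l)}. \<Union>h\<in>H r. E1 n l r i h)"
  define A2 where "A2 = (\<lambda>n. \<Union>r\<in>RR n. \<Union>h\<in>H r. E2 n h)"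
  define g where "g = (\<lambda>n::nat. (real n + 1) * ((real n + 1) * (2 * real n powr (-6))) + (V * 2 ^ 62) * ((real n + 1) * 2 powr (- real n / 2)))"
  have Hf: "finite (H r)" "card (H r) \<le> 2 ^ r" for r using H by (auto simp: small_family_def)
  have Hb: "bvc V h" "(\<integral>x. \<bar>h x\<bar> \<partial>U) \<le> (1 / 2) ^ r" if "h \<in> H r" for h r
    using H that by (auto simp: small_family_def)
  have hm: "h \<in> borel_measurable borel" "conv d h \<in> borel_measurable borel" if "h \<in> H r" for h r d
    using bvcD(1)[OF Hb(1)[OF that]] conv_measurable[OF bvcD(1-3)[OF Hb(1)[OF that]]] by auto
  have E1m: "E1 n l r i h \<in> sets borel" if "h \<in> H r" for n l r i h
  proof -
    note [measurable] = hm[OF that]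
    show ?thesis unfolding E1_def by measurable
  qed
  have E2m: "E2 n h \<in> sets borel" if "h \<in> H r" for n r h
  proof -
    note [measurable] = hm[OF that]
    show ?thesis unfolding E2_def by measurable
  qed
  have fL: "finite (LL n)" and cL: "real (card (LL n)) \<le> real n + 1" for n
  proof -
    have s: "LL n \<subseteq> {..n}" by (auto simp: LL_def)
    then show "finite (LL n)" by (rule finite_subset) simp
    show "real (card (LL n)) \<le> real n + 1" using card_mono[OF _ s] by simp
  qed
  have fR: "finite (RR n)" and cR: "real (card (RR n)) \<le> real n + 1" for n
  proof -
    have s: "RR n \<subseteq> {..n}" by (auto simp: RR_def)
    then show "finite (RR n)" by (rule finite_subset) simp
    show "real (card (RR n)) \<le> real n + 1" using card_mono[OF _ s] by simp
  qed
  have A1m: "A1 n \<in> sets borel" for n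
    unfolding A1_def by (intro sets.finite_UN fL fR Hf finite_lessThan E1m)
  have A2m: "A2 n \<in> sets borel" for n
    unfolding A2_def by (intro sets.finite_UN fR Hf E2m)
  have evI: "eventually (\<lambda>n. 2 powr (3 * real n / 8) * sqrt (ln (real n) / 2 powr real n) * 4 ^ (n div 32 + 2) \<le> 1) sequentially"
  proof -
    have "eventually (\<lambda>n::nat. 2 powr (3 * real n / 8) * sqrt (ln (real n) / 2 powr real n) * (16 * 2 powr (real n / 16)) \<le> 1) sequentially"
      by real_asymp
    then show ?thesis
    proof (eventually_elim)
      case (elim n)
      have "(4::real) ^ (n div 32 + 2) = 16 * 2 powr (2 * real (n div 32))"
        using powr_realpow[of "2::real" "2 * (n div 32)"] by (simp add: power_add power_mult)
      also have "\<dots> \<le> 16 * 2 powr (real n / 16)"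
      proof -
        have "32 * (n div 32) \<le> n" by simp
        then have "real (32 * (n div 32)) \<le> real n" by (rule of_nat_mono)
        then show ?thesis by (intro mult_left_mono powr_mono) auto
      qed
      finally have "2 powr (3 * real n / 8) * sqrt (ln (real n) / 2 powr real n) * 4 ^ (n div 32 + 2)
        \<le> 2 powr (3 * real n / 8) * sqrt (ln (real n) / 2 powr real n) * (16 * 2 powr (real n / 16))"
      proof (rule mult_left_mono)
        have "0 \<le> ln (real n)" by (cases "n = 0") (auto intro: ln_ge_zero)
        then show "0 \<le> 2 powr (3 * real n / 8) * sqrt (ln (real n) / 2 powr real n)" by simp
      qed
      then show ?case using elim by linarith
    qed
  qed
  have ev: "eventually (\<lambda>n. measure U (A1 n \<union> A2 n) \<le> g n) sequentially"
    using evI eventually_ge_at_top[of 3]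
  proof eventually_elim
    case (elim n)
    have m1: "measure U (A1 n) \<le> (real n + 1) * ((real n + 1) * (2 * real n powr (-6)))"
    proof -
      have inner: "measure U (\<Union>i\<in>{..<2 ^ (n - l)}. \<Union>h\<in>H r. E1 n l r i h) \<le> 2 * real n powr (-6)"
        if l: "l \<in> LL n" and r: "r \<in> RR n" for l r
      proof -
        define b where "b = 2 * exp (- 6 * 2 powr ((real n - real l + real r) / 4) * ln (real n))"
        have e: "measure U (E1 n l r i h) \<le> b" if "h \<in> H r" for i h
          unfolding E1_def y_def b_def using l r elim
          by (intro block_tail[OF V Hb[OF that] k0]) (auto simp: LL_def RR_def)
        have "measure U (\<Union>h\<in>H r. E1 n l r i h) \<le> real (2 ^ r) * b" for i
        proof -
          have "measure U (\<Union>h\<in>H r. E1 n l r i h) \<le> real (card (H r)) * b"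
            by (intro U_union_le Hf E1m e)
          also have "\<dots> \<le> real (2 ^ r) * b" using Hf(2)[of r] by (intro mult_right_mono of_nat_mono) (auto simp: b_def)
          finally show ?thesis .
        qed
        then have "measure U (\<Union>i\<in>{..<2 ^ (n - l)}. \<Union>h\<in>H r. E1 n l r i h) \<le> real (card {..<2 ^ (n - l) :: nat}) * (real (2 ^ r) * b)"
          by (intro U_union_le finite_lessThan sets.finite_UN Hf E1m)
        also have "\<dots> = real (2 ^ (n - l)) * (real (2 ^ r) * b)" by simp
        also have "\<dots> \<le> 2 * real n powr (-6)"
          unfolding b_def by (rule block_count_bound) (use l elim in \<open>auto simp: LL_def\<close>)
        finally show ?thesis .
      qed
      have "measure U (\<Union>r\<in>RR n. \<Union>i\<in>{..<2 ^ (n - l)}. \<Union>h\<in>H r. E1 n l r i h) \<le> (real n + 1) * (2 * real n powr (-6))"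
        if l: "l \<in> LL n" for l
      proof -
        have "measure U (\<Union>r\<in>RR n. \<Union>i\<in>{..<2 ^ (n - l)}. \<Union>h\<in>H r. E1 n l r i h) \<le> real (card (RR n)) * (2 * real n powr (-6))"
          by (intro U_union_le fR sets.finite_UN Hf finite_lessThan E1m inner l)
        also have "\<dots> \<le> (real n + 1) * (2 * real n powr (-6))" by (intro mult_right_mono cR) auto
        finally show ?thesis .
      qed
      then have "measure U (A1 n) \<le> real (card (LL n)) * ((real n + 1) * (2 * real n powr (-6)))"
        unfolding A1_def by (intro U_union_le fL fR sets.finite_UN Hf finite_lessThan E1m)
      also have "\<dots> \<le> (real n + 1) * ((real n + 1) * (2 * real n powr (-6)))" by (intro mult_right_mono cL) auto
      finally show ?thesis .
    qed
    have m2: "measure U (A2 n) \<le> (V * 2 ^ 62) * ((real n + 1) * 2 powr (- real n / 2))"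
    proof -
      define b where "b = 2 powr real n * (V * 2 ^ 62 / 2 powr (2 * real n))"
      have b0: "b \<ge> 0" using V by (simp add: b_def)
      have e: "measure U (E2 n h) \<le> b" if "h \<in> H r" for h r
      proof -
        have "measure U (E2 n h) \<le> real (card ({1..2 ^ n} \<inter> late k0)) * (V / 2 ^ (64 * (n div 32)))"
          unfolding E2_def using V by (intro smoothing_error_tail[OF Hb(1)[OF that]]) auto
        also have "\<dots> \<le> 2 powr real n * (V * 2 ^ 62 / 2 powr (2 * real n))"
        proof (intro mult_mono smoothing_scale_bound)
          have "card ({1..2 ^ n} \<inter> late k0) \<le> card {1..2 ^ n :: nat}" by (intro card_mono) auto
          then have "real (card ({1..2 ^ n} \<inter> late k0)) \<le> real (2 ^ n)" by (intro of_nat_mono) simp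
          then show "real (card ({1..2 ^ n} \<inter> late k0)) \<le> 2 powr real n" by (simp add: powr_realpow)
        qed (use V in auto)
        finally show ?thesis by (simp add: b_def)
      qed
      have "measure U (\<Union>h\<in>H r. E2 n h) \<le> 2 powr (real n / 2) * b" if r: "r \<in> RR n" for r
      proof -
        have "measure U (\<Union>h\<in>H r. E2 n h) \<le> real (card (H r)) * b"
          by (intro U_union_le Hf E2m e)
        also have "\<dots> \<le> 2 powr (real n / 2) * b"
        proof (rule mult_right_mono[OF _ b0])
          have "real (card (H r)) \<le> real (2 ^ r)" using Hf(2)[of r] by (intro of_nat_mono)
          also have "\<dots> = 2 powr real r" by (simp add: powr_realpow)
          also have "\<dots> \<le> 2 powr (real n / 2)" using r by (intro powr_mono) (auto simp: RR_def)
          finally show "real (card (H r)) \<le> 2 powr (real n / 2)" .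
        qed
        finally show ?thesis .
      qed
      then have "measure U (A2 n) \<le> real (card (RR n)) * (2 powr (real n / 2) * b)"
        unfolding A2_def by (intro U_union_le fR sets.finite_UN Hf E2m)
      also have "\<dots> \<le> (real n + 1) * (2 powr (real n / 2) * b)" using b0 by (intro mult_right_mono cR) auto
      also have "2 powr (real n / 2) * b = V * 2 ^ 62 * (2 powr (real n / 2) * (2 powr real n * 2 powr (- (2 * real n))))"
        unfolding b_def by (simp only: powr_minus_divide) (simp add: mult_ac)
      also have "2 powr (real n / 2) * (2 powr real n * 2 powr (- (2 * real n))) = 2 powr (- real n / 2)"
        by (simp flip: powr_add)
      finally show ?thesis by (simp add: mult_ac)
    qed
    have "measure U (A1 n \<union> A2 n) \<le> measure U (A1 n) + measure U (A2 n)"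
      using A1m A2m by (intro measure_Un_le) auto
    then show ?case using m1 m2 by (simp add: g_def)
  qed
  have "summable g"
  proof (rule summable_comparison_test_bigo)
    show "summable (\<lambda>n. norm (1 / real n ^ 2))"
      using inverse_power_summable[of 2, where ?'a=real] by (simp add: field_simps)
    show "g \<in> O(\<lambda>n. 1 / real n ^ 2)" unfolding g_def by real_asymp
  qed
  then have "AE x in U. eventually (\<lambda>n. x \<notin> A1 n \<union> A2 n) sequentially"
    by (intro AE_eventually_U[OF _ ev]) (use A1m A2m in auto)
  then show ?thesis
  proof eventually_elim
    case (elim x)
    from elim show ?case
    proof eventually_elim
      case (elim n)
      have "x \<notin> E1 n l r i h" if "n \<le> 2 * l" "l \<le> n" "2 * r \<le> n" "i < 2 ^ (n - l)" "h \<in> H r" for l r i h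
        using elim that unfolding A1_def LL_def RR_def by blast
      moreover have "x \<notin> E2 n h" if "2 * r \<le> n" "h \<in> H r" for r h
        using elim that unfolding A2_def RR_def by blast
      ultimately show ?case unfolding smooth_block_bound_def E1_def E2_def y_def by (simp add: not_le not_less)
    qed
  qed
qed

text \<open>\<open>C\<close> depends on the modulus \<open>V\<close> only: the bound stays small for members of high level \<open>r\<close>.\<close>
lemma block_estimate:
  assumes V: "V \<ge> 1"
  shows "\<exists>C>0. \<forall>H. small_family V H \<longrightarrow> (AE x in U. eventually (block_bound C H x) sequentially)"
proof -
  obtain k0 where k0: "gap_from (2 ^ 130) k0"
    using gap_from_exists[of "2 ^ 130"] by auto
  \<comment> \<open>Chaining costs the factor 12, absorbing the smoothing error into the threshold
    the factor 2, and \<open>k0\<close> pays for the positions with small index.\<close>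
  define C where "C = 24 * (2 ^ 10 * V + 6) + real k0"
  show ?thesis
  proof (intro exI[of _ C] conjI allI impI)
  show "0 < C" using V by (simp add: C_def add_pos_nonneg)
  fix H assume H: "small_family V H"
  define K where "K = 2 ^ 10 * V + 6"
  have K: "K \<ge> 1" using V by (simp add: K_def)
  define W where "W = (\<lambda>n. sqrt (2 powr real n * ln (real n)))"
  show "AE x in U. eventually (block_bound C H x) sequentially"
    using AE_smooth_block_bound[OF V H k0]
  proof eventually_elim
    case (elim x)
    from elim show ?case
      using eventually_ge_at_top[of 3]
    proof eventually_elim
      case (elim n)
      have n: "n \<ge> 3" by (rule elim(2))
      have ln1: "ln (real n) \<ge> 1"
      proof -
        have "exp 1 \<le> real n" using exp_le n by linarith
        then show ?thesis using n ln_mono[of "exp 1" "real n"] by simp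
      qed
      show ?case
        unfolding block_bound_def
      proof (intro allI impI)
        fix r L M :: nat and h
        assume r: "2 * r \<le> n" and h: "h \<in> H r" and L: "n \<le> 2 * L" "L \<le> n" and M: "M < 2 ^ n"
        define F where "F = (\<lambda>m. psum h ({1..m} \<inter> late k0) x)"
        define Y where "Y = 2 * K * 2 powr (- real r / 8) * W n"
        define l0 where "l0 = (n + 1) div 2"
        have bv: "bvc V h" using H h by (auto simp: small_family_def)
        note hb = bvcD(3)[OF bv]
        have W0: "W n \<ge> 0" using ln1 by (simp add: W_def)
        have Fd: "F v - F u = psum h ({u<..v} \<inter> late k0) x" if "u \<le> v" for u v
        proof -
          have "{1..v} \<inter> late k0 = ({1..u} \<inter> late k0) \<union> ({u<..v} \<inter> late k0)"
            using that by (auto simp: late_def)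
          moreover have "(\<Sum>k\<in>({1..u} \<inter> late k0) \<union> ({u<..v} \<inter> late k0). h (real (a (\<sigma> k)) * x))
              = (\<Sum>k\<in>{1..u} \<inter> late k0. h (real (a (\<sigma> k)) * x)) + (\<Sum>k\<in>{u<..v} \<inter> late k0. h (real (a (\<sigma> k)) * x))"
            by (rule sum.union_disjoint) auto
          ultimately show ?thesis unfolding F_def psum_def by simp
        qed
        have blk: "\<bar>F ((i + 1) * 2 ^ l) - F (i * 2 ^ l)\<bar> \<le> Y * 2 powr (- (real n - real l) / 8)"
          if l: "l0 \<le> l" "l \<le> n" "i < 2 ^ (n - l)" for l i
        proof -
          let ?B = "{i * 2 ^ l<..(i + 1) * 2 ^ l} \<inter> late k0"
          let ?g = "\<lambda>x. \<bar>conv (deg (n div 32)) h x - h x\<bar>"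
          define y where "y = K * 2 powr (- (real n - real l + real r) / 8) * W n"
          have nl: "n \<le> 2 * l" using l(1) by (simp add: l0_def)
          have c: "\<bar>psum (conv (deg (n div 32)) h) ?B x\<bar> < y"
            using elim(1) nl l r h unfolding smooth_block_bound_def y_def W_def K_def by blast
          have "(i + 1) * 2 ^ l \<le> 2 ^ (n - l) * 2 ^ l" using l(3) by (intro mult_right_mono) auto
          also have "\<dots> = (2::nat) ^ n" using l(2) by (simp flip: power_add)
          finally have sub: "?B \<subseteq> {1..2 ^ n} \<inter> late k0" by auto
          have "\<bar>psum (conv (deg (n div 32)) h) ?B x - psum h ?B x\<bar> \<le> psum ?g ?B x"
            unfolding psum_def sum_subtractf[symmetric] by (rule sum_abs)
          also have "\<dots> \<le> psum ?g ({1..2 ^ n} \<inter> late k0) x"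
            unfolding psum_def by (rule sum_mono2[OF _ sub]) auto
          also have "\<dots> \<le> 1" using elim(1) r h unfolding smooth_block_bound_def by blast
          \<comment> \<open>Since \<open>n - l + r \<le> n\<close>, the threshold is at least of
            order \<open>2 powr (3 * n / 8)\<close>; the smoothing error can only double it.\<close>
          also have "1 \<le> y"
          proof -
            have "2 powr (real n / 2) = sqrt (2 powr real n)" by (simp add: powr_half_sqrt_powr)
            also have "\<dots> \<le> W n" unfolding W_def using ln1 by (intro real_sqrt_le_mono) simp
            finally have "2 powr (- (real n - real l + real r) / 8) * 2 powr (real n / 2) \<le> 2 powr (- (real n - real l + real r) / 8) * W n"
              by (rule mult_left_mono) simp
            moreover have "1 \<le> 2 powr (- (real n - real l + real r) / 8) * 2 powr (real n / 2)"
              unfolding powr_add[symmetric]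
            proof (rule ge_one_powr_ge_zero)
              have "real n \<le> 2 * real l" "2 * real r \<le> real n" using nl r by linarith+
              then show "0 \<le> - (real n - real l + real r) / 8 + real n / 2" by (simp add: field_simps)
            qed simp
            ultimately have "1 \<le> 2 powr (- (real n - real l + real r) / 8) * W n" by linarith
            then have "1 * 1 \<le> K * (2 powr (- (real n - real l + real r) / 8) * W n)" using K by (intro mult_mono) auto
            then show ?thesis by (simp add: y_def mult.assoc)
          qed
          finally have "\<bar>psum h ?B x\<bar> \<le> 2 * y" using c by linarith
          also have "2 * y = Y * 2 powr (- (real n - real l) / 8)"
          proof -
            have "2 powr (- (real n - real l + real r) / 8) = 2 powr (- real r / 8) * 2 powr (- (real n - real l) / 8)"
              unfolding powr_add[symmetric] by (rule arg_cong[where f="\<lambda>z. 2 powr z"]) (simp add: field_simps)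
            then show ?thesis by (simp only: y_def Y_def mult_ac)
          qed
          finally show ?thesis using Fd[of "i * 2 ^ l" "(i + 1) * 2 ^ l"] by simp
        qed
        have inc: "\<bar>F v - F u\<bar> \<le> real (v - u)" if "u \<le> v" for u v
        proof -
          have "\<bar>F v - F u\<bar> \<le> 1 * real (card ({u<..v} \<inter> late k0))"
            unfolding Fd[OF that] by (rule psum_abs_le[OF hb])
          also have "card ({u<..v} \<inter> late k0) \<le> card {u<..v}" by (intro card_mono) auto
          finally show ?thesis by simp
        qed
        have "\<bar>F M - F (M div 2 ^ L * 2 ^ L)\<bar> \<le> 12 * Y * 2 powr (- (real n - real L) / 8) + real (M mod 2 ^ l0)"
          by (rule dyadic_chain[OF _ blk inc _ L(2) M]) (use K W0 L in \<open>auto simp: Y_def l0_def\<close>)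
        moreover have "\<bar>psum h {M div 2 ^ L * 2 ^ L<..M} x - (F M - F (M div 2 ^ L * 2 ^ L))\<bar> \<le> 1 * real k0"
          unfolding Fd[OF div_times_less_eq_dividend] by (rule psum_late[OF hb]) auto
        ultimately have le1: "\<bar>psum h {M div 2 ^ L * 2 ^ L<..M} x\<bar>
           \<le> 12 * Y * 2 powr (- (real n - real L) / 8) + real k0 + real (M mod 2 ^ l0)"
          by linarith
        have eq: "12 * Y * 2 powr (- (real n - real L) / 8) = 24 * K * 2 powr (- (real n - real L + real r) / 8) * W n"
        proof -
          have "2 powr (- (real n - real L + real r) / 8) = 2 powr (- real r / 8) * 2 powr (- (real n - real L) / 8)"
            unfolding powr_add[symmetric] by (rule arg_cong[where f="\<lambda>z. 2 powr z"]) (simp add: field_simps)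
          then show ?thesis by (simp add: Y_def mult_ac)
        qed
        have le2: "24 * K * 2 powr (- (real n - real L + real r) / 8) * W n \<le> C * 2 powr (- (real n - real L + real r) / 8) * W n"
          using W0 by (intro mult_right_mono) (auto simp: C_def K_def)
        have "real k0 \<le> C" using V by (simp add: C_def)
        then show "\<bar>psum h {M div 2 ^ L * 2 ^ L<..M} x\<bar> \<le>
         C * 2 powr (- (real n - real L + real r) / 8) * sqrt (2 powr real n * ln (real n)) + C + real (M mod 2 ^ ((n + 1) div 2))"
          using le1 le2 unfolding eq unfolding W_def l0_def by linarith
      qed
    qed
  qed
  qed
qed

lemma mod_half_power_le: "real (M mod 2 ^ ((n + 1) div 2)) \<le> 2 * 2 powr (real n / 2)"
proof -
  have "real (M mod 2 ^ ((n + 1) div 2)) \<le> real (2 ^ ((n + 1) div 2))" by (intro of_nat_mono less_imp_le) simp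
  also have "\<dots> = 2 powr real ((n + 1) div 2)" by (simp add: powr_realpow)
  also have "\<dots> \<le> 2 powr (1 + real n / 2)"
  proof (rule powr_mono)
    have "2 * ((n + 1) div 2) \<le> n + 1" by simp
    then show "real ((n + 1) div 2) \<le> 1 + real n / 2" by linarith
  qed simp
  finally show ?thesis by (simp add: powr_add)
qed

end

subsection \<open>The upper bound for trigonometric polynomials\<close>

definition psi :: "nat \<Rightarrow> real" where "psi N = sqrt (2 * real N * ln (ln (real N)))"

text \<open>The number of binary digits. Almost sure statements are indexed by this level, so that
  its logarithm plays the role of the iterated logarithm of \<open>N\<close>.\<close>

definition lev :: "nat \<Rightarrow> nat" where "lev N = (LEAST n. N < 2 ^ n)"

lemma lev_less: "N < 2 ^ lev N"
  unfolding lev_def by (rule LeastI[of _ N]) simp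

lemma lev_power_le: assumes "N \<ge> 1" shows "2 ^ lev N \<le> 2 * N"
proof (cases "lev N")
  case (Suc m)
  then have "\<not> N < 2 ^ m" using not_less_Least[of m "\<lambda>n. N < 2 ^ n"] by (simp add: lev_def)
  then show ?thesis using Suc by simp
qed (use assms in auto)

lemma filterlim_lev: "filterlim lev at_top sequentially"
  unfolding filterlim_at_top
proof
  fix Z :: nat
  have "Z \<le> lev N" if "N \<ge> 2 ^ Z" for N
  proof (rule ccontr)
    assume "\<not> Z \<le> lev N"
    then have "(2::nat) ^ lev N \<le> 2 ^ Z" by (intro power_increasing) auto
    then show False using lev_less[of N] that by linarith
  qed
  then show "eventually (\<lambda>N. Z \<le> lev N) sequentially"
    unfolding eventually_sequentially by blast
qed

lemma eventually_lev: "eventually P sequentially \<Longrightarrow> eventually (\<lambda>N. P (lev N)) sequentially"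
  by (rule eventually_compose_filterlim[OF _ filterlim_lev])

lemma lev_powr_le: "N \<ge> 1 \<Longrightarrow> 2 powr real (lev N) \<le> 2 * real N"
proof -
  assume "N \<ge> 1"
  then have "real (2 ^ lev N) \<le> real (2 * N)" by (intro of_nat_mono lev_power_le)
  then show ?thesis by (simp add: powr_realpow)
qed

lemma ln_lev_le:
  assumes "\<delta> > 0"
  shows "eventually (\<lambda>N. ln (real (lev N)) \<le> (1 + \<delta>) * ln (ln (real N))) sequentially"
proof -
  have "eventually (\<lambda>N::nat. ln (ln (2 * real N) / ln 2) \<le> (1 + \<delta>) * ln (ln (real N))) sequentially"
    using assms by real_asymp
  then show ?thesis using eventually_ge_at_top[of 2] eventually_lev[OF eventually_ge_at_top[of 1]]
  proof eventually_elim
    case (elim N)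
    have "real (lev N) * ln 2 = ln (2 powr real (lev N))" by (simp add: ln_powr)
    also have "\<dots> \<le> ln (2 * real N)" using lev_powr_le[of N] elim by (subst ln_le_cancel_iff) auto
    finally have "real (lev N) \<le> ln (2 * real N) / ln 2" by (simp add: pos_le_divide_eq)
    then have "ln (real (lev N)) \<le> ln (ln (2 * real N) / ln 2)" using elim by (intro ln_mono) auto
    then show ?case using elim by linarith
  qed
qed

lemma sqrt_le_psi:
  assumes "\<epsilon> > 0" shows "eventually (\<lambda>N. c * sqrt (real N) + b \<le> \<epsilon> * psi N) sequentially"
proof -
  have "eventually (\<lambda>N::nat. \<bar>c\<bar> * sqrt (real N) + \<bar>b\<bar> \<le> \<epsilon> * sqrt (2 * real N * ln (ln (real N)))) sequentially"
    using assms by real_asymp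
  then show ?thesis
  proof eventually_elim
    case (elim N)
    have "c * sqrt (real N) \<le> \<bar>c\<bar> * sqrt (real N)" by (intro mult_right_mono) auto
    then show ?case using elim by (auto simp: psi_def)
  qed
qed

lemma psi_pos: "eventually (\<lambda>N. psi N > 0) sequentially"
  unfolding psi_def by real_asymp

lemma lev_scale_le_psi:
  assumes "\<delta> > 0"
  shows "eventually (\<lambda>N. sqrt (2 * real N * ln (real (lev N))) \<le> (1 + \<delta>) * psi N) sequentially"
  using ln_lev_le[OF assms] psi_pos
proof eventually_elim
  case (elim N)
  have "2 * real N * ln (real (lev N)) \<le> 2 * real N * ((1 + \<delta>) * ln (ln (real N)))"
    using elim by (intro mult_left_mono) auto
  then have "sqrt (2 * real N * ln (real (lev N))) \<le> sqrt ((1 + \<delta>) * (2 * real N * ln (ln (real N))))"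
    by (simp add: mult_ac)
  also have "\<dots> = sqrt (1 + \<delta>) * psi N" by (simp add: psi_def real_sqrt_mult)
  also have "\<dots> \<le> (1 + \<delta>) * psi N"
    using assms elim by (intro mult_right_mono) (auto intro!: real_le_lsqrt simp: power2_eq_square algebra_simps)
  finally show ?case .
qed

lemma lev_scale_le_psi':
  "eventually (\<lambda>N. sqrt (2 powr real (lev N) * ln (real (lev N))) \<le> 2 * psi N) sequentially"
  using lev_scale_le_psi[of 1, OF zero_less_one] eventually_ge_at_top[of 1] eventually_lev[OF eventually_ge_at_top[of 1]]
proof eventually_elim
  case (elim N)
  have "sqrt (2 powr real (lev N) * ln (real (lev N))) \<le> sqrt (2 * real N * ln (real (lev N)))"
    using elim by (intro real_sqrt_le_mono mult_right_mono lev_powr_le ln_ge_zero) auto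
  then show ?case using elim(1) unfolding one_add_one by linarith
qed

lemma lev_remainder: "N \<ge> 1 \<Longrightarrow> 3 * 2 powr (real (lev N) / 2) \<le> 5 * sqrt (real N)"
proof -
  assume N: "N \<ge> 1"
  have "3 * 2 powr (real (lev N) / 2) = sqrt (9 * 2 powr real (lev N))"
    by (simp add: powr_half_sqrt_powr real_sqrt_mult)
  also have "\<dots> \<le> sqrt (25 * real N)" using lev_powr_le[OF N] by (intro real_sqrt_le_mono) simp
  finally show ?thesis by (simp add: real_sqrt_mult)
qed

section \<open>Checkpoints and the sharp upper constant\<close>

context permuted_lacunary
begin

abbreviation S :: "(real \<Rightarrow> real) \<Rightarrow> nat \<Rightarrow> real \<Rightarrow> real" where
  "S h N x \<equiv> psum h {1..N} x"

definition lil_upper :: "(real \<Rightarrow> real) \<Rightarrow> real \<Rightarrow> bool" where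
  "lil_upper h c \<longleftrightarrow> (\<forall>\<epsilon>>0. AE x in U. eventually (\<lambda>N. \<bar>S h N x\<bar> \<le> (c + \<epsilon>) * psi N) sequentially)"

definition lil_lower :: "(real \<Rightarrow> real) \<Rightarrow> real \<Rightarrow> bool" where
  "lil_lower h c \<longleftrightarrow> (\<forall>\<epsilon>>0. AE x in U. frequently (\<lambda>N. S h N x \<ge> (c - \<epsilon>) * psi N) sequentially)"

text \<open>Serves to discard remainders. The constant is chosen before the family, so a level
  \<open>r\<close> can be fixed in terms of \<open>C\<close> and a function of small
  \<open>L^1\<close> norm placed there afterwards.\<close>

lemma psum_fine:
  assumes V: "V \<ge> 1"
  shows "\<exists>C>0. \<forall>H. small_family V H \<longrightarrow> (AE x in U. eventually (\<lambda>N. \<forall>r h. 2 * r \<le> lev N \<longrightarrow> h \<in> H r \<longrightarrow>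
    \<bar>S h N x\<bar> \<le> C * 2 powr (- real r / 8) * psi N + 5 * sqrt (real N)) sequentially)"
proof -
  obtain C where C: "C > 0" "\<And>H. small_family V H \<Longrightarrow> (AE x in U. eventually (block_bound C H x) sequentially)"
    using block_estimate[OF V] by blast
  have evC: "eventually (\<lambda>n::nat. C \<le> 2 powr (real n / 2)) sequentially" by real_asymp
  show ?thesis
  proof (intro exI[of _ "2 * C"] conjI allI impI)
    show "2 * C > 0" using C(1) by simp
    fix H assume "small_family V H"
    from C(2)[OF this] show "AE x in U. eventually (\<lambda>N. \<forall>r h. 2 * r \<le> lev N \<longrightarrow> h \<in> H r \<longrightarrow>
      \<bar>S h N x\<bar> \<le> 2 * C * 2 powr (- real r / 8) * psi N + 5 * sqrt (real N)) sequentially"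
    proof eventually_elim
      case (elim x)
      from eventually_lev[OF elim] lev_scale_le_psi' eventually_ge_at_top[of 1] eventually_lev[OF evC]
      show ?case
      proof eventually_elim
        case (elim N)
        show ?case
        proof (intro allI impI)
          fix r h assume r: "2 * r \<le> lev N" and h: "h \<in> H r"
          let ?n = "lev N"
          have "N div 2 ^ ?n * 2 ^ ?n = 0" using lev_less[of N] by simp
          moreover have "{0<..N} = {1..N}" by auto
          ultimately have "\<bar>S h N x\<bar> \<le> C * 2 powr (- real r / 8) * sqrt (2 powr real ?n * ln (real ?n)) + C + real (N mod 2 ^ ((?n + 1) div 2))"
            using elim(1)[unfolded block_bound_def, rule_format, OF r h, of ?n N] lev_less[of N] by simp
          also have "C * 2 powr (- real r / 8) * sqrt (2 powr real ?n * ln (real ?n)) \<le> C * 2 powr (- real r / 8) * (2 * psi N)"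
            using C(1) elim(2) by (intro mult_left_mono) auto
          \<comment> \<open>\<open>C\<close> and the binary remainder together cost at most
            \<open>3 * 2 powr (n / 2)\<close>, a multiple of \<open>sqrt N\<close>.\<close>
          finally show "\<bar>S h N x\<bar> \<le> 2 * C * 2 powr (- real r / 8) * psi N + 5 * sqrt (real N)"
            using lev_remainder[OF elim(3)] mod_half_power_le[of N ?n] elim(4) by simp
        qed
      qed
    qed
  qed
qed

lemma psum_trig_tail:
  assumes p: "rtrig d p" "(\<integral>x. p x \<partial>U) = 0" "\<And>x. \<bar>p x\<bar> \<le> 1"
    and k0: "gap_from (2 * d + 2) k0" and B: "finite B" "B \<subseteq> late k0" "real (card B) \<le> M"
    and l: "0 < l" "l \<le> e" "e \<le> 1/2"
  shows "measure U {x. y \<le> \<bar>psum p B x\<bar>} \<le> 2 * exp ((1/2 + e) * l\<^sup>2 * (\<integral>x. (p x)\<^sup>2 \<partial>U) * M - l * y)"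
proof -
  define v where "v = (\<integral>x. (p x)\<^sup>2 \<partial>U)"
  have v0: "v \<ge> 0" by (simp add: v_def)
  note [measurable] = rtrig_measurable[OF p(1)]
  have B1: "B \<subseteq> {1..}" using B(2) by (auto simp: late_def)
  have gap: "(2 * d + 1) * a k < a k'" if "k \<in> \<sigma> ` B" "k' \<in> \<sigma> ` B" "k < k'" for k k'
    using that B(2) k0 by (intro gap_from_less) (auto simp: late_def)
  have mgf: "(\<integral>x. exp (l' * psum p B x) \<partial>U) \<le> exp ((1/2 + e) * l\<^sup>2 * v * M)" if l': "\<bar>l'\<bar> = l" for l'
  proof -
    have "(\<integral>x. exp (l' * (\<Sum>k\<in>\<sigma> ` B. p (real (a k) * x))) \<partial>U) \<le> exp ((1/2 + e) * l'\<^sup>2 * v * real (card (\<sigma> ` B)))"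
      unfolding v_def
      by (rule rtrig_mgf_le[OF _ p gap]) (use B l l' k0 in \<open>auto simp: late_def intro!: gap_from_pos\<close>)
    also have "l'\<^sup>2 = l\<^sup>2" using l' by (metis power2_abs)
    also have "card (\<sigma> ` B) = card B" by (rule card_image[OF inj_sigma[OF B1]])
    also have "exp ((1/2 + e) * l\<^sup>2 * v * real (card B)) \<le> exp ((1/2 + e) * l\<^sup>2 * v * M)"
      using B(3) l v0 by (simp add: mult_left_mono)
    finally show ?thesis by (simp add: psum_image[OF B1])
  qed
  have b: "\<bar>psum p B x\<bar> \<le> 1 * real (card B)" for x by (rule psum_abs_le[OF p(3)])
  show ?thesis unfolding v_def[symmetric] by (rule U_Chernoff_abs[OF _ b l(1) mgf]) auto
qed

text \<open>At fixed degree the tilt tends to 0, so the exponential moment is asymptotically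
  Gaussian and the constant is sharp. With only \<open>2 ^ s\<close> checkpoints per level,
  \<open>s\<close> fixed, the union bound costs a constant and any power of \<open>n\<close> below
  \<open>- 1\<close> suffices.\<close>

lemma trig_checkpoints:
  assumes p: "rtrig d p" "(\<integral>x. p x \<partial>U) = 0" "\<And>x. \<bar>p x\<bar> \<le> 1"
    and k0: "gap_from (2 * d + 2) k0" and c: "c > 0" "(\<integral>x. (p x)\<^sup>2 \<partial>U) < c\<^sup>2"
  shows "AE x in U. eventually (\<lambda>n. \<forall>j\<in>{1..2 ^ s}.
     \<bar>psum p ({1..j * 2 ^ (n - s)} \<inter> late k0) x\<bar> < c * sqrt (2 * real (j * 2 ^ (n - s)) * ln (real n))) sequentially"
proof -
  define v where "v = (\<integral>x. (p x)\<^sup>2 \<partial>U)"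
  have v0: "v \<ge> 0" by (simp add: v_def)
  define q where "q = v / c\<^sup>2"
  \<comment> \<open>Divides the slack \<open>1 - q\<close> between the loss in the variance and
    summability: \<open>(1 + 2 * e) * q - 2 \<le> - (1 + 2 * e)\<close>.\<close>
  define e where "e = (1 - q) / 4"
  have q: "0 \<le> q" "q < 1" using c v0 by (auto simp: q_def v_def)
  have e: "0 < e" "e \<le> 1/2" using q by (auto simp: e_def)
  have eq: "(1 + 2 * e) * q \<le> 1 - 2 * e"
  proof -
    have "2 * e * q \<le> 2 * e * 1" using e q by (intro mult_left_mono) auto
    moreover have "q = 1 - 4 * e" by (simp add: e_def field_simps)
    moreover have "(1 + 2 * e) * q = q + 2 * e * q" by (simp add: algebra_simps)
    ultimately show ?thesis by linarith
  qed
  note [measurable] = rtrig_measurable[OF p(1)]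
  define E where "E = (\<lambda>n j. {x. c * sqrt (2 * real (j * 2 ^ (n - s)) * ln (real n)) \<le> \<bar>psum p ({1..j * 2 ^ (n - s)} \<inter> late k0) x\<bar>})"
  have Em: "E n j \<in> sets borel" for n j unfolding E_def by measurable
  have small: "eventually (\<lambda>n. sqrt (2 * ln (real n) / 2 ^ (n - s)) / c \<le> e) sequentially"
  proof -
    have "eventually (\<lambda>n::nat. sqrt (2 * ln (real n) / 2 powr (real n - real s)) / c \<le> e) sequentially"
      using e c by real_asymp
    then show ?thesis using eventually_ge_at_top[of s]
      by eventually_elim (simp add: of_nat_diff flip: powr_realpow)
  qed
  have ev: "eventually (\<lambda>n. measure U (\<Union>j\<in>{1..2 ^ s}. E n j) \<le> 2 ^ s * (2 * real n powr (- (1 + 2 * e)))) sequentially"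
    using small eventually_ge_at_top[of 3]
  proof eventually_elim
    case (elim n)
    have ln: "ln (real n) > 0" using elim by simp
    have one: "measure U (E n j) \<le> 2 * real n powr (- (1 + 2 * e))" if j: "j \<in> {1..2 ^ s}" for j
    proof -
      define M where "M = real (j * 2 ^ (n - s))"
      \<comment> \<open>The optimal tilt with the variance replaced by \<open>c^2 * M\<close>, that
        is, the threshold \<open>c * sqrt (2 * M * ln n)\<close> divided by
        \<open>c^2 * M\<close>.\<close>
      define l where "l = sqrt (2 * ln (real n) / M) / c"
      have M: "M \<ge> 2 ^ (n - s)" using j by (simp add: M_def)
      then have Mp: "M > 0" by (meson less_le_trans zero_less_numeral zero_less_power)
      have l0: "l > 0" using Mp ln c by (simp add: l_def)
      have "l \<le> sqrt (2 * ln (real n) / 2 ^ (n - s)) / c"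
        unfolding l_def using M Mp ln c by (intro divide_right_mono real_sqrt_le_mono divide_left_mono) auto
      then have le: "l \<le> e" using elim(1) by linarith
      have cB: "real (card ({1..j * 2 ^ (n - s)} \<inter> late k0)) \<le> M"
      proof -
        have "card ({1..j * 2 ^ (n - s)} \<inter> late k0) \<le> card {1..j * 2 ^ (n - s)}" by (intro card_mono) auto
        then have "real (card ({1..j * 2 ^ (n - s)} \<inter> late k0)) \<le> real (card {1..j * 2 ^ (n - s)})" by (rule of_nat_mono)
        then show ?thesis by (simp add: M_def)
      qed
      have "measure U (E n j) \<le> 2 * exp ((1/2 + e) * l\<^sup>2 * v * M - l * (c * sqrt (2 * M * ln (real n))))"
        unfolding E_def v_def M_def[symmetric]
        by (rule psum_trig_tail[OF p k0 _ _ cB l0 le e(2)]) auto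
      also have "(1/2 + e) * l\<^sup>2 * v * M - l * (c * sqrt (2 * M * ln (real n))) = ((1 + 2 * e) * q - 2) * ln (real n)"
      proof -
        have "l\<^sup>2 * M = 2 * ln (real n) / c\<^sup>2" using Mp ln by (simp add: l_def power_divide)
        have "(1/2 + e) * l\<^sup>2 * v * M = (1/2 + e) * v * (l\<^sup>2 * M)" by simp
        then have 1: "(1/2 + e) * l\<^sup>2 * v * M = (1 + 2 * e) * q * ln (real n)"
          unfolding \<open>l\<^sup>2 * M = _\<close> using c(1) by (simp add: q_def field_simps)
        have "l * c = sqrt (2 * ln (real n) / M)" using c by (simp add: l_def)
        then have "l * (c * sqrt (2 * M * ln (real n))) = sqrt (2 * ln (real n) / M) * sqrt (2 * M * ln (real n))"
          by (simp flip: mult.assoc)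
        also have "\<dots> = sqrt ((2 * ln (real n)) * (2 * ln (real n)))"
          using Mp by (simp add: real_sqrt_mult[symmetric] mult_ac)
        also have "\<dots> = 2 * ln (real n)" unfolding real_sqrt_abs2 using ln by simp
        finally show ?thesis using 1 by (simp add: algebra_simps)
      qed
      also have "2 * exp (((1 + 2 * e) * q - 2) * ln (real n)) \<le> 2 * exp (- (1 + 2 * e) * ln (real n))"
        using eq ln by (intro mult_left_mono) (auto intro!: mult_right_mono)
      also have "\<dots> = 2 * real n powr (- (1 + 2 * e))" using elim(2) by (simp add: powr_def)
      finally show ?thesis .
    qed
    have "measure U (\<Union>j\<in>{1..2 ^ s}. E n j) \<le> real (card {1..2 ^ s :: nat}) * (2 * real n powr (- (1 + 2 * e)))"
      by (rule U_union_le) (use Em one in auto)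
    then show ?case by simp
  qed
  have "summable (\<lambda>n. 2 ^ s * (2 * real n powr (- (1 + 2 * e))))"
    using e by (intro summable_mult) (simp add: summable_real_powr_iff)
  then have "AE x in U. eventually (\<lambda>n. x \<notin> (\<Union>j\<in>{1..2 ^ s}. E n j)) sequentially"
    by (intro AE_eventually_U[OF _ ev]) (auto intro!: sets.finite_UN Em)
  then show ?thesis
  proof eventually_elim
    case (elim x)
    from elim show ?case
      by eventually_elim (simp add: E_def not_le)
  qed
qed

text \<open>Rounding \<open>N\<close> down to a multiple of \<open>2 ^ (n - s)\<close> gives a
  checkpoint, where the sharp bound holds. The rest is controlled by the crude block bound, whose
  factor \<open>2 powr (- s / 8)\<close> is made small by the choice of \<open>s\<close>.\<close>

lemma lil_upper_trig:
  assumes bv: "bvc V p" "V \<ge> 1" and p: "rtrig d p"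
  shows "lil_upper p (sqrt (\<integral>x. (p x)\<^sup>2 \<partial>U))"
  unfolding lil_upper_def
proof (intro allI impI)
  fix \<epsilon> :: real assume eps: "\<epsilon> > 0"
  define v where "v = (\<integral>x. (p x)\<^sup>2 \<partial>U)"
  have v0: "v \<ge> 0" by (simp add: v_def)
  \<comment> \<open>The four quarters of \<open>\<epsilon>\<close> pay for the strict inequality of
    variances, the passage from \<open>ln n\<close> to the iterated logarithm, the sum after the
    checkpoint and the lower order terms.\<close>
  define c where "c = sqrt v + \<epsilon> / 4"
  have c: "c > 0" using v0 eps by (simp add: c_def add_nonneg_pos)
  have "sqrt v < c" using eps by (simp add: c_def)
  then have vc: "(\<integral>x. (p x)\<^sup>2 \<partial>U) < c\<^sup>2" using v0 power_strict_mono[of "sqrt v" c 2] by (simp add: v_def)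
  obtain k0 where k0: "gap_from (2 * d + 2) k0" using gap_from_exists[of "2 * d + 2"] by auto
  define H where "H = (\<lambda>r::nat. if r = 0 then {p} else {})"
  note h = bvcD[OF bv(1)]
  have "(\<integral>x. \<bar>p x\<bar> \<partial>U) \<le> 1" by (rule integral_U_le_const) (use h in auto)
  then have H: "small_family V H" using bv(1) by (auto simp: small_family_def H_def)
  obtain C where C: "C > 0" "AE x in U. eventually (block_bound C H x) sequentially"
    using block_estimate[OF bv(2)] H by blast
  have "eventually (\<lambda>s::nat. C * 2 powr (- real s / 8) * 2 \<le> \<epsilon> / 4) sequentially"
    using C(1) eps by real_asymp
  then obtain s :: nat where s: "C * 2 powr (- real s / 8) * 2 \<le> \<epsilon> / 4"
    using eventually_happens' sequentially_bot by blast
  have eps4: "\<epsilon> / 4 > 0" using eps by simp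
  define \<delta> where "\<delta> = \<epsilon> / (4 * c)"
  have d: "\<delta> > 0" "c * (1 + \<delta>) = c + \<epsilon> / 4" using c eps by (auto simp: \<delta>_def field_simps)
  show "AE x in U. eventually (\<lambda>N. \<bar>S p N x\<bar> \<le> (sqrt (\<integral>x. (p x)\<^sup>2 \<partial>U) + \<epsilon>) * psi N) sequentially"
    using C(2) trig_checkpoints[OF p h(4) h(3) k0 c vc, of s]
  proof eventually_elim
    case (elim x)
    from eventually_lev[OF elim(1)] eventually_lev[OF elim(2)] lev_scale_le_psi' lev_scale_le_psi[OF d(1)] psi_pos
      sqrt_le_psi[OF eps4, of 5 "real k0 + C"] eventually_ge_at_top[of 1] eventually_lev[OF eventually_ge_at_top[of "2 * s + 1"]]
    show ?case
    proof (eventually_elim)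
      case (elim N)
      define n where "n = lev N"
      define j where "j = N div 2 ^ (n - s)"
      define M where "M = j * 2 ^ (n - s)"
      have n: "n \<ge> 2 * s + 1" using elim(8) by (simp add: n_def)
      have lnn: "ln (real n) \<ge> 0" using n by simp
      have MN: "M \<le> N" by (simp add: M_def j_def)
      have j2: "j \<le> 2 ^ s"
      proof -
        have "N < 2 ^ s * 2 ^ (n - s)" using lev_less[of N] n by (simp add: n_def flip: power_add)
        then show ?thesis unfolding j_def by (simp add: less_mult_imp_div_less less_imp_le)
      qed
      have "\<bar>psum p ({1..M} \<inter> late k0) x\<bar> \<le> c * sqrt (2 * real M * ln (real n))"
      proof (cases "j = 0")
        case True
        then show ?thesis by (simp add: M_def psum_def)
      next
        case False
        then show ?thesis using elim(2) j2 unfolding M_def n_def[symmetric] by (auto intro: less_imp_le)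
      qed
      also have "\<dots> \<le> c * sqrt (2 * real N * ln (real n))"
        using MN c lnn by (intro mult_left_mono real_sqrt_le_mono mult_right_mono) auto
      also have "\<dots> \<le> c * ((1 + \<delta>) * psi N)"
        using elim(4) c unfolding n_def by (intro mult_left_mono) auto
      also have "\<dots> = (c + \<epsilon> / 4) * psi N" using d(2) by (simp flip: mult.assoc)
      finally have 1: "\<bar>psum p ({1..M} \<inter> late k0) x\<bar> \<le> (c + \<epsilon> / 4) * psi N" .
      have 2: "\<bar>S p M x - psum p ({1..M} \<inter> late k0) x\<bar> \<le> 1 * real k0"
        by (rule psum_late[OF h(3)]) auto
      have "\<bar>psum p {M<..N} x\<bar> \<le> C * 2 powr (- (real n - real (n - s) + real 0) / 8) * sqrt (2 powr real n * ln (real n)) + C + real (N mod 2 ^ ((n + 1) div 2))"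
        using elim(1)[unfolded block_bound_def, rule_format, of 0 p "n - s" N] lev_less[of N] n
        by (simp add: H_def M_def j_def n_def[symmetric])
      also have "\<dots> \<le> C * 2 powr (- real s / 8) * (2 * psi N) + C + 5 * sqrt (real N)"
      proof (intro add_mono order_refl)
        show "C * 2 powr (- (real n - real (n - s) + real 0) / 8) * sqrt (2 powr real n * ln (real n)) \<le> C * 2 powr (- real s / 8) * (2 * psi N)"
          using n elim(3) C(1) unfolding n_def[symmetric] by (simp add: of_nat_diff)
        show "real (N mod 2 ^ ((n + 1) div 2)) \<le> 5 * sqrt (real N)"
          using lev_remainder[OF elim(7)] mod_half_power_le[of N n] powr_ge_zero[of 2 "real n / 2"] unfolding n_def by linarith
      qed
      also have "C * 2 powr (- real s / 8) * (2 * psi N) = (C * 2 powr (- real s / 8) * 2) * psi N" by simp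
      also have "\<dots> \<le> \<epsilon> / 4 * psi N" using s elim(5) by (intro mult_right_mono) auto
      finally have 3: "\<bar>psum p {M<..N} x\<bar> \<le> \<epsilon> / 4 * psi N + (5 * sqrt (real N) + C)" by simp
      have "S p N x = S p M x + psum p {M<..N} x" by (rule psum_split[OF MN])
      then have "\<bar>S p N x\<bar> \<le> (c + \<epsilon> / 4) * psi N + \<epsilon> / 4 * psi N + (5 * sqrt (real N) + (real k0 + C))"
        using 1 2 3 by linarith
      also have "\<dots> \<le> (c + \<epsilon> / 4) * psi N + \<epsilon> / 4 * psi N + \<epsilon> / 4 * psi N" using elim(6) by simp
      also have "\<dots> = (sqrt (\<integral>x. (p x)\<^sup>2 \<partial>U) + \<epsilon>) * psi N" by (simp add: c_def v_def algebra_simps)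
      finally show ?case .
    qed
  qed
qed

end

subsection \<open>The lower bound for trigonometric polynomials\<close>

text \<open>A majorant combines several tilts and is no longer a product. Factorisation is linear in
  each block, so it extends from products to their linear span.\<close>

inductive polyf :: "(nat \<Rightarrow> nat) \<Rightarrow> nat \<Rightarrow> nat set \<Rightarrow> (real \<Rightarrow> real) \<Rightarrow> bool"
  for a :: "nat \<Rightarrow> nat" and d :: nat and A :: "nat set" where
  prod: "(\<And>k. k \<in> A \<Longrightarrow> rtrig d (P k)) \<Longrightarrow> polyf a d A (\<lambda>x. \<Prod>k\<in>A. P k (real (a k) * x))"
| add: "polyf a d A F \<Longrightarrow> polyf a d A G \<Longrightarrow> polyf a d A (\<lambda>x. F x + G x)"
| scale: "polyf a d A F \<Longrightarrow> polyf a d A (\<lambda>x. c * F x)"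

lemma rtrig_prod_bounded:
  assumes "finite A" "\<And>k. k \<in> A \<Longrightarrow> rtrig d (P k)"
  shows "(\<lambda>x. \<Prod>k\<in>A. P k (real (a k) * x)) \<in> borel_measurable borel"
    "\<exists>c. \<forall>x. \<bar>\<Prod>k\<in>A. P k (real (a k) * x)\<bar> \<le> c"
proof -
  have "(\<lambda>x. P k (real (a k) * x)) \<in> borel_measurable borel" if "k \<in> A" for k
    by (rule measurable_compose[OF _ rtrig_measurable[OF assms(2)[OF that]]]) simp
  then show "(\<lambda>x. \<Prod>k\<in>A. P k (real (a k) * x)) \<in> borel_measurable borel"
    by (rule borel_measurable_prod)
  have "\<exists>c. \<forall>x. \<bar>P k x\<bar> \<le> c" if "k \<in> A" for k using rtrig_bounded[OF assms(2)[OF that]] by metis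
  then obtain c where c: "\<And>k x. k \<in> A \<Longrightarrow> \<bar>P k x\<bar> \<le> c k" by metis
  have "\<bar>\<Prod>k\<in>A. P k (real (a k) * x)\<bar> \<le> (\<Prod>k\<in>A. c k)" for x
    unfolding abs_prod by (intro prod_mono) (auto intro: c)
  then show "\<exists>c. \<forall>x. \<bar>\<Prod>k\<in>A. P k (real (a k) * x)\<bar> \<le> c" by blast
qed

lemma polyf_bounded:
  assumes "polyf a d A F" "finite A"
  shows "F \<in> borel_measurable borel" "\<exists>c. \<forall>x. \<bar>F x\<bar> \<le> c"
proof -
  have "F \<in> borel_measurable borel \<and> (\<exists>c. \<forall>x. \<bar>F x\<bar> \<le> c)"
    using assms(1)
  proof induction
    case (prod P)
    then show ?case using rtrig_prod_bounded[OF assms(2)] by blast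
  next
    case (add F G)
    then obtain c c' where "\<And>x. \<bar>F x\<bar> \<le> c" "\<And>x. \<bar>G x\<bar> \<le> c'" by blast
    then have "\<bar>F x + G x\<bar> \<le> c + c'" for x by (meson abs_triangle_ineq add_mono order_trans)
    then show ?case using add by auto
  next
    case (scale F c)
    then obtain C where C: "\<And>x. \<bar>F x\<bar> \<le> C" by blast
    then have "\<bar>c * F x\<bar> \<le> \<bar>c\<bar> * C" for x unfolding abs_mult by (intro mult_left_mono) auto
    then show ?case using scale by auto
  qed
  then show "F \<in> borel_measurable borel" "\<exists>c. \<forall>x. \<bar>F x\<bar> \<le> c" by auto
qed

lemma bounded_prod:
  fixes F :: "'j \<Rightarrow> real \<Rightarrow> real"
  assumes "finite J" "\<And>j. j \<in> J \<Longrightarrow> F j \<in> borel_measurable borel" "\<And>j. j \<in> J \<Longrightarrow> \<exists>c. \<forall>x. \<bar>F j x\<bar> \<le> c"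
  shows "(\<lambda>x. \<Prod>j\<in>J. F j x) \<in> borel_measurable borel" "\<exists>c. \<forall>x. \<bar>\<Prod>j\<in>J. F j x\<bar> \<le> c"
proof -
  show "(\<lambda>x. \<Prod>j\<in>J. F j x) \<in> borel_measurable borel" using assms(2) by (rule borel_measurable_prod)
  obtain c where c: "\<And>j x. j \<in> J \<Longrightarrow> \<bar>F j x\<bar> \<le> c j" using assms(3) by metis
  have "\<bar>\<Prod>j\<in>J. F j x\<bar> \<le> (\<Prod>j\<in>J. c j)" for x
    unfolding abs_prod by (intro prod_mono) (auto intro: c)
  then show "\<exists>c. \<forall>x. \<bar>\<Prod>j\<in>J. F j x\<bar> \<le> c" by blast
qed

text \<open>The index sets may interleave, so the blocks cannot be ordered. Instead one block at a time is
  absorbed into the index set of the remaining product.\<close>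
lemma integral_prod_polyf:
  fixes a :: "nat \<Rightarrow> nat" and F :: "'j \<Rightarrow> real \<Rightarrow> real"
  assumes J: "finite J" and fin: "\<And>j. j \<in> J \<Longrightarrow> finite (A j)" and dis: "disjoint_family_on A J"
    and F: "\<And>j. j \<in> J \<Longrightarrow> polyf a d (A j) (F j)"
    and good: "\<And>j. j \<in> J \<Longrightarrow> A j \<subseteq> G"
    and gap: "\<And>k k'. k \<in> G \<Longrightarrow> k' \<in> G \<Longrightarrow> k < k' \<Longrightarrow> (d + 1) * a k < a k'" "\<And>k. k \<in> G \<Longrightarrow> a k > 0"
  shows "(\<integral>x. (\<Prod>j\<in>J. F j x) \<partial>U) = (\<Prod>j\<in>J. \<integral>x. F j x \<partial>U)"
proof -
  have *: "(\<integral>x. (\<Prod>k\<in>B. P k (real (a k) * x)) * (\<Prod>j\<in>J. F j x) \<partial>U)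
      = (\<Prod>k\<in>B. \<integral>x. P k x \<partial>U) * (\<Prod>j\<in>J. \<integral>x. F j x \<partial>U)"
    if "finite B" "B \<subseteq> G" "\<And>k. k \<in> B \<Longrightarrow> rtrig d (P k)" "\<And>j. j \<in> J \<Longrightarrow> B \<inter> A j = {}" for B P
    using J fin dis F good that
  proof (induction J arbitrary: B P rule: finite_induct)
    case empty
    have "(\<integral>x. (\<Prod>k\<in>B. P k (real (a k) * x)) \<partial>U) = (\<Prod>k\<in>B. \<integral>x. P k x \<partial>U)"
    proof (rule integral_rtrig_prod[where d=d])
      show "(d + 1) * a k < a k'" if "k \<in> B" "k' \<in> B" "k < k'" for k k'
        using that empty.prems(6) by (intro gap(1)) auto
    qed (use empty gap in auto)
    then show ?case by simp
  next
    case (insert i J)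
    let ?G = "\<lambda>x. \<Prod>j\<in>J. F j x"
    let ?I = "\<Prod>j\<in>J. \<integral>x. F j x \<partial>U"
    have fi: "finite (A i)" "A i \<subseteq> G" using insert.prems by auto
    have disJ: "disjoint_family_on A J" using insert.prems(2) by (auto simp: disjoint_family_on_def)
    have disi: "A i \<inter> A j = {}" if "j \<in> J" for j
      using insert.prems(2) insert.hyps that unfolding disjoint_family_on_def by (metis insertCI)
    have IH: "(\<integral>x. (\<Prod>k\<in>B. P k (real (a k) * x)) * ?G x \<partial>U) = (\<Prod>k\<in>B. \<integral>x. P k x \<partial>U) * ?I"
      if "finite B" "B \<subseteq> G" "\<And>k. k \<in> B \<Longrightarrow> rtrig d (P k)" "\<And>j. j \<in> J \<Longrightarrow> B \<inter> A j = {}" for B P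
      by (rule insert.IH) (use insert.prems disJ that in auto)
    have Fm: "F j \<in> borel_measurable borel" "\<exists>c. \<forall>x. \<bar>F j x\<bar> \<le> c" if "j \<in> J" for j
    proof -
      have j: "polyf a d (A j) (F j)" "finite (A j)" using insert.prems that by auto
      show "F j \<in> borel_measurable borel" "\<exists>c. \<forall>x. \<bar>F j x\<bar> \<le> c" by (rule polyf_bounded[OF j])+
    qed
    have Gm: "?G \<in> borel_measurable borel" "\<exists>c. \<forall>x. \<bar>?G x\<bar> \<le> c"
      by (rule bounded_prod[OF insert.hyps(1)], erule Fm, erule Fm)+
    have int: "integrable U (\<lambda>x. (\<Prod>k\<in>B. P k (real (a k) * x)) * H x * ?G x)" "integrable U H" if H: "polyf a d (A i) H" for H
    proof -
      note [measurable] = rtrig_prod_bounded(1)[of B d P a, OF insert.prems(5,7)] polyf_bounded(1)[OF H fi(1)] Gm(1)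
      obtain c1 where c1: "\<And>x. \<bar>\<Prod>k\<in>B. P k (real (a k) * x)\<bar> \<le> c1"
        using rtrig_prod_bounded(2)[of B d P a, OF insert.prems(5,7)] by blast
      obtain c2 where c2: "\<And>x. \<bar>H x\<bar> \<le> c2" using polyf_bounded(2)[OF H fi(1)] by blast
      obtain c3 where c3: "\<And>x. \<bar>?G x\<bar> \<le> c3" using Gm(2) by blast
      note c = c1 c2 c3
      show "integrable U (\<lambda>x. (\<Prod>k\<in>B. P k (real (a k) * x)) * H x * ?G x)"
      proof (rule integrable_U[where c="c1 * c2 * c3"])
        have nn: "0 \<le> c1" "0 \<le> c2" "0 \<le> c3" using c1[of 0] c2[of 0] c3[of 0] by linarith+
        show "norm ((\<Prod>k\<in>B. P k (real (a k) * x)) * H x * ?G x) \<le> c1 * c2 * c3" for x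
          unfolding real_norm_def abs_mult using nn by (intro mult_mono c mult_nonneg_nonneg) auto
      qed measurable
      show "integrable U H" by (rule integrable_U[where c=c2]) (use c in auto)
    qed
    have "polyf a d (A i) (F i)" using insert.prems by auto
    then have "(\<integral>x. (\<Prod>k\<in>B. P k (real (a k) * x)) * F i x * ?G x \<partial>U) = (\<Prod>k\<in>B. \<integral>x. P k x \<partial>U) * (\<integral>x. F i x \<partial>U) * ?I"
    proof induction
      case (prod Q)
      \<comment> \<open>A product generating block \<open>i\<close> is merged with the accumulated
        product over \<open>B\<close>; as the two index sets are disjoint, membership in
        \<open>B\<close> selects the factor.\<close>
      let ?R = "\<lambda>k. if k \<in> B then P k else Q k"
      have BA: "B \<inter> A i = {}" using insert.prems by auto
      have m: "(\<Prod>k\<in>B \<union> A i. if k \<in> B then f k else g k) = (\<Prod>k\<in>B. f k) * (\<Prod>k\<in>A i. g k)" for f g :: "nat \<Rightarrow> real"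
      proof -
        have "(\<Prod>k\<in>A i. if k \<in> B then f k else g k) = (\<Prod>k\<in>A i. g k)"
          using BA by (intro prod.cong) auto
        then show ?thesis using prod.union_disjoint[OF insert.prems(5) fi(1) BA, of "\<lambda>k. if k \<in> B then f k else g k"] by simp
      qed
      have "(\<integral>x. (\<Prod>k\<in>B \<union> A i. ?R k (real (a k) * x)) * ?G x \<partial>U) = (\<Prod>k\<in>B \<union> A i. \<integral>x. ?R k x \<partial>U) * ?I"
      proof (rule IH)
        show "(B \<union> A i) \<inter> A j = {}" if "j \<in> J" for j using insert.prems(8)[of j] disi[OF that] that by blast
      qed (use insert.prems fi prod in auto)
      moreover have "(\<Prod>k\<in>B \<union> A i. ?R k (real (a k) * x)) = (\<Prod>k\<in>B. P k (real (a k) * x)) * (\<Prod>k\<in>A i. Q k (real (a k) * x))" for x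
        using m[of "\<lambda>k. P k (real (a k) * x)" "\<lambda>k. Q k (real (a k) * x)"] by (simp add: if_distrib[of "\<lambda>f. f _"] cong: if_cong)
      moreover have "(\<Prod>k\<in>B \<union> A i. \<integral>x. ?R k x \<partial>U) = (\<Prod>k\<in>B. \<integral>x. P k x \<partial>U) * (\<Prod>k\<in>A i. \<integral>x. Q k x \<partial>U)"
        using m[of "\<lambda>k. \<integral>x. P k x \<partial>U" "\<lambda>k. \<integral>x. Q k x \<partial>U"] by (simp add: if_distrib[of "\<lambda>f. \<integral>x. f x \<partial>U"] cong: if_cong)
      moreover have "(\<integral>x. (\<Prod>k\<in>A i. Q k (real (a k) * x)) \<partial>U) = (\<Prod>k\<in>A i. \<integral>x. Q k x \<partial>U)"
      proof (rule integral_rtrig_prod[where d=d])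
        show "(d + 1) * a k < a k'" if "k \<in> A i" "k' \<in> A i" "k < k'" for k k'
          using that fi(2) by (intro gap(1)) auto
      qed (use fi prod gap in auto)
      ultimately show ?case by simp
    next
      case (add H K)
      have "(\<integral>x. (\<Prod>k\<in>B. P k (real (a k) * x)) * (H x + K x) * ?G x \<partial>U)
        = (\<integral>x. (\<Prod>k\<in>B. P k (real (a k) * x)) * H x * ?G x + (\<Prod>k\<in>B. P k (real (a k) * x)) * K x * ?G x \<partial>U)"
        by (simp add: algebra_simps)
      also have "\<dots> = (\<Prod>k\<in>B. \<integral>x. P k x \<partial>U) * (\<integral>x. H x \<partial>U) * ?I + (\<Prod>k\<in>B. \<integral>x. P k x \<partial>U) * (\<integral>x. K x \<partial>U) * ?I"
        using add by (subst Bochner_Integration.integral_add) (auto intro: int)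
      also have "\<dots> = (\<Prod>k\<in>B. \<integral>x. P k x \<partial>U) * (\<integral>x. H x + K x \<partial>U) * ?I"
        using int(2)[OF add.hyps(1)] int(2)[OF add.hyps(2)] by (simp add: algebra_simps)
      finally show ?case .
    next
      case (scale H c)
      have "(\<integral>x. (\<Prod>k\<in>B. P k (real (a k) * x)) * (c * H x) * ?G x \<partial>U)
        = (\<integral>x. c * ((\<Prod>k\<in>B. P k (real (a k) * x)) * H x * ?G x) \<partial>U)"
        by (simp add: mult_ac)
      also have "\<dots> = c * ((\<Prod>k\<in>B. \<integral>x. P k x \<partial>U) * (\<integral>x. H x \<partial>U) * ?I)" by (simp only: integral_mult_right_zero scale)
      finally show ?case by simp
    qed
    then show ?case using insert.hyps by (simp add: mult.assoc)
  qed
  show ?thesis using *[of "{}"] by simp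
qed

text \<open>The exponential tilt with each factor \<open>exp (l * p)\<close> replaced by its
  second-order Taylor polynomial, so that it remains a trigonometric polynomial in each
  index.\<close>

definition quadprod :: "(nat \<Rightarrow> nat) \<Rightarrow> nat set \<Rightarrow> (real \<Rightarrow> real) \<Rightarrow> real \<Rightarrow> real \<Rightarrow> real" where
  "quadprod a A p l x = (\<Prod>k\<in>A. 1 + l * p (real (a k) * x) + l\<^sup>2 / 2 * (p (real (a k) * x))\<^sup>2)"

lemma polyf_quadprod: "rtrig d p \<Longrightarrow> polyf a (2 * d) A (quadprod a A p l)"
  unfolding quadprod_def[abs_def]
  by (rule polyf.prod[where P="\<lambda>k x. 1 + l * p x + l\<^sup>2 / 2 * (p x)\<^sup>2"]) (rule rtrig_quadratic)

lemma quadprod_bounds: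
  assumes "finite A" "\<And>x. \<bar>p x\<bar> \<le> 1" "\<bar>l\<bar> \<le> 1/2"
  shows "exp (l * (\<Sum>k\<in>A. p (real (a k) * x)) - real (card A) * \<bar>l\<bar>^3) \<le> quadprod a A p l x"
    "quadprod a A p l x \<le> exp (l * (\<Sum>k\<in>A. p (real (a k) * x)) + real (card A) * \<bar>l\<bar>^3)"
proof -
  have b: "\<bar>l * p y\<bar> \<le> \<bar>l\<bar>" for y
    unfolding abs_mult using mult_left_mono[OF assms(2), of "\<bar>l\<bar>"] by simp
  then have c: "\<bar>l * p y\<bar>^3 \<le> \<bar>l\<bar>^3" for y by (intro power_mono) auto
  have half: "\<bar>l * p y\<bar> \<le> 1/2" for y using b[of y] assms(3) by linarith
  have e: "1 + l * p y + l\<^sup>2 / 2 * (p y)\<^sup>2 = 1 + l * p y + (l * p y)\<^sup>2 / 2" for y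
    by (simp add: power_mult_distrib)
  have lo: "exp (l * p y - \<bar>l\<bar>^3) \<le> 1 + l * p y + l\<^sup>2 / 2 * (p y)\<^sup>2" for y
  proof -
    have "exp (l * p y - \<bar>l\<bar>^3) \<le> exp (l * p y - \<bar>l * p y\<bar>^3)" using c[of y] by simp
    also have "\<dots> \<le> 1 + l * p y + (l * p y)\<^sup>2 / 2" by (rule exp_quadratic_le[OF half])
    finally show ?thesis unfolding e .
  qed
  have hi: "1 + l * p y + l\<^sup>2 / 2 * (p y)\<^sup>2 \<le> exp (l * p y + \<bar>l\<bar>^3)" for y
  proof -
    have "1 + l * p y + (l * p y)\<^sup>2 / 2 \<le> exp (l * p y + \<bar>l * p y\<bar>^3)" by (rule exp_quadratic_ge[OF half])
    also have "\<dots> \<le> exp (l * p y + \<bar>l\<bar>^3)" using c[of y] by simp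
    finally show ?thesis unfolding e .
  qed
  have "l * (\<Sum>k\<in>A. p (real (a k) * x)) - real (card A) * \<bar>l\<bar>^3 = (\<Sum>k\<in>A. l * p (real (a k) * x) - \<bar>l\<bar>^3)"
    by (simp add: sum_subtractf sum_distrib_left)
  then show "exp (l * (\<Sum>k\<in>A. p (real (a k) * x)) - real (card A) * \<bar>l\<bar>^3) \<le> quadprod a A p l x"
    unfolding quadprod_def by (simp only: exp_sum[OF assms(1)]) (rule prod_mono, rule conjI[OF exp_ge_zero lo])
  have "l * (\<Sum>k\<in>A. p (real (a k) * x)) + real (card A) * \<bar>l\<bar>^3 = (\<Sum>k\<in>A. l * p (real (a k) * x) + \<bar>l\<bar>^3)"
    by (simp add: sum.distrib sum_distrib_left)
  moreover have nn: "0 \<le> 1 + l * p y + l\<^sup>2 / 2 * (p y)\<^sup>2" for y using lo[of y] by (meson exp_ge_zero order_trans)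
  ultimately show "quadprod a A p l x \<le> exp (l * (\<Sum>k\<in>A. p (real (a k) * x)) + real (card A) * \<bar>l\<bar>^3)"
    unfolding quadprod_def by (simp only: exp_sum[OF assms(1)]) (rule prod_mono, rule conjI[OF nn hi])
qed

lemma integral_quadprod:
  assumes "finite A" "rtrig d p" "(\<integral>x. p x \<partial>U) = 0" "\<And>x. \<bar>p x\<bar> \<le> 1"
    and gap: "\<And>k k'. k \<in> A \<Longrightarrow> k' \<in> A \<Longrightarrow> k < k' \<Longrightarrow> (2 * d + 1) * a k < a k'" "\<And>k. k \<in> A \<Longrightarrow> a k > 0"
  shows "(\<integral>x. quadprod a A p l x \<partial>U) = (1 + l\<^sup>2 / 2 * (\<integral>x. (p x)\<^sup>2 \<partial>U)) ^ card A"
proof -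
  note [measurable] = rtrig_measurable[OF assms(2)]
  have "integrable U p" "integrable U (\<lambda>x. (p x)\<^sup>2)"
    by (rule integrable_U[where c=1]; use assms(4) in \<open>auto simp: abs_square_le_1\<close>)+
  then have i: "(\<integral>x. 1 + l * p x + l\<^sup>2 / 2 * (p x)\<^sup>2 \<partial>U) = 1 + l\<^sup>2 / 2 * (\<integral>x. (p x)\<^sup>2 \<partial>U)"
    using U.prob_space assms(3) by simp
  have "(\<integral>x. quadprod a A p l x \<partial>U) = (\<Prod>k\<in>A. \<integral>x. 1 + l * p x + l\<^sup>2 / 2 * (p x)\<^sup>2 \<partial>U)"
    unfolding quadprod_def
  proof (rule integral_rtrig_prod[where d="2 * d" and P="\<lambda>k x. 1 + l * p x + l\<^sup>2 / 2 * (p x)\<^sup>2"])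
    show "finite A" by (rule assms(1))
    show "rtrig (2 * d) (\<lambda>x. 1 + l * p x + l\<^sup>2 / 2 * (p x)\<^sup>2)" by (rule rtrig_quadratic[OF assms(2)])
    show "(2 * d + 1) * a k < a k'" if "k \<in> A" "k' \<in> A" "k < k'" for k k' by (rule gap(1)[OF that])
    show "0 < a k" if "k \<in> A" for k by (rule gap(2)[OF that])
  qed
  then show ?thesis unfolding i by simp
qed

text \<open>The main tilt has integral \<open>(1 + z) ^ m\<close>, which must not fall below
  \<open>exp (m * z)\<close> by more than a constant factor; the loss is \<open>m * z^2\<close> in
  the exponent.\<close>

lemma power_one_plus_ge:
  fixes z :: real assumes "0 \<le> z" "z \<le> 1" shows "exp (real m * (z - z\<^sup>2)) \<le> (1 + z) ^ m"
proof -
  have z2: "0 \<le> z - z\<^sup>2" "z - z\<^sup>2 \<le> z" using assms by (auto simp: power2_eq_square mult_left_le)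
  have "exp (z - z\<^sup>2) \<le> 1 + (z - z\<^sup>2) + (z - z\<^sup>2)\<^sup>2" using z2 assms by (intro exp_bound) linarith+
  also have "\<dots> \<le> 1 + z" using z2 power_mono[OF z2(2,1), of 2] by simp
  finally have "exp (z - z\<^sup>2) ^ m \<le> (1 + z) ^ m" by (intro power_mono) auto
  then show ?thesis by (simp add: exp_of_nat_mult)
qed

text \<open>The tilt \<open>quadprod \<lambda>\<close> is cut off on both sides of the window \<open>(u, u')\<close> by the tilts \<open>\<lambda> \<plusminus> \<kappa>\<lambda>\<close>.
  This gives a block polynomial \<open>1 - \<phi>\<close> that dominates the indicator of \<open>S \<le> u\<close>.\<close>
lemma indicator_majorant:
  fixes a :: "nat \<Rightarrow> nat" and l \<kappa> :: real
  assumes fin: "finite A" and p: "rtrig d p" "(\<integral>x. p x \<partial>U) = 0" "\<And>x. \<bar>p x\<bar> \<le> 1"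
    and gap: "\<And>k k'. k \<in> A \<Longrightarrow> k' \<in> A \<Longrightarrow> k < k' \<Longrightarrow> (2 * d + 1) * a k < a k'" "\<And>k. k \<in> A \<Longrightarrow> a k > 0"
    and v: "v = (\<integral>x. (p x)\<^sup>2 \<partial>U)" and m: "m = real (card A)"
    and kap: "0 < \<kappa>" "\<kappa> \<le> 1/2" and l: "0 < l" "l * (1 + \<kappa>) \<le> 1/2" "m * (l * (1 + \<kappa>)) ^ 3 \<le> 1"
    and X: "X = l\<^sup>2 * v * m / 2" "4 * exp 3 \<le> exp (\<kappa>\<^sup>2 * X)"
  obtains F where "polyf a (2 * d) A F" "\<And>x. F x \<ge> 0"
    "\<And>x. (\<Sum>k\<in>A. p (real (a k) * x)) \<le> (1 - \<kappa>) * l * v * m \<Longrightarrow> F x \<ge> 1"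
    "(\<integral>x. F x \<partial>U) \<le> 1 - exp (- 2) / 2 * exp (- X * (1 + 2 * \<kappa>))"
proof -
  define \<delta> where "\<delta> = \<kappa> * l"
  define u where "u = (1 - \<kappa>) * l * v * m"
  define u' where "u' = (1 + \<kappa>) * l * v * m"
  define Sx where "Sx x = (\<Sum>k\<in>A. p (real (a k) * x))" for x
  define R where "R t x = quadprod a A p t x" for t x
  \<comment> \<open>Under the tilt \<open>l\<close> the sum concentrates near
    \<open>l * v * m\<close>. The coefficients make the neighbouring tilts dominate above
    \<open>u'\<close> and below \<open>u\<close>; the summand 2 pays for an error of 1 in the
    exponent of each of the two tilts compared.\<close>
  define b1 where "b1 = exp (2 - \<delta> * u')"
  define b2 where "b2 = exp (2 + \<delta> * u)"
  \<comment> \<open>The inverse of the bound \<open>exp (l * u' + 1)\<close> for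
    \<open>\<phi>\<close> inside the window, so that \<open>1 - al * \<phi>\<close> stays
    nonnegative.\<close>
  define al where "al = exp (- l * u' - 1)"
  define \<phi> where "\<phi> x = R l x - b1 * R (l + \<delta>) x - b2 * R (l - \<delta>) x" for x
  have d0: "\<delta> > 0" using kap l by (simp add: \<delta>_def)
  have dl: "\<delta> \<le> l" using kap l by (simp add: \<delta>_def)
  have ts: "\<bar>t\<bar> \<le> l * (1 + \<kappa>)" if "t \<in> {l, l + \<delta>, l - \<delta>}" for t
  proof -
    have "l * (1 + \<kappa>) = l + \<delta>" by (simp add: \<delta>_def algebra_simps)
    then show ?thesis using that d0 dl l(1) by auto
  qed
  have m0: "m \<ge> 0" by (simp add: m)
  have t3: "m * \<bar>t\<bar>^3 \<le> 1" "\<bar>t\<bar> \<le> 1/2" if "t \<in> {l, l + \<delta>, l - \<delta>}" for t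
  proof -
    have "m * \<bar>t\<bar>^3 \<le> m * (l * (1 + \<kappa>))^3" using ts[OF that] m0 by (intro mult_left_mono power_mono) auto
    then show "m * \<bar>t\<bar>^3 \<le> 1" using l(3) by linarith
    show "\<bar>t\<bar> \<le> 1/2" using ts[OF that] l(2) by linarith
  qed
  have Rlo: "exp (t * Sx x - 1) \<le> R t x" and Rhi: "R t x \<le> exp (t * Sx x + 1)" if "t \<in> {l, l + \<delta>, l - \<delta>}" for t x
  proof -
    note q = quadprod_bounds[OF fin, of p, OF p(3) t3(2)[OF that], where a=a and x=x, folded m]
    have "exp (t * Sx x - 1) \<le> exp (t * Sx x - m * \<bar>t\<bar>^3)" using t3(1)[OF that] by simp
    then show "exp (t * Sx x - 1) \<le> R t x" using q(1) unfolding R_def Sx_def by linarith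
    have "exp (t * Sx x + m * \<bar>t\<bar>^3) \<le> exp (t * Sx x + 1)" using t3(1)[OF that] by simp
    then show "R t x \<le> exp (t * Sx x + 1)" using q(2) unfolding R_def Sx_def by linarith
  qed
  have R0: "R t x \<ge> 0" if "t \<in> {l, l + \<delta>, l - \<delta>}" for t x
    using Rlo[OF that, of x] by (meson exp_ge_zero order_trans)
  have neg1: "\<phi> x \<le> 0" if "Sx x \<le> u" for x
  proof -
    have "R l x \<le> exp (l * Sx x + 1)" by (rule Rhi) simp
    also have "\<dots> \<le> exp ((2 + \<delta> * u) + ((l - \<delta>) * Sx x - 1))"
      using mult_left_mono[OF that, of \<delta>] d0 by (simp add: algebra_simps)
    also have "\<dots> = b2 * exp ((l - \<delta>) * Sx x - 1)" unfolding b2_def exp_add ..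
    also have "\<dots> \<le> b2 * R (l - \<delta>) x" by (intro mult_left_mono Rlo) (auto simp: b2_def)
    finally have "R l x \<le> b2 * R (l - \<delta>) x" .
    moreover have "0 \<le> b1 * R (l + \<delta>) x" using R0[of "l + \<delta>" x] by (simp add: b1_def)
    ultimately show ?thesis by (simp add: \<phi>_def)
  qed
  have neg2: "\<phi> x \<le> 0" if "Sx x \<ge> u'" for x
  proof -
    have "R l x \<le> exp (l * Sx x + 1)" by (rule Rhi) simp
    also have "\<dots> \<le> exp ((2 - \<delta> * u') + ((l + \<delta>) * Sx x - 1))"
      using mult_left_mono[OF that, of \<delta>] d0 by (simp add: algebra_simps)
    also have "\<dots> = b1 * exp ((l + \<delta>) * Sx x - 1)" unfolding b1_def exp_add ..
    also have "\<dots> \<le> b1 * R (l + \<delta>) x" by (intro mult_left_mono Rlo) (auto simp: b1_def)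
    finally have "R l x \<le> b1 * R (l + \<delta>) x" .
    moreover have "0 \<le> b2 * R (l - \<delta>) x" using R0[of "l - \<delta>" x] by (simp add: b2_def)
    ultimately show ?thesis by (simp add: \<phi>_def)
  qed
  have up: "al * \<phi> x \<le> 1" for x
  proof (cases "Sx x \<ge> u'")
    case True
    then have "al * \<phi> x \<le> 0" using neg2[OF True] by (simp add: al_def mult_nonneg_nonpos)
    then show ?thesis by simp
  next
    case False
    have "0 \<le> b1 * R (l + \<delta>) x" "0 \<le> b2 * R (l - \<delta>) x"
      using R0[of "l + \<delta>" x] R0[of "l - \<delta>" x] by (auto simp: b1_def b2_def)
    then have "\<phi> x \<le> R l x" by (simp add: \<phi>_def)
    also have "\<dots> \<le> exp (l * Sx x + 1)" by (rule Rhi) simp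
    also have "\<dots> \<le> exp (l * u' + 1)" using False l by simp
    finally have "al * \<phi> x \<le> al * exp (l * u' + 1)" by (intro mult_left_mono) (auto simp: al_def)
    also have "\<dots> = 1" by (simp add: al_def flip: exp_add)
    finally show ?thesis .
  qed
  define F where "F x = 1 - al * \<phi> x" for x
  \<comment> \<open>The constant 1 is the tilt with parameter 0, which puts \<open>F\<close> into
    the span of four tilts.\<close>
  have Fe: "F = (\<lambda>x. R 0 x + (- al) * R l x + (al * b1) * R (l + \<delta>) x + (al * b2) * R (l - \<delta>) x)"
    by (auto simp: F_def \<phi>_def R_def quadprod_def algebra_simps)
  have Rp: "polyf a (2 * d) A (R t)" for t
    unfolding R_def[abs_def] by (rule polyf_quadprod[OF p(1)])
  have Fp: "polyf a (2 * d) A F"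
    unfolding Fe by (intro polyf.add polyf.scale Rp)
  have Ri: "integrable U (R t)" for t
    using polyf_bounded[OF Rp fin, of t] integrable_U by (metis real_norm_def)
  have v0: "0 \<le> v" "v \<le> 1"
  proof -
    show "0 \<le> v" by (simp add: v)
    have [measurable]: "p \<in> borel_measurable borel" by (rule rtrig_measurable[OF p(1)])
    show "v \<le> 1" unfolding v by (rule integral_U_le_const) (use p(3) in \<open>auto simp: abs_square_le_1\<close>)
  qed
  have IR: "(\<integral>x. R t x \<partial>U) = (1 + t\<^sup>2 / 2 * v) ^ card A" for t
    unfolding R_def v by (rule integral_quadprod[OF fin p gap])
  have IRle: "(\<integral>x. R t x \<partial>U) \<le> exp (t\<^sup>2 * v * m / 2)" for t
  proof -
    have "(1 + t\<^sup>2 / 2 * v) ^ card A \<le> exp (t\<^sup>2 / 2 * v) ^ card A"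
      using v0 by (intro power_mono exp_ge_add_one_self) auto
    also have "\<dots> = exp (t\<^sup>2 * v * m / 2)" by (simp add: m exp_of_nat_mult[symmetric] mult_ac)
    finally show ?thesis unfolding IR .
  qed
  \<comment> \<open>Completing the square: moving the tilt by \<open>\<kappa> * l\<close> lowers the
    exponent from \<open>X\<close> to \<open>X * (1 - \<kappa>^2)\<close>.\<close>
  have I1: "b1 * (\<integral>x. R (l + \<delta>) x \<partial>U) \<le> exp 2 * exp (X * (1 - \<kappa>\<^sup>2))"
  proof -
    have "b1 * (\<integral>x. R (l + \<delta>) x \<partial>U) \<le> b1 * exp ((l + \<delta>)\<^sup>2 * v * m / 2)"
      by (intro mult_left_mono IRle) (simp add: b1_def)
    also have "\<dots> = exp 2 * exp (- \<delta> * u' + (l + \<delta>)\<^sup>2 * v * m / 2)"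
      by (simp add: b1_def exp_add[symmetric])
    also have "- \<delta> * u' + (l + \<delta>)\<^sup>2 * v * m / 2 = X * (1 - \<kappa>\<^sup>2)"
      unfolding X(1) \<delta>_def u'_def by (simp add: power2_eq_square field_simps)
    finally show ?thesis .
  qed
  have I2: "b2 * (\<integral>x. R (l - \<delta>) x \<partial>U) \<le> exp 2 * exp (X * (1 - \<kappa>\<^sup>2))"
  proof -
    have "b2 * (\<integral>x. R (l - \<delta>) x \<partial>U) \<le> b2 * exp ((l - \<delta>)\<^sup>2 * v * m / 2)"
      by (intro mult_left_mono IRle) (simp add: b2_def)
    also have "\<dots> = exp 2 * exp (\<delta> * u + (l - \<delta>)\<^sup>2 * v * m / 2)"
      by (simp add: b2_def exp_add[symmetric])
    also have "\<delta> * u + (l - \<delta>)\<^sup>2 * v * m / 2 = X * (1 - \<kappa>\<^sup>2)"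
      unfolding X(1) \<delta>_def u_def by (simp add: power2_eq_square field_simps)
    finally show ?thesis .
  qed
  have I0: "exp (X - 1) \<le> (\<integral>x. R l x \<partial>U)"
  proof -
    define z where "z = l\<^sup>2 / 2 * v"
    have l1: "l \<le> 1/2" using t3(2)[of l] l(1) by simp
    have ll: "l\<^sup>2 \<le> 1" using l1 l(1) by (simp add: power_le_one)
    have z: "0 \<le> z" "z \<le> 1"
    proof -
      show "0 \<le> z" using v0 by (simp add: z_def)
      have "z \<le> 1 / 2 * 1" unfolding z_def using v0 ll by (intro mult_mono) auto
      then show "z \<le> 1" by simp
    qed
    have "m * z\<^sup>2 \<le> m * \<bar>l\<bar>^3"
    proof (rule mult_left_mono[OF _ m0])
      have "z \<le> l\<^sup>2" unfolding z_def using v0 mult_mono[of "l\<^sup>2 / 2" "l\<^sup>2" v 1] by simp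
      then have "z\<^sup>2 \<le> (l\<^sup>2)\<^sup>2" using z by (intro power_mono) auto
      also have "\<dots> = l ^ 3 * l" by (simp add: power3_eq_cube power2_eq_square)
      also have "\<dots> \<le> l ^ 3 * 1" using l1 l(1) by (intro mult_left_mono) auto
      finally show "z\<^sup>2 \<le> \<bar>l\<bar>^3" using l(1) by simp
    qed
    then have mz: "m * z\<^sup>2 \<le> 1" using t3(1)[of l] by simp
    have Xz: "X = m * z" by (simp add: X(1) z_def)
    have "exp (X - 1) \<le> exp (m * (z - z\<^sup>2))" using mz by (simp add: Xz right_diff_distrib)
    also have "\<dots> \<le> (1 + z) ^ card A" unfolding m by (rule power_one_plus_ge[OF z])
    finally show ?thesis by (simp add: IR z_def)
  qed
  have I\<phi>: "(\<integral>x. \<phi> x \<partial>U) = (\<integral>x. R l x \<partial>U) - b1 * (\<integral>x. R (l + \<delta>) x \<partial>U) - b2 * (\<integral>x. R (l - \<delta>) x \<partial>U)"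
    unfolding \<phi>_def using Ri by simp
  \<comment> \<open>Each of the two corrections uses at most a quarter of the main term
    \<open>exp (X - 1)\<close>, so half of it remains.\<close>
  have "exp 2 * exp (X * (1 - \<kappa>\<^sup>2)) * 4 * exp 1 \<le> exp X"
  proof -
    have "exp 2 * exp (X * (1 - \<kappa>\<^sup>2)) * 4 * exp 1 = 4 * exp 3 * exp (X * (1 - \<kappa>\<^sup>2))"
      by (simp add: mult_ac flip: exp_add)
    also have "\<dots> \<le> exp (\<kappa>\<^sup>2 * X) * exp (X * (1 - \<kappa>\<^sup>2))" by (intro mult_right_mono X(2)) simp
    also have "\<dots> = exp X" by (simp add: algebra_simps flip: exp_add)
    finally show ?thesis .
  qed
  then have "exp 2 * exp (X * (1 - \<kappa>\<^sup>2)) * 4 \<le> exp (X - 1)" by (simp add: exp_diff field_simps)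
  then have "exp (X - 1) / 2 \<le> (\<integral>x. \<phi> x \<partial>U)" using I0 I1 I2 unfolding I\<phi> by linarith
  then have "al * (exp (X - 1) / 2) \<le> al * (\<integral>x. \<phi> x \<partial>U)" by (intro mult_left_mono) (auto simp: al_def)
  moreover have "al * (exp (X - 1) / 2) = exp (- 2) / 2 * exp (- X * (1 + 2 * \<kappa>))"
  proof -
    have "- l * u' - 1 + (X - 1) = - 2 + - X * (1 + 2 * \<kappa>)"
      unfolding X(1) u'_def by (simp add: power2_eq_square field_simps)
    then show ?thesis unfolding al_def by (simp add: exp_add[symmetric])
  qed
  moreover have "(\<integral>x. F x \<partial>U) = 1 - al * (\<integral>x. \<phi> x \<partial>U)"
    unfolding F_def \<phi>_def using Ri U.prob_space by simp
  ultimately have "(\<integral>x. F x \<partial>U) \<le> 1 - exp (- 2) / 2 * exp (- X * (1 + 2 * \<kappa>))" by simp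
  moreover have "F x \<ge> 0" for x using up[of x] by (simp add: F_def)
  moreover have "F x \<ge> 1" if "(\<Sum>k\<in>A. p (real (a k) * x)) \<le> (1 - \<kappa>) * l * v * m" for x
    using neg1[of x] that by (simp add: F_def Sx_def u_def al_def mult_nonneg_nonpos)
  ultimately show ?thesis using that Fp by blast
qed

section \<open>Large sums over geometric blocks\<close>

context permuted_lacunary
begin

text \<open>A substitute for the second Borel-Cantelli lemma. Where the blocks from \<open>J\<close>
  on all stay below their thresholds, every majorant is at least 1. The measure of this set is
  therefore at most a product of integrals, which the divergence of the harmonic series drives to
  0.\<close>

lemma blocks_frequently_large:
  assumes p: "rtrig d p" "(\<integral>x. p x \<partial>U) = 0" "\<And>x. \<bar>p x\<bar> \<le> 1"
    and k0: "gap_from (2 * d + 2) k0" and v: "v = (\<integral>x. (p x)\<^sup>2 \<partial>U)" "v > 0"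
    and kap: "0 < \<kappa>" "\<kappa> \<le> 1/2" and Q: "Q \<ge> (2::nat)"
  defines "B \<equiv> \<lambda>j. {Q ^ j<..Q ^ (j + 1)} \<inter> late k0"
  defines "u \<equiv> \<lambda>j. (1 - \<kappa>) * sqrt (2 * (ln (real j) / (1 + 2 * \<kappa>)) * v * real (card (B j)))"
  shows "AE x in U. frequently (\<lambda>j. psum p (B j) x > u j) sequentially"
proof -
  \<comment> \<open>The divisor \<open>1 + 2 * \<kappa>\<close> cancels the loss in
    \<open>indicator_majorant\<close>, so the \<open>j\<close>-th integral is at most
    \<open>1 - exp (- 2) / 2 / j\<close>.\<close>
  define X where "X j = ln (real j) / (1 + 2 * \<kappa>)" for j :: nat
  define m where "m j = real (card (B j))" for j
  \<comment> \<open>Chosen so that \<open>X = l^2 * v * m / 2\<close>; then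
    \<open>l * v * m = sqrt (2 * X * v * m)\<close>, the threshold \<open>u\<close> before the
    factor \<open>1 - \<kappa>\<close>.\<close>
  define l where "l j = sqrt (2 * X j / (v * m j))" for j
  have finB: "finite (B j)" for j by (simp add: B_def)
  have B1: "B j \<subseteq> {1..}" "B j \<subseteq> late k0" for j by (auto simp: B_def late_def)
  have mlow: "2 ^ j / 2 \<le> m j" if "2 * k0 \<le> 2 ^ j" for j
  proof -
    have "Q ^ (j + 1) - Q ^ j \<le> card (B j) + k0"
      using card_late[of "{Q ^ j<..Q ^ (j + 1)}" k0] by (simp add: B_def subset_eq)
    moreover have "2 * Q ^ j \<le> Q ^ (j + 1)" using Q by simp
    moreover have "(2::nat) ^ j \<le> Q ^ j" using Q by (intro power_mono) auto
    ultimately have "2 ^ j \<le> 2 * card (B j)" using that by linarith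
    then have "real (2 ^ j) \<le> real (2 * card (B j))" by (rule of_nat_mono)
    then show ?thesis by (simp add: m_def)
  qed
  have ev: "eventually (\<lambda>j::nat. real (2 * k0) \<le> 2 ^ j \<and> 
      sqrt (4 * (ln (real j) / (1 + 2 * \<kappa>)) / (v * 2 ^ j)) * (1 + \<kappa>) \<le> 1/2 \<and>
      2 * (ln (real j) / (1 + 2 * \<kappa>)) / v * (1 + \<kappa>) ^ 3 * sqrt (4 * (ln (real j) / (1 + 2 * \<kappa>)) / (v * 2 ^ j)) \<le> 1 \<and>
      4 * exp 3 \<le> exp (\<kappa>\<^sup>2 * (ln (real j) / (1 + 2 * \<kappa>)))) sequentially"
    by (intro eventually_conj; use kap v(2) in real_asymp)
  then obtain J0 where J0: "J0 \<ge> 2" "\<And>j. j \<ge> J0 \<Longrightarrow> real (2 * k0) \<le> 2 ^ j \<and> 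
      sqrt (4 * X j / (v * 2 ^ j)) * (1 + \<kappa>) \<le> 1/2 \<and>
      2 * X j / v * (1 + \<kappa>) ^ 3 * sqrt (4 * X j / (v * 2 ^ j)) \<le> 1 \<and>
      4 * exp 3 \<le> exp (\<kappa>\<^sup>2 * X j)"
  proof -
    from ev obtain J1 where "\<forall>j\<ge>J1. real (2 * k0) \<le> 2 ^ j \<and> 
      sqrt (4 * X j / (v * 2 ^ j)) * (1 + \<kappa>) \<le> 1/2 \<and>
      2 * X j / v * (1 + \<kappa>) ^ 3 * sqrt (4 * X j / (v * 2 ^ j)) \<le> 1 \<and>
      4 * exp 3 \<le> exp (\<kappa>\<^sup>2 * X j)"
      unfolding eventually_sequentially X_def by blast
    then show ?thesis by (intro that[of "max 2 J1"]) auto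
  qed
  define G where "G = {k. k \<ge> k0}"
  have gap: "(2 * d + 1) * a k < a k'" if "k \<in> G" "k' \<in> G" "k < k'" for k k'
    using that k0 by (intro gap_from_less) (auto simp: G_def)
  have aposG: "a k > 0" if "k \<in> G" for k using that k0 by (auto simp: G_def intro: gap_from_pos)
  have AG: "\<sigma> ` B j \<subseteq> G" for j using B1(2) by (auto simp: late_def G_def)
  have ps: "psum p (B j) x = (\<Sum>k\<in>\<sigma> ` B j. p (real (a k) * x))" for j x by (rule psum_image[OF B1(1)])
  have cA: "m j = real (card (\<sigma> ` B j))" for j using card_image[OF inj_sigma[OF B1(1)]] by (simp add: m_def)
  have "\<exists>F. polyf a (2 * d) (\<sigma> ` B j) F \<and> (\<forall>x. F x \<ge> 0) \<and> (\<forall>x. psum p (B j) x \<le> u j \<longrightarrow> F x \<ge> 1) \<and>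
      (\<integral>x. F x \<partial>U) \<le> 1 - exp (- 2) / 2 / real j" if j: "j \<ge> J0" for j
  proof -
    note c = J0(2)[OF j]
    have j2: "j \<ge> 2" using j J0(1) by linarith
    have X0: "X j > 0" using j2 kap by (simp add: X_def)
    have "real (2 * k0) \<le> real (2 ^ j)" using c by simp
    then have "2 * k0 \<le> 2 ^ j" by (simp only: of_nat_le_iff)
    then have ml: "2 ^ j / 2 \<le> m j" by (rule mlow)
    have m0: "m j > 0" using ml by (meson half_gt_zero less_le_trans zero_less_numeral zero_less_power)
    have l0: "l j > 0" using X0 v(2) m0 by (simp add: l_def)
    have l2: "(l j)\<^sup>2 = 2 * X j / (v * m j)" using X0 v(2) m0 by (simp add: l_def)
    have lle: "l j \<le> sqrt (4 * X j / (v * 2 ^ j))"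
    proof -
      have "2 * X j / (v * m j) \<le> 2 * X j / (v * (2 ^ j / 2))"
        using X0 v(2) m0 ml by (intro divide_left_mono mult_left_mono mult_pos_pos) auto
      then show ?thesis unfolding l_def by (intro real_sqrt_le_mono) simp
    qed
    have a1: "l j * (1 + \<kappa>) \<le> 1/2"
    proof -
      have "l j * (1 + \<kappa>) \<le> sqrt (4 * X j / (v * 2 ^ j)) * (1 + \<kappa>)" using lle kap by (intro mult_right_mono) auto
      then show ?thesis using c by linarith
    qed
    have a2: "m j * (l j * (1 + \<kappa>)) ^ 3 \<le> 1"
    proof -
      have "m j * (l j * (1 + \<kappa>)) ^ 3 = m j * (l j)\<^sup>2 * (1 + \<kappa>) ^ 3 * l j"
        by (simp add: power_mult_distrib power3_eq_cube power2_eq_square)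
      also have "m j * (l j)\<^sup>2 = 2 * X j / v" unfolding l2 using m0 by simp
      also have "2 * X j / v * (1 + \<kappa>) ^ 3 * l j \<le> 2 * X j / v * (1 + \<kappa>) ^ 3 * sqrt (4 * X j / (v * 2 ^ j))"
        using X0 v(2) kap by (intro mult_left_mono lle) auto
      finally show ?thesis using c by linarith
    qed
    have Xe: "X j = (l j)\<^sup>2 * v * m j / 2" unfolding l2 using m0 v(2) by simp
    have ue: "(1 - \<kappa>) * l j * v * m j = u j"
    proof -
      have "sqrt (2 * X j * v * m j) = sqrt ((l j * (v * m j))\<^sup>2)"
        unfolding power_mult_distrib l2 using m0 v(2) by (simp add: power2_eq_square)
      also have "\<dots> = l j * (v * m j)" using l0 m0 v(2) by simp
      finally show ?thesis by (simp add: u_def X_def m_def)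
    qed
    have ex: "exp (- X j * (1 + 2 * \<kappa>)) = 1 / real j"
    proof -
      have "X j * (1 + 2 * \<kappa>) = ln (real j)" using kap by (simp add: X_def)
      then show ?thesis using j2 by (simp add: exp_minus inverse_eq_divide)
    qed
    obtain F where F: "polyf a (2 * d) (\<sigma> ` B j) F" "\<And>x. F x \<ge> 0"
      "\<And>x. (\<Sum>k\<in>\<sigma> ` B j. p (real (a k) * x)) \<le> (1 - \<kappa>) * l j * v * m j \<Longrightarrow> F x \<ge> 1"
      "(\<integral>x. F x \<partial>U) \<le> 1 - exp (- 2) / 2 * exp (- X j * (1 + 2 * \<kappa>))"
    proof (rule indicator_majorant[OF _ p _ _ v(1) cA kap l0 a1 a2 Xe])
      show "finite (\<sigma> ` B j)" using finB by simp
      show "(2 * d + 1) * a k < a k'" if "k \<in> \<sigma> ` B j" "k' \<in> \<sigma> ` B j" "k < k'" for k k'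
        using that AG gap by blast
      show "a k > 0" if "k \<in> \<sigma> ` B j" for k using that AG aposG by blast
      show "4 * exp 3 \<le> exp (\<kappa>\<^sup>2 * X j)" using c by blast
    qed blast
    have F3: "F x \<ge> 1" if "psum p (B j) x \<le> u j" for x
      using F(3)[of x] that unfolding ue ps by blast
    have F4: "(\<integral>x. F x \<partial>U) \<le> 1 - exp (- 2) / 2 / real j" using F(4) unfolding ex by simp
    show ?thesis using F(1,2) F3 F4 by blast
  qed
  then obtain F where F: "\<And>j. j \<ge> J0 \<Longrightarrow> polyf a (2 * d) (\<sigma> ` B j) (F j)" "\<And>j x. j \<ge> J0 \<Longrightarrow> F j x \<ge> 0"
    "\<And>j x. j \<ge> J0 \<Longrightarrow> psum p (B j) x \<le> u j \<Longrightarrow> F j x \<ge> 1"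
    "\<And>j. j \<ge> J0 \<Longrightarrow> (\<integral>x. F j x \<partial>U) \<le> 1 - exp (- 2) / 2 / real j" by metis
  have dis: "disjoint_family_on (\<lambda>j. \<sigma> ` B j) J" for J
  proof -
    have "B i \<inter> B j = {}" if "i < j" for i j
    proof -
      have "Q ^ (i + 1) \<le> Q ^ j" using that Q by (intro power_increasing) auto
      then show ?thesis by (auto simp: B_def)
    qed
    then have "B i \<inter> B j = {}" if "i \<noteq> j" for i j using that by (metis inf_commute linorder_neqE_nat)
    moreover have "\<sigma> ` B i \<inter> \<sigma> ` B j = \<sigma> ` (B i \<inter> B j)" for i j
      using inj_on_image_Int[OF inj_sigma[OF order_refl] B1(1) B1(1)] by simp
    ultimately show ?thesis by (simp add: disjoint_family_on_def)
  qed
  note [measurable] = rtrig_measurable[OF p(1)]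
  have null: "AE x in U. \<exists>j\<ge>J. psum p (B j) x > u j" if J: "J \<ge> J0" for J
  proof -
    define N where "N = {x. \<forall>j\<ge>J. psum p (B j) x \<le> u j}"
    have Nm: "N \<in> sets borel" unfolding N_def by measurable
    have J1: "J \<ge> 1" using J J0(1) by linarith
    have bnd: "measure U N \<le> exp (- (exp (- 2) / 2) * (harm n - harm (J - 1)))" if n: "n \<ge> J" for n
    proof -
      have Fb: "F j \<in> borel_measurable borel" "\<exists>c. \<forall>x. \<bar>F j x\<bar> \<le> c" if "j \<in> {J..n}" for j
        using polyf_bounded[OF F(1)] that J finB by auto
      have Pm: "(\<lambda>x. \<Prod>j\<in>{J..n}. F j x) \<in> borel_measurable borel" "\<exists>c. \<forall>x. \<bar>\<Prod>j\<in>{J..n}. F j x\<bar> \<le> c"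
        by (rule bounded_prod[of "{J..n}" F], simp, erule Fb, erule Fb)+
      have Pi: "integrable U (\<lambda>x. \<Prod>j\<in>{J..n}. F j x)"
        using Pm integrable_U by (metis (no_types, lifting) real_norm_def)
      have "measure U N = (\<integral>x. indicator N x \<partial>U)" using Nm by simp
      also have "\<dots> \<le> (\<integral>x. (\<Prod>j\<in>{J..n}. F j x) \<partial>U)"
      proof (rule integral_mono[OF _ Pi])
        show "integrable U (indicator N :: real \<Rightarrow> real)"
          by (rule integrable_U[where c=1]) (use Nm in \<open>auto simp: indicator_def\<close>)
        show "indicator N x \<le> (\<Prod>j\<in>{J..n}. F j x)" for x
        proof (cases "x \<in> N")
          case True
          then have "F j x \<ge> 1" if "j \<in> {J..n}" for j using that J F(3)[of j x] by (auto simp: N_def)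
          then have "1 \<le> (\<Prod>j\<in>{J..n}. F j x)" by (rule prod_ge_1)
          then show ?thesis using True by simp
        next
          case False
          then show ?thesis using F(2) J by (auto intro!: prod_nonneg)
        qed
      qed
      also have "\<dots> = (\<Prod>j\<in>{J..n}. \<integral>x. F j x \<partial>U)"
      proof (rule integral_prod_polyf[where A="\<lambda>j. \<sigma> ` B j" and d="2 * d" and a=a and G=G])
        show "polyf a (2 * d) (\<sigma> ` B j) (F j)" if "j \<in> {J..n}" for j using F(1) that J by auto
        show "(2 * d + 1) * a k < a k'" if "k \<in> G" "k' \<in> G" "k < k'" for k k' by (rule gap[OF that])
      qed (use finB dis AG aposG in auto)
      also have "\<dots> \<le> (\<Prod>j\<in>{J..n}. exp (- (exp (- 2) / 2) / real j))"
      proof (intro prod_mono conjI)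
        fix j assume "j \<in> {J..n}"
        then have j: "j \<ge> J0" using J by auto
        show "0 \<le> (\<integral>x. F j x \<partial>U)" using F(2)[OF j] by (intro integral_nonneg_AE) auto
        have "(\<integral>x. F j x \<partial>U) \<le> 1 + (- (exp (- 2) / 2) / real j)" using F(4)[OF j] by simp
        also have "\<dots> \<le> exp (- (exp (- 2) / 2) / real j)" by (rule exp_ge_add_one_self)
        finally show "(\<integral>x. F j x \<partial>U) \<le> exp (- (exp (- 2) / 2) / real j)" .
      qed
      also have "\<dots> = exp (\<Sum>j\<in>{J..n}. - (exp (- 2) / 2) / real j)" by (simp add: exp_sum)
      also have "(\<Sum>j\<in>{J..n}. - (exp (- 2) / 2) / real j) = - (exp (- 2) / 2) * (\<Sum>j\<in>{J..n}. 1 / real j)"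
        by (simp add: sum_distrib_left)
      also have "(\<Sum>j\<in>{J..n}. 1 / real j) = harm n - harm (J - 1)"
      proof -
        have "{1..n} = {1..J - 1} \<union> {J..n}" using n J1 by auto
        then have "harm n = harm (J - 1) + (\<Sum>j\<in>{J..n}. inverse (real j))"
          unfolding harm_def by (simp only:) (rule sum.union_disjoint, auto)
        then show ?thesis by (simp add: inverse_eq_divide)
      qed
      finally show ?thesis .
    qed
    have lim: "(\<lambda>n. exp (- (exp (- 2) / 2) * (harm n - harm (J - 1)))) \<longlonglongrightarrow> (0::real)"
    proof (rule filterlim_compose[OF exp_at_bot])
      have "filterlim (\<lambda>n. harm n - harm (J - 1) :: real) at_top sequentially"
        using filterlim_tendsto_add_at_top[OF tendsto_const[of "- harm (J - 1)"] harm_at_top] by simp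
      then show "filterlim (\<lambda>n. - (exp (- 2) / 2) * (harm n - harm (J - 1)) :: real) at_bot sequentially"
        by (intro filterlim_tendsto_neg_mult_at_bot[OF tendsto_const]) auto
    qed
    have "measure U N \<le> 0"
      by (rule LIMSEQ_le_const[OF lim]) (use bnd in auto)
    then have "emeasure U N = 0" using measure_nonneg[of U N] by (simp add: U.emeasure_eq_measure)
    then have "N \<in> null_sets U" using Nm by (auto simp: null_sets_def)
    then have "AE x in U. x \<notin> N" by (rule AE_not_in)
    then show ?thesis by (rule AE_mp) (auto simp: N_def not_le)
  qed
  have "AE x in U. \<forall>J. \<exists>j\<ge>max J J0. psum p (B j) x > u j"
    by (subst AE_all_countable) (intro allI null max.cobounded2)
  then show ?thesis
  proof eventually_elim
    case (elim x)
    from elim show ?case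
      unfolding frequently_sequentially by (metis max.bounded_iff)
  qed
qed

lemma frequently_subseq:
  assumes "filterlim g at_top sequentially" "frequently (\<lambda>j. P (g j)) sequentially"
  shows "frequently P sequentially"
  using assms eventually_compose_filterlim[of "\<lambda>x. \<not> P x" sequentially g sequentially] unfolding frequently_def by blast

text \<open>A large last block makes the whole sum large only if the earlier part cannot cancel it.
  By the upper half the earlier part is at most of order \<open>1 / sqrt Q\<close> on the new scale,
  and a large ratio \<open>Q\<close> also makes the block nearly the whole range.\<close>

lemma lil_lower_trig:
  assumes bv: "bvc V p" "V \<ge> 1" and p: "rtrig d p"
  shows "lil_lower p (sqrt (\<integral>x. (p x)\<^sup>2 \<partial>U))"
  unfolding lil_lower_def
proof (intro allI impI)
  fix \<epsilon> :: real assume eps: "\<epsilon> > 0"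
  define v where "v = (\<integral>x. (p x)\<^sup>2 \<partial>U)"
  have v0: "v \<ge> 0" by (simp add: v_def)
  note h = bvcD[OF bv(1)]
  have up: "lil_upper p (sqrt v)" unfolding v_def by (rule lil_upper_trig[OF bv p])
  show "AE x in U. frequently (\<lambda>N. S p N x \<ge> (sqrt (\<integral>x. (p x)\<^sup>2 \<partial>U) - \<epsilon>) * psi N) sequentially"
  proof (cases "v = 0")
    case True
    \<comment> \<open>With zero variance the upper half already contains the claim.\<close>
    have "AE x in U. eventually (\<lambda>N. \<bar>S p N x\<bar> \<le> (sqrt v + \<epsilon>) * psi N) sequentially"
      using up eps by (simp add: lil_upper_def)
    then show ?thesis
    proof eventually_elim
      case (elim x)
      then have "eventually (\<lambda>N. S p N x \<ge> (sqrt v - \<epsilon>) * psi N) sequentially"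
        by eventually_elim (simp add: True abs_le_iff)
      then show ?case
        unfolding v_def by (rule eventually_frequently[OF sequentially_bot])
    qed
  next
    case False
    then have vp: "v > 0" using v0 by simp
    define s where "s = sqrt v"
    have sp: "s > 0" using vp by (simp add: s_def)
    obtain k0 where k0: "gap_from (2 * d + 2) k0" using gap_from_exists[of "2 * d + 2"] by auto
    \<comment> \<open>The losses with \<open>\<kappa> = 1 / Q\<close>: outside the root the factor
      of the threshold \<open>u\<close>; under it the passage from \<open>ln j\<close> to the
      iterated logarithm, the divisor of \<open>X\<close>, and the share of the block in
      \<open>Q ^ (j + 1)\<close>.\<close>
    define \<theta> where "\<theta> Q = (1 - 1 / real Q) * s * sqrt ((1 - 1 / real Q) / (1 + 2 / real Q) * (1 - 2 / real Q))" for Q :: nat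
    have "eventually (\<lambda>Q. s - \<epsilon> / 2 \<le> \<theta> Q - (s + 1) / sqrt (real Q)) sequentially"
      unfolding \<theta>_def using sp eps by real_asymp
    then have "eventually (\<lambda>Q. Q \<ge> 3 \<and> s - \<epsilon> / 2 \<le> \<theta> Q - (s + 1) / sqrt (real Q)) sequentially"
      using eventually_ge_at_top[of 3] by eventually_elim auto
    then obtain Q where Q: "Q \<ge> 3" "s - \<epsilon> / 2 \<le> \<theta> Q - (s + 1) / sqrt (real Q)"
      using eventually_happens' sequentially_bot by blast
    define \<kappa> where "\<kappa> = 1 / real Q"
    have kap: "0 < \<kappa>" "\<kappa> \<le> 1/2" using Q by (auto simp: \<kappa>_def field_simps)
    define B where "B j = {Q ^ j<..Q ^ (j + 1)} \<inter> late k0" for j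
    define u where "u j = (1 - \<kappa>) * sqrt (2 * (ln (real j) / (1 + 2 * \<kappa>)) * v * real (card (B j)))" for j
    have lnQ: "ln (real Q) > 1"
    proof -
      have "exp 1 < real Q" using Q(1) e_less_272 by linarith
      then show ?thesis using Q(1) by (subst exp_less_cancel_iff[symmetric]) simp
    qed
    have Qlim: "filterlim (\<lambda>j. Q ^ j) at_top sequentially"
      using Q(1) by (intro filterlim_subseq strict_monoI power_strict_increasing) auto
    have Qlim1: "filterlim (\<lambda>j. Q ^ (j + 1)) at_top sequentially"
      using filterlim_compose[OF Qlim filterlim_Suc] by simp
    have fr: "AE x in U. frequently (\<lambda>j. psum p (B j) x > u j) sequentially"
      unfolding B_def u_def using Q(1)
      by (intro blocks_frequently_large[OF p h(4) h(3) k0 v_def vp kap]) auto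
    have "eventually (\<lambda>j::nat. (1 - \<kappa>) * ln ((real j + 1) * ln (real Q)) \<le> ln (real j)) sequentially"
      using kap lnQ by real_asymp
    then have evu: "eventually (\<lambda>j. \<theta> Q * psi (Q ^ (j + 1)) \<le> u j) sequentially"
      using eventually_compose_filterlim[OF eventually_ge_at_top[of k0] Qlim] eventually_ge_at_top[of 1]
    proof eventually_elim
      case (elim j)
      define N where "N = real (Q ^ (j + 1))"
      have lnN: "ln N = (real j + 1) * ln (real Q)" using Q(1) by (simp add: N_def ln_realpow ln_mult field_simps)
      have lnN1: "ln N \<ge> 1"
      proof -
        have "1 * 1 \<le> (real j + 1) * ln (real Q)" using lnQ by (intro mult_mono) auto
        then show ?thesis by (simp add: lnN)
      qed
      \<comment> \<open>One share \<open>\<kappa> * N\<close> is the initial segment up to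
        \<open>Q ^ j\<close>; the other dominates \<open>k0\<close>.\<close>
      have cB: "(1 - 2 * \<kappa>) * N \<le> real (card (B j))"
      proof -
        have "Q ^ (j + 1) \<le> card (B j) + 2 * Q ^ j"
          using card_late[of "{Q ^ j<..Q ^ (j + 1)}" k0] elim(2) by (simp add: B_def subset_eq)
        then have "N \<le> real (card (B j) + 2 * Q ^ j)" unfolding N_def by (rule of_nat_mono)
        moreover have "real (Q ^ j) = \<kappa> * N" using Q(1) by (simp add: N_def \<kappa>_def)
        ultimately show ?thesis by (simp add: algebra_simps)
      qed
      have k12: "0 \<le> 1 - 2 * \<kappa>" "0 \<le> 1 - \<kappa>" "0 < 1 + 2 * \<kappa>" using kap by auto
      have LL0: "ln (ln N) \<ge> 0" using lnN1 by simp
      have "(1 - \<kappa>) / (1 + 2 * \<kappa>) * (1 - 2 * \<kappa>) * (2 * N * ln (ln N)) * v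
          = 2 * ((1 - \<kappa>) * ln (ln N) / (1 + 2 * \<kappa>)) * v * ((1 - 2 * \<kappa>) * N)"
        by (simp add: field_simps)
      also have "\<dots> \<le> 2 * (ln (real j) / (1 + 2 * \<kappa>)) * v * real (card (B j))"
        using elim(1,3) cB k12 vp LL0 unfolding lnN
        by (intro mult_mono mult_nonneg_nonneg divide_right_mono divide_nonneg_pos) (auto simp: N_def)
      finally have "sqrt ((1 - \<kappa>) / (1 + 2 * \<kappa>) * (1 - 2 * \<kappa>) * (2 * N * ln (ln N)) * v)
          \<le> sqrt (2 * (ln (real j) / (1 + 2 * \<kappa>)) * v * real (card (B j)))" by (rule real_sqrt_le_mono)
      then have "(1 - \<kappa>) * sqrt ((1 - \<kappa>) / (1 + 2 * \<kappa>) * (1 - 2 * \<kappa>) * (2 * N * ln (ln N)) * v) \<le> u j"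
        unfolding u_def using k12 by (intro mult_left_mono) auto
      also have "(1 - \<kappa>) * sqrt ((1 - \<kappa>) / (1 + 2 * \<kappa>) * (1 - 2 * \<kappa>) * (2 * N * ln (ln N)) * v)
          = (1 - \<kappa>) * (sqrt ((1 - \<kappa>) / (1 + 2 * \<kappa>) * (1 - 2 * \<kappa>)) * sqrt (2 * N * ln (ln N)) * s)"
        unfolding real_sqrt_mult s_def ..
      also have "\<dots> = \<theta> Q * psi (Q ^ (j + 1))"
        unfolding \<theta>_def psi_def \<kappa>_def N_def by (simp add: mult_ac)
      finally show ?case .
    qed
    have evp: "eventually (\<lambda>j. psi (Q ^ j) \<le> psi (Q ^ (j + 1)) / sqrt (real Q)) sequentially"
      using eventually_ge_at_top[of 1]
    proof eventually_elim
      case (elim j)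
      have l1: "ln (real (Q ^ i)) = real i * ln (real Q)" for i using Q(1) by (simp add: ln_realpow)
      have "1 * 1 \<le> real j * ln (real Q)" using elim lnQ by (intro mult_mono) auto
      then have "1 \<le> ln (real (Q ^ j))" unfolding l1 by simp
      moreover have "ln (real (Q ^ j)) \<le> ln (real (Q ^ (j + 1)))"
        unfolding l1 using lnQ by (intro mult_right_mono) auto
      ultimately have "ln (ln (real (Q ^ j))) \<le> ln (ln (real (Q ^ (j + 1))))" by (subst ln_le_cancel_iff) linarith+
      then have "sqrt (2 * real (Q ^ j) * ln (ln (real (Q ^ j)))) \<le> sqrt (2 * real (Q ^ j) * ln (ln (real (Q ^ (j + 1)))))"
        by (intro real_sqrt_le_mono mult_left_mono) auto
      also have "2 * real (Q ^ j) * ln (ln (real (Q ^ (j + 1)))) = 2 * real (Q ^ (j + 1)) * ln (ln (real (Q ^ (j + 1)))) / real Q"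
        using Q(1) by simp
      finally show ?case by (simp only: psi_def real_sqrt_divide)
    qed
    have AEu: "AE x in U. eventually (\<lambda>N. \<bar>S p N x\<bar> \<le> (s + 1) * psi N) sequentially"
      using up unfolding lil_upper_def s_def by (auto dest: spec[of _ 1])
    show ?thesis
      using AEu fr
    proof eventually_elim
      case (elim x)
      note x = elim
      have eps2: "\<epsilon> / 2 > 0" using eps by simp
      have "frequently (\<lambda>j. S p (Q ^ (j + 1)) x \<ge> (s - \<epsilon>) * psi (Q ^ (j + 1))) sequentially"
        using x(2)
      proof (rule frequently_rev_mp)
        show "eventually (\<lambda>j. psum p (B j) x > u j \<longrightarrow> S p (Q ^ (j + 1)) x \<ge> (s - \<epsilon>) * psi (Q ^ (j + 1))) sequentially"
          using eventually_compose_filterlim[OF x(1) Qlim] evu evp eventually_compose_filterlim[OF psi_pos Qlim1]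
            eventually_compose_filterlim[OF sqrt_le_psi[OF eps2, of 0 "real k0"] Qlim1]
        proof eventually_elim
          case (elim j)
          show ?case
          proof
            assume big: "psum p (B j) x > u j"
            have "S p (Q ^ (j + 1)) x = S p (Q ^ j) x + psum p {Q ^ j<..Q ^ (j + 1)} x"
              using Q(1) by (intro psum_split power_increasing) auto
            moreover have "\<bar>psum p {Q ^ j<..Q ^ (j + 1)} x - psum p (B j) x\<bar> \<le> 1 * real k0"
              unfolding B_def by (rule psum_late[OF h(3)]) auto
            moreover have "(s + 1) * psi (Q ^ j) \<le> (s + 1) * (psi (Q ^ (j + 1)) / sqrt (real Q))"
              using elim(3) sp by (intro mult_left_mono) auto
            ultimately have "S p (Q ^ (j + 1)) x \<ge> \<theta> Q * psi (Q ^ (j + 1)) - (s + 1) * (psi (Q ^ (j + 1)) / sqrt (real Q)) - \<epsilon> / 2 * psi (Q ^ (j + 1))"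
              using elim(1,2,5) big by (simp add: abs_le_iff)
            also have "\<theta> Q * psi (Q ^ (j + 1)) - (s + 1) * (psi (Q ^ (j + 1)) / sqrt (real Q)) - \<epsilon> / 2 * psi (Q ^ (j + 1))
               = ((\<theta> Q - (s + 1) / sqrt (real Q)) - \<epsilon> / 2) * psi (Q ^ (j + 1))" by (simp add: algebra_simps)
            also have "\<dots> \<ge> (s - \<epsilon>) * psi (Q ^ (j + 1))"
              using Q(2) elim(4) by (intro mult_right_mono) auto
            finally show "S p (Q ^ (j + 1)) x \<ge> (s - \<epsilon>) * psi (Q ^ (j + 1))" .
          qed
        qed
      qed
      then show ?case
        unfolding v_def[symmetric] s_def[symmetric] by (rule frequently_subseq[OF Qlim1])
    qed
  qed
qed

end

subsection \<open>Functions of bounded variation\<close>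

text \<open>Turns a linear modulus into the sine form demanded by \<open>bvc\<close>. On
  \<open>[0, pi / 4]\<close> sine lies above the line of slope \<open>cos (pi / 4)\<close>; the
  double angle formula uses the same bound for the cosine.\<close>

lemma sin_ge_self_quarter:
  assumes "0 \<le> t" "t \<le> 1/2" shows "t \<le> sin (pi * t)"
proof -
  define y where "y = pi * t / 2"
  have y: "0 \<le> y" "y \<le> pi / 4" using assms by (auto simp: y_def field_simps)
  have c: "cos (pi / 4) \<le> cos z" if "0 \<le> z" "z \<le> pi / 4" for z
    using that by (intro cos_monotone_0_pi_le) auto
  have "sin 0 - 0 * cos (pi / 4) \<le> sin y - y * cos (pi / 4)"
  proof (rule DERIV_nonneg_imp_nondecreasing[OF y(1)])
    fix z assume "0 \<le> z" "z \<le> y"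
    then show "\<exists>D. ((\<lambda>z. sin z - z * cos (pi / 4)) has_real_derivative D) (at z) \<and> 0 \<le> D"
      using c[of z] y(2) by (intro exI[of _ "cos z - cos (pi / 4)"]) (auto intro!: derivative_eq_intros)
  qed
  then have 1: "y * cos (pi / 4) \<le> sin y" by simp
  have "t \<le> pi * t / 2" using assms pi_ge_two mult_right_mono[of 2 pi t] by simp
  also have "\<dots> = 2 * (y * cos (pi / 4) * cos (pi / 4))" by (simp add: y_def cos_45)
  also have "\<dots> \<le> 2 * (sin y * cos y)"
  proof -
    have "y * cos (pi / 4) * cos (pi / 4) \<le> sin y * cos y"
      using 1 c[OF y] y by (intro mult_mono order_trans[OF _ 1]) (auto simp: cos_45)
    then show ?thesis by simp
  qed
  also have "\<dots> = sin (pi * t)" using sin_double[of y] by (simp add: y_def)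
  finally show ?thesis .
qed

lemma frac_measurable_U: "frac \<in> borel_measurable (borel :: real measure)"
  unfolding frac_def[abs_def] by measurable

text \<open>Subtracting the linear growth of \<open>W\<close> leaves the periodic function
  \<open>G\<close>; the term \<open>V * t\<close> covers both ordinary increments and those that
  wrap around. Translation invariance then cancels the two integrals of \<open>G\<close>.\<close>

lemma modulus_linear:
  fixes f W :: "real \<Rightarrow> real"
  assumes [measurable]: "f \<in> borel_measurable borel" and p: "periodic1 f" and b: "\<And>x. \<bar>f x\<bar> \<le> c"
    and W: "mono W" and var: "\<And>x y. 0 \<le> x \<Longrightarrow> x \<le> y \<Longrightarrow> y \<le> 1 \<Longrightarrow> \<bar>f y - f x\<bar> \<le> W y - W x"
    and t: "0 \<le> t" "t \<le> 1"
  shows "(\<integral>x. \<bar>f (x + t) - f x\<bar> \<partial>U) \<le> (W 1 - W 0) * t"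
proof -
  define V where "V = W 1 - W 0"
  define G where "G x = W (frac x) - V * frac x" for x
  have V0: "V \<ge> 0" using W by (simp add: V_def monoD)
  note [measurable] = borel_measurable_mono[OF W] frac_measurable_U
  have Gm [measurable]: "G \<in> borel_measurable borel" unfolding G_def[abs_def] by measurable
  have Gp: "periodic1 G" by (simp add: periodic1_def G_def frac_1_eq)
  have Gb: "\<bar>G x\<bar> \<le> \<bar>W 0\<bar> + \<bar>W 1\<bar> + V" for x
  proof -
    have "frac x \<le> 1" using frac_lt_1[of x] by simp
    then have "W 0 \<le> W (frac x)" "W (frac x) \<le> W 1" "0 \<le> V * frac x" "V * frac x \<le> V"
      using V0 by (auto intro: monoD[OF W] mult_left_le)
    moreover have "\<bar>G x\<bar> \<le> \<bar>W (frac x)\<bar> + \<bar>V * frac x\<bar>" unfolding G_def by (rule abs_triangle_ineq4)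
    ultimately show ?thesis by linarith
  qed
  have pt: "\<bar>f (x + t) - f x\<bar> \<le> G (x + t) - G x + V * t" if x: "x \<in> {0..<1}" for x
  proof (cases "x + t < 1")
    case True
    have "\<bar>f (x + t) - f x\<bar> \<le> W (x + t) - W x" using x t True by (intro var) auto
    moreover have "frac (x + t) = x + t" "frac x = x" using x t True by (auto simp: frac_eq)
    ultimately show ?thesis by (simp add: G_def algebra_simps)
  next
    case False
    have fr: "frac (x + t) = x + t - 1"
      using x t False by (subst frac_unique_iff) (auto simp: Ints_def intro: exI[of _ 1])
    have fx: "frac x = x" using x by (simp add: frac_eq)
    have e: "f (x + t) = f (x + t - 1)" "f 1 = f 0"
      using p[unfolded periodic1_def, rule_format, of "x + t - 1"] p[unfolded periodic1_def, rule_format, of 0] by auto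
    have "\<bar>f (x + t - 1) - f 0\<bar> \<le> W (x + t - 1) - W 0" using x t False by (intro var) auto
    moreover have "\<bar>f 1 - f x\<bar> \<le> W 1 - W x" using x by (intro var) auto
    ultimately have "\<bar>f (x + t) - f x\<bar> \<le> W (x + t - 1) - W x + V" unfolding e V_def by linarith
    then show ?thesis unfolding G_def fr fx by (simp add: algebra_simps)
  qed
  have i: "integrable U (\<lambda>x. G (x + t))" "integrable U G"
    by (rule integrable_U[where c="\<bar>W 0\<bar> + \<bar>W 1\<bar> + V"]; use Gb in simp)+
  have "(\<integral>x. \<bar>f (x + t) - f x\<bar> \<partial>U) \<le> (\<integral>x. G (x + t) - G x + V * t \<partial>U)"
  proof (rule integral_mono_AE)
    show "integrable U (\<lambda>x. \<bar>f (x + t) - f x\<bar>)"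
    proof (rule integrable_U[where c="2 * c"])
      show "norm \<bar>f (x + t) - f x\<bar> \<le> 2 * c" for x using b[of x] b[of "x + t"] by simp
    qed measurable
    show "AE x in U. \<bar>f (x + t) - f x\<bar> \<le> G (x + t) - G x + V * t" unfolding AE_U using pt by auto
  qed (use i in simp)
  also have "\<dots> = (\<integral>x. G (x + t) \<partial>U) - (\<integral>x. G x \<partial>U) + V * t"
    using i U.prob_space by simp
  also have "(\<integral>x. G (x + t) \<partial>U) = (\<integral>x. G x \<partial>U)"
    by (rule integral_U_shift[OF Gm _ Gp]) (use Gb in simp)
  finally show ?thesis by (simp add: V_def)
qed

lemma modulus_sin:
  fixes f W :: "real \<Rightarrow> real"
  assumes f: "f \<in> borel_measurable borel" "periodic1 f" "\<And>x. \<bar>f x\<bar> \<le> c"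
    and W: "mono W" "\<And>x y. 0 \<le> x \<Longrightarrow> x \<le> y \<Longrightarrow> y \<le> 1 \<Longrightarrow> \<bar>f y - f x\<bar> \<le> W y - W x"
    and t: "0 \<le> t" "t < 1"
  shows "(\<integral>x. \<bar>f (x + t) - f x\<bar> \<partial>U) \<le> (W 1 - W 0) * sin (pi * t)"
proof -
  note [measurable] = f(1)
  have V0: "W 1 - W 0 \<ge> 0" using W(1) by (simp add: monoD)
  show ?thesis
  proof (cases "t \<le> 1/2")
    case True
    have "(\<integral>x. \<bar>f (x + t) - f x\<bar> \<partial>U) \<le> (W 1 - W 0) * t" using t by (intro modulus_linear[OF f W]) auto
    also have "\<dots> \<le> (W 1 - W 0) * sin (pi * t)" using True t V0 by (intro mult_left_mono sin_ge_self_quarter) auto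
    finally show ?thesis .
  next
    case False
    \<comment> \<open>A shift by \<open>1 - t\<close> turns the increment over \<open>t\<close> into
      the increment over \<open>1 - t\<close> with opposite sign, which reduces to short
      increments.\<close>
    let ?g = "\<lambda>x. \<bar>f (x + t) - f x\<bar>"
    have gp: "periodic1 ?g" using f(2) unfolding periodic1_def by (metis add.assoc add.commute)
    have gb: "norm (?g x) \<le> 2 * c" for x using f(3)[of "x + t"] f(3)[of x] by simp
    have "(\<integral>x. ?g x \<partial>U) = (\<integral>x. ?g (x + (1 - t)) \<partial>U)"
      by (rule integral_U_shift[OF _ gb gp, symmetric]) measurable
    also have "(\<lambda>x. ?g (x + (1 - t))) = (\<lambda>x. \<bar>f (x + (1 - t)) - f x\<bar>)"
      using f(2) by (auto simp: periodic1_def abs_minus_commute add.commute add.left_commute)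
    also have "(\<integral>x. \<bar>f (x + (1 - t)) - f x\<bar> \<partial>U) \<le> (W 1 - W 0) * (1 - t)"
      using t by (intro modulus_linear[OF f W]) auto
    also have "\<dots> \<le> (W 1 - W 0) * sin (pi * (1 - t))" using False t V0 by (intro mult_left_mono sin_ge_self_quarter) auto
    also have "sin (pi * (1 - t)) = sin (pi * t)" by (simp add: right_diff_distrib sin_diff)
    finally show ?thesis .
  qed
qed

section \<open>Variation functions\<close>

lemma total_variation_step:
  assumes "0 \<le> x" "x \<le> y"
  shows "total_variation f 0 x + ereal \<bar>f y - f x\<bar> \<le> total_variation f 0 y"
proof -
  have "total_variation f 0 x \<le> total_variation f 0 y - ereal \<bar>f y - f x\<bar>"
    unfolding total_variation_def[of f 0 x]
  proof (rule SUP_least)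
    fix tm :: "(nat \<Rightarrow> real) \<times> nat"
    assume "tm \<in> {(t, m). t 0 = 0 \<and> t m = x \<and> (\<forall>i<m. t i \<le> t (Suc i))}"
    then obtain t m where tm: "tm = (t, m)" and t: "t 0 = 0" "t m = x" "\<forall>i<m. t i \<le> t (Suc i)" by auto
    define s where "s i = (if i \<le> m then t i else y)" for i
    have sm: "(s, Suc m) \<in> {(t, m). t 0 = 0 \<and> t m = y \<and> (\<forall>i<m. t i \<le> t (Suc i))}"
      using t assms by (auto simp: s_def less_Suc_eq)
    have "(\<Sum>i<Suc m. \<bar>f (s (Suc i)) - f (s i)\<bar>) = (\<Sum>i<m. \<bar>f (t (Suc i)) - f (t i)\<bar>) + \<bar>f y - f x\<bar>"
      using t by (simp add: s_def)
    then have "ereal ((\<Sum>i<m. \<bar>f (t (Suc i)) - f (t i)\<bar>) + \<bar>f y - f x\<bar>) \<le> total_variation f 0 y"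
      unfolding total_variation_def by (intro SUP_upper2[OF sm]) simp
    then show "ereal (\<Sum>i<snd tm. \<bar>f (fst tm (Suc i)) - f (fst tm i)\<bar>) \<le> total_variation f 0 y - ereal \<bar>f y - f x\<bar>"
      by (simp add: ereal_le_minus tm)
  qed
  then show ?thesis by (simp add: ereal_le_minus)
qed

lemma total_variation_nonneg: "0 \<le> x \<Longrightarrow> 0 \<le> total_variation f 0 x"
proof -
  assume x: "0 \<le> x"
  let ?t = "\<lambda>i::nat. if i = 0 then 0 else x"
  have "(?t, 1) \<in> {(t, m). t 0 = 0 \<and> t m = x \<and> (\<forall>i<m. t i \<le> t (Suc i))}" using x by auto
  then show ?thesis unfolding total_variation_def by (rule SUP_upper2) simp
qed

lemma total_variation_function:
  assumes "total_variation f 0 1 < \<infinity>"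
  obtains W where "mono W" "\<And>x y. 0 \<le> x \<Longrightarrow> x \<le> y \<Longrightarrow> y \<le> 1 \<Longrightarrow> \<bar>f y - f x\<bar> \<le> W y - W x"
proof -
  define T where "T x = real_of_ereal (total_variation f 0 x)" for x
  have le1: "total_variation f 0 x \<le> total_variation f 0 1" if "0 \<le> x" "x \<le> 1" for x
  proof -
    have "total_variation f 0 x \<le> total_variation f 0 x + ereal \<bar>f 1 - f x\<bar>"
      using add_mono[OF order_refl, of 0 "ereal \<bar>f 1 - f x\<bar>" "total_variation f 0 x"] by simp
    then show ?thesis using total_variation_step[OF that] order_trans by blast
  qed
  have T: "total_variation f 0 x = ereal (T x)" if "0 \<le> x" "x \<le> 1" for x
  proof -
    have "total_variation f 0 x \<noteq> \<infinity>" using le1[OF that] assms by auto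
    moreover have "total_variation f 0 x \<noteq> - \<infinity>" using total_variation_nonneg[OF that(1), of f] by auto
    ultimately show ?thesis by (auto simp: T_def ereal_real)
  qed
  have st: "\<bar>f y - f x\<bar> \<le> T y - T x" if "0 \<le> x" "x \<le> y" "y \<le> 1" for x y
    using total_variation_step[OF that(1,2), of f] T[of x] T[of y] that by simp
  \<comment> \<open>Clamping to the unit interval makes the variation function monotone on the whole
    line, and hence Borel measurable there.\<close>
  define W where "W x = T (max 0 (min 1 x))" for x
  have "mono W"
  proof (rule monoI)
    fix x y :: real assume "x \<le> y"
    then have "\<bar>f (max 0 (min 1 y)) - f (max 0 (min 1 x))\<bar> \<le> W y - W x" unfolding W_def by (intro st) auto
    then show "W x \<le> W y" by linarith
  qed
  moreover have "\<bar>f y - f x\<bar> \<le> W y - W x" if "0 \<le> x" "x \<le> y" "y \<le> 1" for x y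
    using st[OF that] that by (simp add: W_def)
  ultimately show ?thesis using that by blast
qed

lemma interval_integral_U:
  fixes g :: "real \<Rightarrow> real"
  assumes "g \<in> borel_measurable borel"
  shows "(LBINT x=0..1. g x) = (\<integral>x. g x \<partial>U)"
  using assms unfolding integral_U[OF assms]
  by (simp add: interval_integral_Ico set_lebesgue_integral_def zero_ereal_def one_ereal_def)

section \<open>Transfer from polynomials to the class of controlled modulus\<close>

context permuted_lacunary
begin

text \<open>A single smoothing of fixed degree suffices: half the remainder belongs to the same
  class and has small \<open>L^1\<close> norm, so at a high level \<open>r\<close> its sums are
  negligible against \<open>psi\<close>. The \<open>L^2\<close> norms are close because both
  functions are bounded by 1.\<close>

lemma lil_bvc_approx:
  assumes bv: "bvc V f" and V: "V \<ge> 1" and eps: "\<epsilon> > 0"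
  obtains p d where "bvc V p" "rtrig d p" "\<bar>sqrt (\<integral>x. (p x)\<^sup>2 \<partial>U) - sqrt (\<integral>x. (f x)\<^sup>2 \<partial>U)\<bar> \<le> \<epsilon>"
    "AE x in U. eventually (\<lambda>N. \<bar>S f N x - S p N x\<bar> \<le> \<epsilon> * psi N) sequentially"
proof -
  obtain C where C: "C > 0" "\<And>H. small_family V H \<Longrightarrow> (AE x in U. eventually (\<lambda>N. \<forall>r h. 2 * r \<le> lev N \<longrightarrow> h \<in> H r \<longrightarrow>
    \<bar>S h N x\<bar> \<le> C * 2 powr (- real r / 8) * psi N + 5 * sqrt (real N)) sequentially)"
    using psum_fine[OF V] by blast
  have "eventually (\<lambda>r::nat. 2 * C * 2 powr (- real r / 8) \<le> \<epsilon> / 2) sequentially"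
    using C(1) eps by real_asymp
  then obtain r :: nat where r: "2 * C * 2 powr (- real r / 8) \<le> \<epsilon> / 2"
    using eventually_happens' sequentially_bot by blast
  \<comment> \<open>The first bound admits the remainder to level \<open>r\<close>; the second moves
    the \<open>L^2\<close> norm by at most \<open>\<epsilon>\<close>.\<close>
  have "eventually (\<lambda>i::nat. V / 2 ^ (64 * i) \<le> (1 / 2) ^ r \<and> 2 * (V / 2 ^ (64 * i)) \<le> \<epsilon>\<^sup>2) sequentially"
    by (intro eventually_conj; use V eps in real_asymp)
  then obtain i where i: "V / 2 ^ (64 * i) \<le> (1 / 2) ^ r" "2 * (V / 2 ^ (64 * i)) \<le> \<epsilon>\<^sup>2"
    using eventually_happens' sequentially_bot by blast
  define p where "p = conv (deg i) f"
  \<comment> \<open>Halving keeps both the supremum bound 1 and the modulus constant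
    \<open>V\<close>.\<close>
  define h where "h x = (f x - p x) / 2" for x
  note f = bvcD[OF bv]
  have bp: "bvc V p" unfolding p_def by (rule bvc_conv[OF bv])
  note pp = bvcD[OF bp]
  note [measurable] = f(1) pp(1)
  have ip: "integrable U p" "integrable U f" "integrable U (\<lambda>x. (p x)\<^sup>2)" "integrable U (\<lambda>x. (f x)\<^sup>2)"
    by (rule integrable_U[where c=1]; use f(3) pp(3) in \<open>simp add: abs_square_le_1\<close>)+
  have L1: "(\<integral>x. \<bar>p x - f x\<bar> \<partial>U) \<le> V / 2 ^ (64 * i)"
    unfolding p_def using V by (intro conv_deg_approx[OF bv]) auto
  have id: "integrable U (\<lambda>x. \<bar>p x - f x\<bar>)" using ip by simp
  have bh: "bvc V h"
    unfolding bvc_def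
  proof (intro conjI allI ballI)
    show "h \<in> borel_measurable borel" unfolding h_def[abs_def] by measurable
    show "periodic1 h" using f(2) pp(2) by (simp add: periodic1_def h_def)
    show "\<bar>h x\<bar> \<le> 1" for x using f(3)[of x] pp(3)[of x] by (simp add: h_def)
    show "(\<integral>x. h x \<partial>U) = 0" using ip f(4) pp(4) by (simp add: h_def)
    fix t :: real assume t: "t \<in> {0..<1}"
    have int: "integrable U (\<lambda>x. \<bar>f (x + t) - f x\<bar>)" "integrable U (\<lambda>x. \<bar>p (x + t) - p x\<bar>)"
    proof -
      have "norm \<bar>f (x + t) - f x\<bar> \<le> 2" "norm \<bar>p (x + t) - p x\<bar> \<le> 2" for x
        using f(3)[of x] f(3)[of "x + t"] pp(3)[of x] pp(3)[of "x + t"] by simp_all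
      then show "integrable U (\<lambda>x. \<bar>f (x + t) - f x\<bar>)" "integrable U (\<lambda>x. \<bar>p (x + t) - p x\<bar>)"
        by (intro integrable_U[where c=2]; simp)+
    qed
    have "(\<integral>x. \<bar>h (x + t) - h x\<bar> \<partial>U) \<le> (\<integral>x. (\<bar>f (x + t) - f x\<bar> + \<bar>p (x + t) - p x\<bar>) / 2 \<partial>U)"
    proof (rule integral_mono)
      show "integrable U (\<lambda>x. \<bar>h (x + t) - h x\<bar>)"
      proof (rule integrable_U[where c=2])
        show "norm \<bar>h (x + t) - h x\<bar> \<le> 2" for x
          using f(3)[of x] f(3)[of "x + t"] pp(3)[of x] pp(3)[of "x + t"] unfolding h_def real_norm_def abs_abs abs_le_iff diff_divide_distrib by linarith
      qed (simp add: h_def)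
      show "\<bar>h (x + t) - h x\<bar> \<le> (\<bar>f (x + t) - f x\<bar> + \<bar>p (x + t) - p x\<bar>) / 2" for x
      proof -
        have "h (x + t) - h x = ((f (x + t) - f x) - (p (x + t) - p x)) / 2" by (simp add: h_def diff_divide_distrib)
        then have eq: "\<bar>h (x + t) - h x\<bar> = \<bar>(f (x + t) - f x) - (p (x + t) - p x)\<bar> / 2" by (simp only: abs_divide abs_numeral)
        show ?thesis unfolding eq by (rule divide_right_mono[OF abs_triangle_ineq4]) simp
      qed
    qed (use int in simp)
    also have "\<dots> = ((\<integral>x. \<bar>f (x + t) - f x\<bar> \<partial>U) + (\<integral>x. \<bar>p (x + t) - p x\<bar> \<partial>U)) / 2" using int by simp
    also have "\<dots> \<le> V * sin (pi * t)" using f(5)[OF t] pp(5)[OF t] by simp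
    finally show "(\<integral>x. \<bar>h (x + t) - h x\<bar> \<partial>U) \<le> V * sin (pi * t)" .
  qed
  have Lh: "(\<integral>x. \<bar>h x\<bar> \<partial>U) \<le> (1 / 2) ^ r"
  proof -
    have "(\<integral>x. \<bar>h x\<bar> \<partial>U) = (\<integral>x. \<bar>p x - f x\<bar> \<partial>U) / 2"
      unfolding h_def by (simp add: abs_minus_commute)
    also have "\<dots> \<le> (\<integral>x. \<bar>p x - f x\<bar> \<partial>U)" by simp
    finally show ?thesis using L1 i(1) by linarith
  qed
  define H where "H = (\<lambda>r'. if r' = r then {h} else {})"
  have "small_family V H" using bh Lh by (auto simp: small_family_def H_def)
  from C(2)[OF this] have "AE x in U. eventually (\<lambda>N. \<bar>S f N x - S p N x\<bar> \<le> \<epsilon> * psi N) sequentially"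
  proof eventually_elim
    case (elim x)
    note x = elim
    have eps2: "\<epsilon> / 2 > 0" using eps by simp
    show ?case
      using x sqrt_le_psi[OF eps2, of 10 0] psi_pos eventually_lev[OF eventually_ge_at_top[of "2 * r"]]
    proof eventually_elim
      case (elim N)
      have "\<bar>S h N x\<bar> \<le> C * 2 powr (- real r / 8) * psi N + 5 * sqrt (real N)"
        using elim(1,4) by (simp add: H_def)
      moreover have "S f N x - S p N x = 2 * S h N x"
      proof -
        have e: "f y - p y = 2 * h y" for y by (simp add: h_def)
        show ?thesis unfolding psum_def sum_subtractf[symmetric] e sum_distrib_left ..
      qed
      moreover have "2 * C * 2 powr (- real r / 8) * psi N \<le> \<epsilon> / 2 * psi N"
        using r elim(3) by (intro mult_right_mono) auto
      ultimately show ?case using elim(2) by (simp add: abs_mult)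
    qed
  qed
  moreover have "\<bar>sqrt (\<integral>x. (p x)\<^sup>2 \<partial>U) - sqrt (\<integral>x. (f x)\<^sup>2 \<partial>U)\<bar> \<le> \<epsilon>"
  proof -
    define v where "v = (\<integral>x. (p x)\<^sup>2 \<partial>U)"
    define w where "w = (\<integral>x. (f x)\<^sup>2 \<partial>U)"
    have vw: "v \<ge> 0" "w \<ge> 0" by (simp_all add: v_def w_def)
    have pt: "\<bar>(p x)\<^sup>2 - (f x)\<^sup>2\<bar> \<le> 2 * \<bar>p x - f x\<bar>" for x
    proof -
      have "\<bar>(p x)\<^sup>2 - (f x)\<^sup>2\<bar> = \<bar>p x + f x\<bar> * \<bar>p x - f x\<bar>"
        unfolding abs_mult[symmetric] by (simp add: power2_eq_square algebra_simps)
      also have "\<dots> \<le> 2 * \<bar>p x - f x\<bar>" using f(3)[of x] pp(3)[of x] by (intro mult_right_mono) auto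
      finally show ?thesis .
    qed
    have "\<bar>v - w\<bar> = \<bar>\<integral>x. (p x)\<^sup>2 - (f x)\<^sup>2 \<partial>U\<bar>" using ip by (simp add: v_def w_def)
    also have "\<dots> \<le> (\<integral>x. \<bar>(p x)\<^sup>2 - (f x)\<^sup>2\<bar> \<partial>U)" by (rule integral_abs_bound)
    also have "\<dots> \<le> (\<integral>x. 2 * \<bar>p x - f x\<bar> \<partial>U)"
      by (rule integral_mono[OF _ _ pt]) (use ip id in auto)
    also have "\<dots> \<le> 2 * (V / 2 ^ (64 * i))" using L1 by simp
    also have "\<dots> \<le> \<epsilon>\<^sup>2" by (rule i(2))
    finally have "\<bar>v - w\<bar> \<le> \<epsilon>\<^sup>2" .
    then have "v \<le> w + \<epsilon>\<^sup>2" "w \<le> v + \<epsilon>\<^sup>2" by (auto simp: abs_le_iff)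
    moreover have "sqrt (z + \<epsilon>\<^sup>2) \<le> sqrt z + \<epsilon>" if "z \<ge> 0" for z
      using sqrt_add_le_add_sqrt[of z "\<epsilon>\<^sup>2"] that eps by simp
    ultimately have "sqrt v \<le> sqrt w + \<epsilon>" "sqrt w \<le> sqrt v + \<epsilon>"
      using vw by (meson order_trans real_sqrt_le_mono)+
    then show ?thesis by (auto simp: v_def w_def abs_le_iff)
  qed
  moreover have "rtrig (deg i) p" unfolding p_def by (rule rtrig_conv[OF f(1-3)])
  ultimately show ?thesis using that bp by blast
qed

lemma lil_bvc:
  assumes bv: "bvc V f" and V: "V \<ge> 1"
  shows "lil_upper f (sqrt (\<integral>x. (f x)\<^sup>2 \<partial>U))" "lil_lower f (sqrt (\<integral>x. (f x)\<^sup>2 \<partial>U))"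
proof -
  define s where "s = sqrt (\<integral>x. (f x)\<^sup>2 \<partial>U)"
  have "(AE x in U. eventually (\<lambda>N. \<bar>S f N x\<bar> \<le> (s + \<epsilon>) * psi N) sequentially) \<and>
        (AE x in U. frequently (\<lambda>N. S f N x \<ge> (s - \<epsilon>) * psi N) sequentially)" if eps: "\<epsilon> > 0" for \<epsilon>
  proof -
    have e3: "\<epsilon> / 3 > 0" using eps by simp
    obtain p d where p: "bvc V p" "rtrig d p" "\<bar>sqrt (\<integral>x. (p x)\<^sup>2 \<partial>U) - sqrt (\<integral>x. (f x)\<^sup>2 \<partial>U)\<bar> \<le> \<epsilon> / 3"
      and ap: "AE x in U. eventually (\<lambda>N. \<bar>S f N x - S p N x\<bar> \<le> \<epsilon> / 3 * psi N) sequentially"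
      by (rule lil_bvc_approx[OF bv V e3])
    define q where "q = sqrt (\<integral>x. (p x)\<^sup>2 \<partial>U)"
    have qs: "\<bar>q - s\<bar> \<le> \<epsilon> / 3" using p(3) by (simp add: q_def s_def)
    have u: "AE x in U. eventually (\<lambda>N. \<bar>S p N x\<bar> \<le> (q + \<epsilon> / 3) * psi N) sequentially"
      using lil_upper_trig[OF p(1) V p(2)] e3 unfolding lil_upper_def q_def by blast
    have l: "AE x in U. frequently (\<lambda>N. S p N x \<ge> (q - \<epsilon> / 3) * psi N) sequentially"
      using lil_lower_trig[OF p(1) V p(2)] e3 unfolding lil_lower_def q_def by blast
    have "AE x in U. eventually (\<lambda>N. \<bar>S f N x\<bar> \<le> (s + \<epsilon>) * psi N) sequentially"
      using ap u
    proof eventually_elim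
      case (elim x)
      from elim show ?case
        using psi_pos
      proof eventually_elim
        case (elim N)
        have "(q + \<epsilon> / 3 + \<epsilon> / 3) * psi N \<le> (s + \<epsilon>) * psi N" using qs elim(3) by (intro mult_right_mono) linarith+
        then show ?case using elim(1,2) unfolding distrib_right by linarith
      qed
    qed
    moreover have "AE x in U. frequently (\<lambda>N. S f N x \<ge> (s - \<epsilon>) * psi N) sequentially"
      using ap l
    proof eventually_elim
      case (elim x)
      note x = elim
      show ?case
        using x(2)
      proof (rule frequently_rev_mp)
        show "eventually (\<lambda>N. S p N x \<ge> (q - \<epsilon> / 3) * psi N \<longrightarrow> S f N x \<ge> (s - \<epsilon>) * psi N) sequentially"
          using x(1) psi_pos
        proof eventually_elim
          case (elim N)
          have "(s - \<epsilon>) * psi N \<le> (q - \<epsilon> / 3 - \<epsilon> / 3) * psi N" using qs elim(2) by (intro mult_right_mono) linarith+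
          then show ?case using elim(1) unfolding left_diff_distrib by linarith
        qed
      qed
    qed
    ultimately show ?thesis by blast
  qed
  then show "lil_upper f (sqrt (\<integral>x. (f x)\<^sup>2 \<partial>U))" "lil_lower f (sqrt (\<integral>x. (f x)\<^sup>2 \<partial>U))"
    by (auto simp: lil_upper_def lil_lower_def s_def)
qed

end

text \<open>Restricting \<open>\<epsilon>\<close> to the reciprocals of the positive integers leaves
  only countably many exceptional null sets.\<close>

lemma AE_limsup_eqI:
  fixes X :: "nat \<Rightarrow> real \<Rightarrow> real"
  assumes up: "\<And>\<epsilon>. \<epsilon> > 0 \<Longrightarrow> AE x in U. eventually (\<lambda>N. X N x \<le> c + \<epsilon>) sequentially"
    and lo: "\<And>\<epsilon>. \<epsilon> > 0 \<Longrightarrow> AE x in U. frequently (\<lambda>N. X N x \<ge> c - \<epsilon>) sequentially"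
  shows "AE x in U. limsup (\<lambda>N. ereal (X N x)) = ereal c"
proof -
  have "AE x in U. \<forall>k::nat. eventually (\<lambda>N. X N x \<le> c + 1 / real (Suc k)) sequentially"
    by (subst AE_all_countable) (intro allI up, simp)
  moreover have "AE x in U. \<forall>k::nat. frequently (\<lambda>N. X N x \<ge> c - 1 / real (Suc k)) sequentially"
    by (subst AE_all_countable) (intro allI lo, simp)
  ultimately show ?thesis
  proof eventually_elim
    case (elim x)
    note u = elim(1)
    note l = elim(2)
    show ?case
    proof (rule antisym)
      show "limsup (\<lambda>N. ereal (X N x)) \<le> ereal c"
      proof (rule ccontr)
        assume "\<not> limsup (\<lambda>N. ereal (X N x)) \<le> ereal c"
        then have "ereal c < limsup (\<lambda>N. ereal (X N x))" by simp
        then obtain y where y: "ereal c < ereal y" "ereal y < limsup (\<lambda>N. ereal (X N x))"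
          using ereal_dense2 by blast
        then have "0 < y - c" by simp
        then obtain k where k: "1 / real (Suc k) < y - c" using reals_Archimedean[of "y - c"] by (auto simp: inverse_eq_divide)
        have "limsup (\<lambda>N. ereal (X N x)) \<le> ereal (c + 1 / real (Suc k))"
          by (rule Limsup_bounded) (use u in simp)
        also have "\<dots> \<le> ereal y" using k by simp
        finally show False using y(2) by simp
      qed
      show "ereal c \<le> limsup (\<lambda>N. ereal (X N x))"
      proof (rule ccontr)
        assume "\<not> ereal c \<le> limsup (\<lambda>N. ereal (X N x))"
        then have "limsup (\<lambda>N. ereal (X N x)) < ereal c" by simp
        then obtain y where y: "limsup (\<lambda>N. ereal (X N x)) < ereal y" "ereal y < ereal c"
          using ereal_dense2 by blast
        then have ev: "eventually (\<lambda>N. X N x < y) sequentially" using Limsup_lessD[OF y(1)] by simp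
        have "0 < c - y" using y(2) by simp
        then obtain k where "1 / real (Suc k) < c - y" using reals_Archimedean[of "c - y"] by (auto simp: inverse_eq_divide)
        then have "eventually (\<lambda>N. \<not> X N x \<ge> c - 1 / real (Suc k)) sequentially"
          using ev by (auto elim!: eventually_mono)
        then show False using l by (simp add: frequently_def)
      qed
    qed
  qed
qed

section \<open>The law for a general function of bounded variation\<close>

context permuted_lacunary
begin

lemma lil_limsup:
  assumes "lil_upper h s" "lil_lower h s"
  shows "AE x in U. limsup (\<lambda>N. ereal (S h N x / psi N)) = ereal s"
proof (rule AE_limsup_eqI)
  fix \<epsilon> :: real assume eps: "\<epsilon> > 0"
  have "AE x in U. eventually (\<lambda>N. \<bar>S h N x\<bar> \<le> (s + \<epsilon>) * psi N) sequentially"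
    using assms(1) eps by (simp add: lil_upper_def)
  then show "AE x in U. eventually (\<lambda>N. S h N x / psi N \<le> s + \<epsilon>) sequentially"
  proof eventually_elim
    case (elim x)
    from elim show ?case
      using psi_pos by eventually_elim (simp add: divide_le_eq abs_le_iff)
  qed
  have "AE x in U. frequently (\<lambda>N. S h N x \<ge> (s - \<epsilon>) * psi N) sequentially"
    using assms(2) eps by (simp add: lil_lower_def)
  then show "AE x in U. frequently (\<lambda>N. S h N x / psi N \<ge> s - \<epsilon>) sequentially"
  proof eventually_elim
    case (elim x)
    from elim show ?case
      by (rule frequently_rev_mp) (use psi_pos in \<open>auto elim!: eventually_mono simp: le_divide_eq\<close>)
  qed
qed

lemma lil_bounded_variation:
  fixes f :: "real \<Rightarrow> real"
  assumes fm: "f \<in> borel_measurable borel" and fp: "periodic1 f"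
    and f0: "(\<integral>x. f x \<partial>U) = 0" and fv: "total_variation f 0 1 < \<infinity>"
  shows "AE x in U. limsup (\<lambda>N. ereal (S f N x / psi N)) = ereal (sqrt (\<integral>x. (f x)\<^sup>2 \<partial>U))"
proof -
  obtain W where W: "mono W" "\<And>x y. 0 \<le> x \<Longrightarrow> x \<le> y \<Longrightarrow> y \<le> 1 \<Longrightarrow> \<bar>f y - f x\<bar> \<le> W y - W x"
    using total_variation_function[OF fv] by blast
  \<comment> \<open>A supremum bound for \<open>f\<close>; the summand 1 makes the division by
    \<open>c\<close> legitimate even for \<open>f = 0\<close>.\<close>
  define c where "c = \<bar>f 0\<bar> + (W 1 - W 0) + 1"
  have V0: "W 1 - W 0 \<ge> 0" using W(1) by (simp add: monoD)
  have c: "c \<ge> 1" using V0 by (simp add: c_def)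
  have fb: "\<bar>f x\<bar> \<le> c" for x
  proof -
    have fr: "0 \<le> frac x" "frac x \<le> 1" using frac_lt_1[of x] by auto
    have "\<bar>f (frac x) - f 0\<bar> \<le> W (frac x) - W 0" using fr by (intro W) auto
    moreover have "W (frac x) \<le> W 1" using fr W(1) by (simp add: monoD)
    ultimately show ?thesis unfolding periodic1_frac[OF fp] c_def by linarith
  qed
  define h where "h x = f x / c" for x
  define W' where "W' x = W x / c" for x
  define V where "V = max 1 (W' 1 - W' 0)"
  note [measurable] = fm
  have hm: "h \<in> borel_measurable borel" unfolding h_def[abs_def] by measurable
  have hp: "periodic1 h" using fp by (simp add: periodic1_def h_def)
  have hb: "\<bar>h x\<bar> \<le> 1" for x using fb[of x] c by (simp add: h_def)
  have W': "mono W'" "\<And>x y. 0 \<le> x \<Longrightarrow> x \<le> y \<Longrightarrow> y \<le> 1 \<Longrightarrow> \<bar>h y - h x\<bar> \<le> W' y - W' x"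
  proof -
    show "mono W'" using W(1) c by (auto simp: W'_def mono_def divide_right_mono)
    show "\<bar>h y - h x\<bar> \<le> W' y - W' x" if "0 \<le> x" "x \<le> y" "y \<le> 1" for x y
      using divide_right_mono[OF W(2)[OF that], of c] c by (simp add: h_def W'_def diff_divide_distrib[symmetric] abs_divide)
  qed
  have "bvc V h"
    unfolding bvc_def
  proof (intro conjI allI ballI hm hp hb)
    show "(\<integral>x. h x \<partial>U) = 0" using f0 by (simp add: h_def)
    fix t :: real assume t: "t \<in> {0..<1}"
    have "(\<integral>x. \<bar>h (x + t) - h x\<bar> \<partial>U) \<le> (W' 1 - W' 0) * sin (pi * t)"
      using t by (intro modulus_sin[OF hm hp hb W']) auto
    also have "\<dots> \<le> V * sin (pi * t)"
      using t by (intro mult_right_mono sin_ge_zero) (auto simp: V_def)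
    finally show "(\<integral>x. \<bar>h (x + t) - h x\<bar> \<partial>U) \<le> V * sin (pi * t)" .
  qed
  then have "AE x in U. limsup (\<lambda>N. ereal (S h N x / psi N)) = ereal (sqrt (\<integral>x. (h x)\<^sup>2 \<partial>U))"
    by (intro lil_limsup lil_bvc) (auto simp: V_def)
  then show ?thesis
  proof eventually_elim
    case (elim x)
    have "S f N x / psi N = c * (S h N x / psi N)" for N
      using c by (simp add: psum_def h_def sum_divide_distrib[symmetric])
    then have "limsup (\<lambda>N. ereal (S f N x / psi N)) = limsup (\<lambda>N. ereal c * ereal (S h N x / psi N))"
      by (simp only: times_ereal.simps)
    also have "\<dots> = ereal c * limsup (\<lambda>N. ereal (S h N x / psi N))"
      using c by (intro Limsup_ereal_mult_left) auto
    also have "\<dots> = ereal (c * sqrt (\<integral>x. (h x)\<^sup>2 \<partial>U))" unfolding elim by simp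
    also have "c * sqrt (\<integral>x. (h x)\<^sup>2 \<partial>U) = sqrt (\<integral>x. (f x)\<^sup>2 \<partial>U)"
    proof -
      have "(\<integral>x. (f x)\<^sup>2 \<partial>U) = c\<^sup>2 * (\<integral>x. (h x)\<^sup>2 \<partial>U)"
        using c by (simp add: h_def power_divide)
      then show ?thesis using c by (simp add: real_sqrt_mult)
    qed
    finally show ?case .
  qed
qed

end

subsection \<open>Discrepancy\<close>

definition Ind :: "real \<Rightarrow> real \<Rightarrow> real \<Rightarrow> real" where
  "Ind a b x = indicator {a..<b} (frac x) - (b - a)"

lemma Ind_measurable [measurable]: "Ind a b \<in> borel_measurable borel"
proof -
  note [measurable] = frac_measurable_U
  show ?thesis unfolding Ind_def[abs_def] by measurable
qed

lemma Ind_abs_le: "0 \<le> a \<Longrightarrow> a \<le> b \<Longrightarrow> b \<le> 1 \<Longrightarrow> \<bar>Ind a b x\<bar> \<le> 1"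
  by (auto simp: Ind_def indicator_def abs_le_iff)

lemma integral_indicator_frac:
  assumes "0 \<le> a" "a \<le> b" "b \<le> 1"
  shows "(\<integral>x. indicator {a..<b} (frac x) \<partial>U) = b - a"
    "integrable U (\<lambda>x. indicator {a..<b} (frac x) :: real)"
proof -
  note [measurable] = frac_measurable_U
  show "integrable U (\<lambda>x. indicator {a..<b} (frac x) :: real)"
    by (rule integrable_U[where c=1]) (auto simp: indicator_def)
  have "(\<integral>x. indicator {a..<b} (frac x) \<partial>U) = (\<integral>x. indicator {0..<1} x *\<^sub>R (indicator {a..<b} (frac x) :: real) \<partial>lborel)"
    by (rule integral_U) measurable
  also have "\<dots> = (\<integral>x. indicator {a..<b} x \<partial>lborel)"
    using assms by (intro Bochner_Integration.integral_cong) (auto simp: indicator_def frac_eq)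
  also have "\<dots> = b - a" using assms by simp
  finally show "(\<integral>x. indicator {a..<b} (frac x) \<partial>U) = b - a" .
qed

lemma integral_Ind:
  assumes "0 \<le> a" "a \<le> b" "b \<le> 1"
  shows "(\<integral>x. Ind a b x \<partial>U) = 0" "(\<integral>x. (Ind a b x)\<^sup>2 \<partial>U) = (b - a) * (1 - (b - a))"
    "(\<integral>x. \<bar>Ind a b x\<bar> \<partial>U) \<le> 2 * (b - a)"
proof -
  note i = integral_indicator_frac[OF assms]
  show "(\<integral>x. Ind a b x \<partial>U) = 0" unfolding Ind_def using i U.prob_space by simp
  have sq: "(Ind a b x)\<^sup>2 = (1 - 2 * (b - a)) * indicator {a..<b} (frac x) + (b - a)\<^sup>2" for x
    by (simp add: Ind_def indicator_def power2_eq_square algebra_simps)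
  have "(\<integral>x. (Ind a b x)\<^sup>2 \<partial>U) = (1 - 2 * (b - a)) * (b - a) + (b - a)\<^sup>2"
    unfolding sq using i U.prob_space by simp
  then show "(\<integral>x. (Ind a b x)\<^sup>2 \<partial>U) = (b - a) * (1 - (b - a))"
    by (simp add: power2_eq_square algebra_simps)
  have "(\<integral>x. \<bar>Ind a b x\<bar> \<partial>U) \<le> (\<integral>x. indicator {a..<b} (frac x) + (b - a) \<partial>U)"
  proof (rule integral_mono)
    show "integrable U (\<lambda>x. \<bar>Ind a b x\<bar>)"
      by (rule integrable_U[where c=1]) (use Ind_abs_le[OF assms] in auto)
    show "\<bar>Ind a b x\<bar> \<le> indicator {a..<b} (frac x) + (b - a)" for x
      using assms by (auto simp: Ind_def indicator_def)
  qed (use i in simp)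
  also have "\<dots> = 2 * (b - a)" using i U.prob_space by simp
  finally show "(\<integral>x. \<bar>Ind a b x\<bar> \<partial>U) \<le> 2 * (b - a)" .
qed

lemma bvc_scale:
  assumes "bvc V h" "0 \<le> c" "c \<le> 1" "V \<ge> 0" shows "bvc V (\<lambda>x. c * h x)"
proof -
  note h = bvcD[OF assms(1)]
  note [measurable] = h(1)
  have "(\<integral>x. \<bar>c * h (x + t) - c * h x\<bar> \<partial>U) \<le> V * sin (pi * t)" if t: "t \<in> {0..<1}" for t
  proof -
    have "\<bar>c * h (x + t) - c * h x\<bar> = c * \<bar>h (x + t) - h x\<bar>" for x
      using assms(2) by (simp add: abs_mult flip: right_diff_distrib)
    then have "(\<integral>x. \<bar>c * h (x + t) - c * h x\<bar> \<partial>U) = c * (\<integral>x. \<bar>h (x + t) - h x\<bar> \<partial>U)" by simp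
    also have "\<dots> \<le> 1 * (\<integral>x. \<bar>h (x + t) - h x\<bar> \<partial>U)" using assms(3) by (intro mult_right_mono) auto
    finally show ?thesis using h(5)[OF t] by simp
  qed
  moreover have "\<bar>c * h x\<bar> \<le> 1" for x
    unfolding abs_mult using assms(2,3) mult_mono[of "\<bar>c\<bar>" 1 "\<bar>h x\<bar>" 1] h(3)[of x] by simp
  ultimately show ?thesis unfolding bvc_def using h(2,4) by (auto simp: periodic1_def)
qed

lemma bvc_Ind:
  assumes "0 \<le> a" "a \<le> b" "b \<le> 1" shows "bvc 3 (Ind a b)"
  unfolding bvc_def
proof (intro conjI allI ballI Ind_measurable Ind_abs_le[OF assms] integral_Ind(1)[OF assms])
  show per: "periodic1 (Ind a b)" by (simp add: periodic1_def Ind_def frac_1_eq)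
  \<comment> \<open>One unit jump for each endpoint and one at 1, where the periodic extension may
    jump as it wraps around; hence the constant 3.\<close>
  define W where "W x = (indicator {a..} x + indicator {b..} x + indicator {1..} x :: real)" for x :: real
  have W: "mono W" by (auto simp: W_def mono_def indicator_def)
  have var: "\<bar>Ind a b y - Ind a b x\<bar> \<le> W y - W x" if xy: "0 \<le> x" "x \<le> y" "y \<le> 1" for x y
  proof (cases "y < 1")
    case True
    then have "frac x = x" "frac y = y" using xy by (auto simp: frac_eq)
    then show ?thesis using xy True assms by (auto simp: Ind_def W_def indicator_def)
  next
    case False
    then have y: "y = 1" using xy by simp
    show ?thesis
    proof (cases "x = 1")
      case False
      then have "W x \<le> W y - 1" using xy y assms by (auto simp: W_def indicator_def)
      moreover have "\<bar>Ind a b y - Ind a b x\<bar> \<le> 1" by (auto simp: Ind_def indicator_def)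
      ultimately show ?thesis by simp
    qed (simp add: y)
  qed
  fix t :: real assume t: "t \<in> {0..<1}"
  have "(\<integral>x. \<bar>Ind a b (x + t) - Ind a b x\<bar> \<partial>U) \<le> (W 1 - W 0) * sin (pi * t)"
    using t by (intro modulus_sin[OF Ind_measurable per Ind_abs_le[OF assms] W var]) auto
  also have "\<dots> \<le> 3 * sin (pi * t)"
    using t by (intro mult_right_mono sin_ge_zero) (auto simp: W_def indicator_def)
  finally show "(\<integral>x. \<bar>Ind a b (x + t) - Ind a b x\<bar> \<partial>U) \<le> 3 * sin (pi * t)" .
qed

lemma Ind_add: "a \<le> b \<Longrightarrow> b \<le> c \<Longrightarrow> Ind a c x = Ind a b x + Ind b c x"
  by (auto simp: Ind_def indicator_def)

section \<open>Dyadic chaining of interval endpoints\<close>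

definition dyfl :: "nat \<Rightarrow> real \<Rightarrow> nat" where "dyfl r t = nat \<lfloor>t * 2 ^ r\<rfloor>"

lemma dyfl:
  assumes "0 \<le> t" "t < 1"
  shows "real (dyfl r t) / 2 ^ r \<le> t" "t < (real (dyfl r t) + 1) / 2 ^ r" "dyfl r t < 2 ^ r"
    "dyfl (Suc r) t = 2 * dyfl r t \<or> dyfl (Suc r) t = 2 * dyfl r t + 1"
proof -
  have r: "real (dyfl r t) = of_int \<lfloor>t * 2 ^ r\<rfloor>" for r using assms by (simp add: dyfl_def)
  have b: "real (dyfl r t) \<le> t * 2 ^ r" "t * 2 ^ r < real (dyfl r t) + 1" for r unfolding r by linarith+
  show "real (dyfl r t) / 2 ^ r \<le> t" "t < (real (dyfl r t) + 1) / 2 ^ r"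
    using b[of r] by (simp_all add: field_simps)
  have "real (dyfl r t) < 2 ^ r" using b(1)[of r] assms(2) by (smt (verit) mult_less_cancel_right2 zero_less_power)
  then have "real (dyfl r t) < real (2 ^ r)" by simp
  then show "dyfl r t < 2 ^ r" by (simp only: of_nat_less_iff)
  have "real (dyfl (Suc r) t) < real (2 * dyfl r t + 2)" "real (2 * dyfl r t) < real (dyfl (Suc r) t + 1)"
    using b[of r] b[of "Suc r"] by simp_all
  then show "dyfl (Suc r) t = 2 * dyfl r t \<or> dyfl (Suc r) t = 2 * dyfl r t + 1"
    unfolding of_nat_less_iff by linarith
qed

text \<open>Chaining along the binary digits of the endpoint \<open>t\<close>.\<close>
lemma endpoint_chain:
  fixes T :: "real \<Rightarrow> real \<Rightarrow> real"
  assumes t: "0 \<le> t" "t < 1" and Z: "Z \<ge> 0" and E: "E \<ge> 0"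
    and add: "\<And>a b c. a \<le> b \<Longrightarrow> b \<le> c \<Longrightarrow> T a c = T a b + T b c"
    and block: "\<And>r j. r \<le> r0 \<Longrightarrow> j < 2 ^ r \<Longrightarrow> \<bar>T (real j / 2 ^ r) ((real j + 1) / 2 ^ r)\<bar> \<le> Z * 2 powr (- real r / 8) + E"
    and last: "\<And>j. j < 2 ^ r0 \<Longrightarrow> real j / 2 ^ r0 \<le> t \<Longrightarrow> t < (real j + 1) / 2 ^ r0 \<Longrightarrow>
        \<bar>T (real j / 2 ^ r0) t\<bar> \<le> \<bar>T (real j / 2 ^ r0) ((real j + 1) / 2 ^ r0)\<bar> + D"
    and R: "R \<le> r0"
  shows "\<bar>T (real (dyfl R t) / 2 ^ R) t\<bar> \<le> 12 * Z * 2 powr (- real R / 8) + (real r0 + 1) * E + D"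
proof -
  note d = dyfl[OF t]
  define g where "g r = real (dyfl r t) / 2 ^ r" for r
  have T0: "T a a = 0" for a using add[of a a a] by simp
  have gS: "g r \<le> g (Suc r) \<and> \<bar>T (g r) (g (Suc r))\<bar> \<le> Z * 2 powr (- real (Suc r) / 8) + E" if "Suc r \<le> r0" for r
    using d(4)[of r]
  proof
    assume "dyfl (Suc r) t = 2 * dyfl r t"
    then have "g (Suc r) = g r" by (simp add: g_def)
    then show ?thesis using Z E by (simp add: T0)
  next
    assume e: "dyfl (Suc r) t = 2 * dyfl r t + 1"
    have lt: "2 * dyfl r t < 2 ^ Suc r" using d(3)[of r] by simp
    have 1: "g r = real (2 * dyfl r t) / 2 ^ Suc r" by (simp add: g_def)
    have 2: "g (Suc r) = (real (2 * dyfl r t) + 1) / 2 ^ Suc r" by (simp add: g_def e)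
    have "real (2 * dyfl r t) / 2 ^ Suc r \<le> (real (2 * dyfl r t) + 1) / 2 ^ Suc r"
      by (rule divide_right_mono) simp_all
    then show ?thesis unfolding 1 2 using block[OF that lt] by blast
  qed
  have "g R \<le> g r \<and> \<bar>T (g R) (g r)\<bar> \<le> 12 * Z * (2 powr (- real R / 8) - 2 powr (- real r / 8)) + real (r - R) * E"
    if "R \<le> r" "r \<le> r0" for r
    using that
  proof (induction r rule: dec_induct)
    case base
    then show ?case by (simp add: T0)
  next
    case (step r)
    define z where "z = 2 powr (- real (Suc r) / 8)"
    have z: "2 powr (- real r / 8) = z * 2 powr (1/8)"
      unfolding z_def powr_add[symmetric] by (rule arg_cong[where f="\<lambda>u. 2 powr u"]) (simp add: field_simps)
    \<comment> \<open>Each level is charged to the drop of \<open>2 powr (- r / 8)\<close> between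
      consecutive levels, so the charges telescope.\<close>
    have "Z * z * (13 / 12) \<le> Z * z * 2 powr (1/8)"
      using Z by (intro mult_left_mono two_powr_eighth) (auto simp: z_def)
    then have zz: "Z * z \<le> 12 * Z * (2 powr (- real r / 8) - z)" unfolding z by (simp add: algebra_simps)
    have IH: "g R \<le> g r" "\<bar>T (g R) (g r)\<bar> \<le> 12 * Z * (2 powr (- real R / 8) - 2 powr (- real r / 8)) + real (r - R) * E"
      using step by auto
    have s: "g r \<le> g (Suc r)" "\<bar>T (g r) (g (Suc r))\<bar> \<le> Z * z + E" using gS[of r] step.prems by (auto simp: z_def)
    have "\<bar>T (g R) (g (Suc r))\<bar> \<le> \<bar>T (g R) (g r)\<bar> + \<bar>T (g r) (g (Suc r))\<bar>"
      unfolding add[OF IH(1) s(1)] by (rule abs_triangle_ineq)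
    also have "\<dots> \<le> (12 * Z * (2 powr (- real R / 8) - 2 powr (- real r / 8)) + real (r - R) * E) + (12 * Z * (2 powr (- real r / 8) - z) + E)"
      using IH(2) s(2) zz by linarith
    also have "\<dots> = 12 * Z * (2 powr (- real R / 8) - z) + real (Suc r - R) * E"
      using step.hyps by (simp add: Suc_diff_le algebra_simps)
    finally show ?case using IH(1) s(1) by (simp add: z_def)
  qed
  from this[OF R order_refl] have 1: "g R \<le> g r0"
    "\<bar>T (g R) (g r0)\<bar> \<le> 12 * Z * (2 powr (- real R / 8) - 2 powr (- real r0 / 8)) + real (r0 - R) * E" by auto
  have "\<bar>T (g r0) t\<bar> \<le> (Z * 2 powr (- real r0 / 8) + E) + D"
    using last[OF d(3,1,2)] block[OF order_refl d(3)[of r0]] unfolding g_def by linarith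
  moreover have "g r0 \<le> t" using d(1) by (simp add: g_def)
  then have "T (g R) t = T (g R) (g r0) + T (g r0) t" by (rule add[OF 1(1)])
  ultimately have "\<bar>T (g R) t\<bar> \<le> 12 * Z * (2 powr (- real R / 8) - 2 powr (- real r0 / 8)) + real (r0 - R) * E + ((Z * 2 powr (- real r0 / 8) + E) + D)"
    using 1(2) by linarith
  also have "\<dots> \<le> 12 * Z * 2 powr (- real R / 8) + (real r0 + 1) * E + D"
  proof -
    have "real (r0 - R) * E \<le> real r0 * E" using E by (intro mult_right_mono) auto
    moreover have "0 \<le> Z * 2 powr (- real r0 / 8)" using Z by simp
    moreover have "12 * Z * (2 powr (- real R / 8) - 2 powr (- real r0 / 8)) = 12 * Z * 2 powr (- real R / 8) - 12 * (Z * 2 powr (- real r0 / 8))"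
      "(real r0 + 1) * E = real r0 * E + E" by (simp_all add: algebra_simps)
    ultimately show ?thesis by linarith
  qed
  finally show ?thesis by (simp add: g_def)
qed

context permuted_lacunary
begin

lemma psum_Ind_add: "a' \<le> b' \<Longrightarrow> b' \<le> c' \<Longrightarrow> psum (Ind a' c') B x = psum (Ind a' b') B x + psum (Ind b' c') B x"
  unfolding psum_def sum.distrib[symmetric] by (intro sum.cong refl Ind_add)

text \<open>Indicators without centring are monotone in the endpoint, so beyond the finest dyadic
  level only the centring is lost, at most \<open>w - u\<close> per term.\<close>

lemma psum_Ind_last:
  assumes "u \<le> t" "t < w"
  shows "\<bar>psum (Ind u t) B x\<bar> \<le> \<bar>psum (Ind u w) B x\<bar> + real (card B) * (w - u)"
proof -
  have lo: "- (w - u) \<le> Ind u t y" and hi: "Ind u t y \<le> Ind u w y + (w - u)" for y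
    using assms by (auto simp: Ind_def indicator_def)
  have "(\<Sum>k\<in>B. - (w - u)) \<le> psum (Ind u t) B x" unfolding psum_def by (rule sum_mono) (rule lo)
  moreover have "psum (Ind u t) B x \<le> (\<Sum>k\<in>B. Ind u w (real (a (\<sigma> k)) * x) + (w - u))"
    unfolding psum_def by (rule sum_mono) (rule hi)
  moreover have "(\<Sum>k\<in>B. - (w - u)) = - (real (card B) * (w - u))" by (simp add: algebra_simps)
  moreover have "(\<Sum>k\<in>B. Ind u w (real (a (\<sigma> k)) * x) + (w - u)) = psum (Ind u w) B x + real (card B) * (w - u)"
    by (simp add: sum.distrib psum_def)
  ultimately show ?thesis by linarith
qed

text \<open>Uniformity over all endpoints comes from chaining them down to level
  \<open>n div 2\<close>. There the intervals have length of order \<open>1 / sqrt N\<close>, and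
  the trivial estimate costs only a multiple of \<open>sqrt N\<close>.\<close>

lemma discrepancy_fine:
  "\<exists>C>0. \<forall>R. AE x in U. eventually (\<lambda>N. \<forall>t\<in>{0..<1}.
     \<bar>S (Ind (real (dyfl R t) / 2 ^ R) t) N x\<bar> \<le> C * 2 powr (- real R / 8) * psi N + 10 * sqrt (real N)) sequentially"
proof -
  obtain C where C: "C > 0" "\<And>H. small_family 3 H \<Longrightarrow> (AE x in U. eventually (block_bound C H x) sequentially)"
    using block_estimate[of 3] by auto
  define I where "I r j = Ind (real j / 2 ^ r) ((real j + 1) / 2 ^ r)" for r j :: nat
  \<comment> \<open>The \<open>L^1\<close> norm of a centred indicator can reach almost twice the
    length; the factor \<open>1 / 2\<close> compensates for this.\<close>
  define H where "H r = (\<lambda>j x. 1 / 2 * I r j x) ` {..<2 ^ r}" for r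
  have Ib: "0 \<le> real j / 2 ^ r" "real j / 2 ^ r \<le> (real j + 1) / 2 ^ r" "(real j + 1) / 2 ^ r \<le> 1" if "j < 2 ^ r" for r j :: nat
  proof -
    have "j + 1 \<le> 2 ^ r" using that by simp
    then have "real (j + 1) \<le> real (2 ^ r)" by (rule of_nat_mono)
    then show "(real j + 1) / 2 ^ r \<le> 1" by simp
  qed (simp_all add: divide_right_mono)
  have "small_family 3 H"
    unfolding small_family_def
  proof (intro allI conjI ballI)
    fix r
    show "finite (H r)" by (simp add: H_def)
    show "card (H r) \<le> 2 ^ r" using card_image_le[of "{..<2 ^ r :: nat}" "\<lambda>j x. 1 / 2 * I r j x"] by (simp add: H_def)
    fix h assume "h \<in> H r"
    then obtain j where j: "j < 2 ^ r" "h = (\<lambda>x. 1 / 2 * I r j x)" by (auto simp: H_def)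
    show "bvc 3 h" unfolding j(2) I_def by (intro bvc_scale bvc_Ind Ib j(1)) auto
    have "(\<integral>x. \<bar>h x\<bar> \<partial>U) = 1 / 2 * (\<integral>x. \<bar>I r j x\<bar> \<partial>U)" unfolding j(2) by (simp add: abs_mult)
    also have "\<dots> \<le> 1 / 2 * (2 * ((real j + 1) / 2 ^ r - real j / 2 ^ r))"
      unfolding I_def by (intro mult_left_mono integral_Ind Ib j(1)) auto
    also have "\<dots> = (1 / 2) ^ r" by (simp add: power_divide diff_divide_distrib[symmetric])
    finally show "(\<integral>x. \<bar>h x\<bar> \<partial>U) \<le> (1 / 2) ^ r" .
  qed
  note est = C(2)[OF this]
  show ?thesis
  \<comment> \<open>Chaining over endpoints costs 12, undoing the halving in \<open>H\<close> costs
    2, and the passage to \<open>psi\<close> costs 2.\<close>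
  proof (intro exI[of _ "48 * C"] conjI allI)
    show "48 * C > 0" using C(1) by simp
    fix R :: nat
    show "AE x in U. eventually (\<lambda>N. \<forall>t\<in>{0..<1}.
     \<bar>S (Ind (real (dyfl R t) / 2 ^ R) t) N x\<bar> \<le> 48 * C * 2 powr (- real R / 8) * psi N + 10 * sqrt (real N)) sequentially"
      using est
    proof eventually_elim
      case (elim x)
      have "eventually (\<lambda>n::nat. (real n + 1) * (2 * C) \<le> 2 powr (real n / 2)) sequentially"
        by real_asymp
      from eventually_lev[OF elim] lev_scale_le_psi' eventually_ge_at_top[of 1] eventually_lev[OF this] eventually_lev[OF eventually_ge_at_top[of "2 * R"]] psi_pos
      show ?case
      proof eventually_elim
        case (elim N)
        define n where "n = lev N"
        define l0 where "l0 = (n + 1) div 2"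
        define r0 where "r0 = n div 2"
        \<comment> \<open>Rounding kills the term \<open>M mod 2 ^ l0\<close> of the block bound.
          Otherwise it would enter once per endpoint level, and a sum of order
          \<open>sqrt N * ln N\<close> would exceed \<open>psi\<close>; the omitted positions are
          restored once at the end.\<close>
        define M where "M = N div 2 ^ l0 * 2 ^ l0"
        have MN: "M \<le> N" by (simp add: M_def)
        have Mn: "M < 2 ^ n" using MN lev_less[of N] by (simp add: n_def)
        have Mm: "M mod 2 ^ l0 = 0" by (simp add: M_def)
        have NM: "N - M = N mod 2 ^ l0" by (simp add: M_def minus_div_mult_eq_mod)
        have sqN: "3 * 2 powr (real n / 2) \<le> 5 * sqrt (real N)" using lev_remainder[of N] elim(3) by (simp add: n_def)
        have blk: "\<bar>S (I r j) M x\<bar> \<le> 4 * C * psi N * 2 powr (- real r / 8) + 2 * C" if "r \<le> r0" "j < 2 ^ r" for r j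
        proof -
          have r2: "2 * r \<le> n" using that(1) by (simp add: r0_def)
          have h: "(\<lambda>x. 1 / 2 * I r j x) \<in> H r" using that(2) by (auto simp: H_def)
          have "M div 2 ^ n * 2 ^ n = 0" using Mn by simp
          moreover have "{0<..M} = {1..M}" by auto
          ultimately have "\<bar>S (\<lambda>x. 1 / 2 * I r j x) M x\<bar> \<le> C * 2 powr (- real r / 8) * sqrt (2 powr real n * ln (real n)) + C"
            using elim(1)[folded n_def, unfolded block_bound_def, rule_format, OF r2 h _ order_refl Mn] Mm by (simp add: l0_def)
          also have "\<dots> \<le> C * 2 powr (- real r / 8) * (2 * psi N) + C"
            using elim(2) C(1) by (intro add_mono mult_left_mono) (auto simp: n_def)
          finally have "\<bar>S (\<lambda>x. 1 / 2 * I r j x) M x\<bar> \<le> C * 2 powr (- real r / 8) * (2 * psi N) + C" .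
          moreover have "S (\<lambda>x. 1 / 2 * I r j x) M x = 1 / 2 * S (I r j) M x"
            unfolding psum_def by (rule sum_distrib_left[symmetric])
          ultimately show ?thesis by (simp only: abs_mult) (simp add: mult_ac)
        qed
        show ?case
        proof
          fix t :: real assume t: "t \<in> {0..<1}"
          define g where "g = real (dyfl R t) / 2 ^ R"
          have gt: "0 \<le> g" "g \<le> t" using dyfl(1)[of t R] t by (auto simp: g_def)
          define D where "D = real M / 2 ^ r0"
          have "\<bar>S (Ind g t) M x\<bar> \<le> 12 * (4 * C * psi N) * 2 powr (- real R / 8) + (real r0 + 1) * (2 * C) + D"
            unfolding g_def
          proof (rule endpoint_chain[where T="\<lambda>u w. S (Ind u w) M x"])
            show "0 \<le> t" "t < 1" using t by auto
            show "0 \<le> 4 * C * psi N" "0 \<le> 2 * C" using C(1) elim(6) by auto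
            show "R \<le> r0" using elim(5) by (simp add: r0_def n_def)
            show "S (Ind u w) M x = S (Ind u v) M x + S (Ind v w) M x" if "u \<le> v" "v \<le> w" for u v w
              using that by (rule psum_Ind_add)
            show "\<bar>S (Ind (real j / 2 ^ r) ((real j + 1) / 2 ^ r)) M x\<bar> \<le> 4 * C * psi N * 2 powr (- real r / 8) + 2 * C"
              if "r \<le> r0" "j < 2 ^ r" for r j using blk[OF that] by (simp only: I_def)
            show "\<bar>S (Ind (real j / 2 ^ r0) t) M x\<bar> \<le> \<bar>S (Ind (real j / 2 ^ r0) ((real j + 1) / 2 ^ r0)) M x\<bar> + D"
              if "real j / 2 ^ r0 \<le> t" "t < (real j + 1) / 2 ^ r0" for j
              using psum_Ind_last[OF that, of "{1..M}" x] by (simp add: D_def diff_divide_distrib[symmetric])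
          qed
          moreover have "(real r0 + 1) * (2 * C) \<le> 2 powr (real n / 2)"
          proof -
            have "(real r0 + 1) * (2 * C) \<le> (real n + 1) * (2 * C)" using C(1) by (intro mult_right_mono) (auto simp: r0_def)
            then show ?thesis using elim(4) by (simp add: n_def)
          qed
          moreover have "D \<le> 2 * 2 powr (real n / 2)"
          proof -
            have "real M \<le> 2 powr real n" using Mn of_nat_mono[of M "2 ^ n", where 'a=real] by (simp add: powr_realpow)
            also have "2 powr real n \<le> (2 * 2 powr (real n / 2)) * 2 ^ r0"
            proof -
              have "n \<le> 2 * r0 + 1" by (simp add: r0_def)
              then have "real n \<le> 1 + real n / 2 + real r0" by linarith
              then have "2 powr real n \<le> 2 powr (1 + real n / 2 + real r0)" by (intro powr_mono) auto
              then show ?thesis by (simp add: powr_add powr_realpow)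
            qed
            finally show ?thesis by (simp add: D_def divide_le_eq)
          qed
          moreover have "\<bar>S (Ind g t) N x - S (Ind g t) M x\<bar> \<le> 2 * 2 powr (real n / 2)"
          proof -
            have "S (Ind g t) N x - S (Ind g t) M x = psum (Ind g t) {M<..N} x" using psum_split[OF MN] by simp
            also have "\<bar>\<dots>\<bar> \<le> 1 * real (card {M<..N})"
              using gt t by (intro psum_abs_le Ind_abs_le) auto
            also have "\<dots> = real (N mod 2 ^ l0)" by (simp add: NM)
            also have "\<dots> \<le> 2 * 2 powr (real n / 2)" unfolding l0_def by (rule mod_half_power_le)
            finally show ?thesis .
          qed
          ultimately have "\<bar>S (Ind g t) N x\<bar> \<le> 12 * (4 * C * psi N) * 2 powr (- real R / 8) + 5 * 2 powr (real n / 2)"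
            by linarith
          also have "\<dots> \<le> 12 * (4 * C * psi N) * 2 powr (- real R / 8) + 10 * sqrt (real N)"
            using sqN real_sqrt_ge_zero[OF of_nat_0_le_iff[of N]] by linarith
          finally show "\<bar>S (Ind (real (dyfl R t) / 2 ^ R) t) N x\<bar> \<le> 48 * C * 2 powr (- real R / 8) * psi N + 10 * sqrt (real N)"
            by (simp add: g_def mult_ac)
        qed
      qed
    qed
  qed
qed

section \<open>The discrepancy as a supremum of interval sums\<close>

lemma discrepancy_psum:
  assumes "N \<ge> 1"
  shows "real N * \<bar>real (card {k \<in> {1..N}. frac (real (a (\<sigma> k)) * x) \<in> {u..<w}}) / real N - (w - u)\<bar> = \<bar>S (Ind u w) N x\<bar>"
proof -
  have "real (card {k \<in> {1..N}. frac (real (a (\<sigma> k)) * x) \<in> {u..<w}}) = (\<Sum>k\<in>{1..N}. indicator {u..<w} (frac (real (a (\<sigma> k)) * x)))"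
    by (simp add: indicator_def sum.If_cases Int_def)
  then have "S (Ind u w) N x = real N * (real (card {k \<in> {1..N}. frac (real (a (\<sigma> k)) * x) \<in> {u..<w}}) / real N - (w - u))"
    using assms by (simp add: psum_def Ind_def sum_subtractf right_diff_distrib)
  then show ?thesis by (simp add: abs_mult)
qed

lemma discrepancy_bounds:
  assumes N: "N \<ge> 1"
  shows "(\<And>u w. 0 \<le> u \<Longrightarrow> u < w \<Longrightarrow> w < 1 \<Longrightarrow> \<bar>S (Ind u w) N x\<bar> \<le> B) \<Longrightarrow>
      real N * discrepancy N (\<lambda>k. real (a (\<sigma> k)) * x) \<le> B"
    "0 \<le> u \<Longrightarrow> u < w \<Longrightarrow> w < 1 \<Longrightarrow> \<bar>S (Ind u w) N x\<bar> \<le> real N * discrepancy N (\<lambda>k. real (a (\<sigma> k)) * x)"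
proof -
  define Q where "Q = {(a, b). 0 \<le> a \<and> a < b \<and> b < (1::real)}"
  define \<phi> where "\<phi> ab = \<bar>real (card {k \<in> {1..N}. frac (real (a (\<sigma> k)) * x) \<in> {fst ab..<snd ab}}) / real N - (snd ab - fst ab)\<bar>" for ab
  have D: "discrepancy N (\<lambda>k. real (a (\<sigma> k)) * x) = (SUP ab\<in>Q. \<phi> ab)"
    unfolding discrepancy_def Q_def \<phi>_def ..
  have \<phi>: "real N * \<phi> (u, w) = \<bar>S (Ind u w) N x\<bar>" for u w
    unfolding \<phi>_def fst_conv snd_conv by (rule discrepancy_psum[OF N])
  have Np: "real N > 0" using N by simp
  { assume B: "\<And>u w. 0 \<le> u \<Longrightarrow> u < w \<Longrightarrow> w < 1 \<Longrightarrow> \<bar>S (Ind u w) N x\<bar> \<le> B"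
    have "(SUP ab\<in>Q. \<phi> ab) \<le> B / real N"
    proof (rule cSUP_least)
      have "(0, 1/2) \<in> Q" by (simp add: Q_def)
      then show "Q \<noteq> {}" by blast
      fix ab assume "ab \<in> Q"
      then obtain u w where uw: "ab = (u, w)" "0 \<le> u" "u < w" "w < 1" by (auto simp: Q_def)
      have "real N * \<phi> ab \<le> B" unfolding uw(1) \<phi> by (rule B[OF uw(2-4)])
      then show "\<phi> ab \<le> B / real N" using Np by (simp add: pos_le_divide_eq mult.commute)
    qed
    then show "real N * discrepancy N (\<lambda>k. real (a (\<sigma> k)) * x) \<le> B"
      unfolding D using Np by (simp add: pos_le_divide_eq mult.commute) }
  assume uw: "0 \<le> u" "u < w" "w < 1"
  have "\<phi> (u, w) \<le> (SUP ab\<in>Q. \<phi> ab)"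
  proof (rule cSUP_upper)
    show "(u, w) \<in> Q" using uw by (simp add: Q_def)
    show "bdd_above (\<phi> ` Q)"
    proof (rule bdd_aboveI2)
      fix ab assume "ab \<in> Q"
      then obtain u w where uw: "ab = (u, w)" "0 \<le> u" "u < w" "w < 1" by (auto simp: Q_def)
      have "\<bar>S (Ind u w) N x\<bar> \<le> 1 * real (card {1..N})" using uw by (intro psum_abs_le Ind_abs_le) auto
      then have "real N * \<phi> ab \<le> real N * 1" unfolding uw(1) \<phi> by simp
      then show "\<phi> ab \<le> 1" using Np by (simp only: mult_le_cancel_left_pos)
    qed
  qed
  then show "\<bar>S (Ind u w) N x\<bar> \<le> real N * discrepancy N (\<lambda>k. real (a (\<sigma> k)) * x)"
    unfolding D \<phi>[symmetric] using Np by simp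
qed

text \<open>Rounding both endpoints to a level \<open>R\<close> that depends on
  \<open>\<epsilon>\<close> alone leaves finitely many intervals. Each obeys the upper law, with
  constant at most \<open>1/2\<close> because \<open>l * (1 - l) \<le> 1/4\<close>.\<close>

lemma discrepancy_upper:
  assumes eps: "\<epsilon> > 0"
  shows "AE x in U. eventually (\<lambda>N. real N * discrepancy N (\<lambda>k. real (a (\<sigma> k)) * x) \<le> (1/2 + \<epsilon>) * psi N) sequentially"
proof -
  obtain C where C: "C > 0" "\<And>R. AE x in U. eventually (\<lambda>N. \<forall>t\<in>{0..<1}.
     \<bar>S (Ind (real (dyfl R t) / 2 ^ R) t) N x\<bar> \<le> C * 2 powr (- real R / 8) * psi N + 10 * sqrt (real N)) sequentially"
    using discrepancy_fine by blast
  have "eventually (\<lambda>R::nat. C * 2 powr (- real R / 8) \<le> \<epsilon> / 6) sequentially"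
    using C(1) eps by real_asymp
  then obtain R :: nat where R: "C * 2 powr (- real R / 8) \<le> \<epsilon> / 6"
    using eventually_happens' sequentially_bot by blast
  have e3: "\<epsilon> / 3 > 0" using eps by simp
  have coarse1: "AE x in U. eventually (\<lambda>N. \<bar>S (Ind (real i / 2 ^ R) (real j / 2 ^ R)) N x\<bar> \<le> (1/2 + \<epsilon> / 3) * psi N) sequentially"
    if ij: "i \<le> j" "j \<le> 2 ^ R" for i j :: nat
  proof -
    define l where "l = real j / 2 ^ R - real i / 2 ^ R"
    have b: "0 \<le> real i / 2 ^ R" "real i / 2 ^ R \<le> real j / 2 ^ R" "real j / 2 ^ R \<le> 1"
    proof -
      have "real j \<le> real (2 ^ R)" using ij(2) by (rule of_nat_mono)
      then show "real j / 2 ^ R \<le> 1" by simp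
    qed (use ij in \<open>simp_all add: divide_right_mono\<close>)
    have "lil_upper (Ind (real i / 2 ^ R) (real j / 2 ^ R)) (sqrt (l * (1 - l)))"
      using lil_bvc(1)[OF bvc_Ind[OF b]] by (simp add: integral_Ind(2)[OF b] l_def)
    then have ae: "AE x in U. eventually (\<lambda>N. \<bar>S (Ind (real i / 2 ^ R) (real j / 2 ^ R)) N x\<bar> \<le> (sqrt (l * (1 - l)) + \<epsilon> / 3) * psi N) sequentially"
      using e3 by (simp add: lil_upper_def)
    have s: "sqrt (l * (1 - l)) \<le> 1/2"
    proof (rule real_le_lsqrt)
      show "l * (1 - l) \<le> (1/2)\<^sup>2" using zero_le_power2[of "l - 1/2"] by (simp add: power2_eq_square algebra_simps)
    qed simp
    from ae show ?thesis
    proof eventually_elim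
      case (elim x)
      from elim psi_pos show ?case
      proof eventually_elim
        case (elim N)
        have "(sqrt (l * (1 - l)) + \<epsilon> / 3) * psi N \<le> (1/2 + \<epsilon> / 3) * psi N" using s elim(2) by (intro mult_right_mono) auto
        then show ?case using elim(1) by linarith
      qed
    qed
  qed
  have "AE x in U. \<forall>i. \<forall>j. i \<le> j \<and> j \<le> 2 ^ R \<longrightarrow>
      eventually (\<lambda>N. \<bar>S (Ind (real i / 2 ^ R) (real j / 2 ^ R)) N x\<bar> \<le> (1/2 + \<epsilon> / 3) * psi N) sequentially"
    unfolding AE_all_countable
  proof (intro allI)
    fix i j :: nat
    show "AE x in U. i \<le> j \<and> j \<le> 2 ^ R \<longrightarrow>
      eventually (\<lambda>N. \<bar>S (Ind (real i / 2 ^ R) (real j / 2 ^ R)) N x\<bar> \<le> (1/2 + \<epsilon> / 3) * psi N) sequentially"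
      using coarse1[of i j] by (cases "i \<le> j \<and> j \<le> 2 ^ R") auto
  qed
  with C(2)[of R] show ?thesis
  proof eventually_elim
    case (elim x)
    note fine = elim(1) and coarse = elim(2)
    have "eventually (\<lambda>N. \<forall>ij\<in>{(i, j). i \<le> j \<and> j \<le> (2::nat) ^ R}.
        \<bar>S (Ind (real (fst ij) / 2 ^ R) (real (snd ij) / 2 ^ R)) N x\<bar> \<le> (1/2 + \<epsilon> / 3) * psi N) sequentially"
    proof (rule eventually_ball_finite)
      have "{(i, j). i \<le> j \<and> j \<le> (2::nat) ^ R} \<subseteq> {..2 ^ R} \<times> {..2 ^ R}" by auto
      then show "finite {(i, j). i \<le> j \<and> j \<le> (2::nat) ^ R}" by (rule finite_subset) auto
    qed (use coarse in auto)
    with fine sqrt_le_psi[OF e3, of 20 0] psi_pos eventually_ge_at_top[of 1]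
    show ?case
    proof eventually_elim
      case (elim N)
      show ?case
      proof (rule discrepancy_bounds(1)[OF elim(4)])
        fix u w :: real assume uw: "0 \<le> u" "u < w" "w < 1"
        define gu where "gu = real (dyfl R u) / 2 ^ R"
        define gw where "gw = real (dyfl R w) / 2 ^ R"
        have d: "gu \<le> u" "gw \<le> w" using dyfl(1)[of u R] dyfl(1)[of w R] uw by (auto simp: gu_def gw_def)
        have m: "dyfl R u \<le> dyfl R w" unfolding dyfl_def using uw by (intro nat_mono floor_mono mult_right_mono) auto
        have gg: "gu \<le> gw" using m by (simp add: gu_def gw_def divide_right_mono)
        have "dyfl R w \<le> 2 ^ R" using dyfl(3)[of w R] uw by simp
        then have 1: "\<bar>S (Ind gu gw) N x\<bar> \<le> (1/2 + \<epsilon> / 3) * psi N"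
          using elim(5) m unfolding gu_def gw_def by auto
        have 2: "\<bar>S (Ind gu u) N x\<bar> \<le> C * 2 powr (- real R / 8) * psi N + 10 * sqrt (real N)"
          "\<bar>S (Ind gw w) N x\<bar> \<le> C * 2 powr (- real R / 8) * psi N + 10 * sqrt (real N)"
          using elim(1) uw unfolding gu_def gw_def by auto
        \<comment> \<open>The interval from \<open>u\<close> to \<open>w\<close> is the one from
          \<open>gu\<close> to \<open>gw\<close>, plus that from \<open>gw\<close> to
          \<open>w\<close>, minus that from \<open>gu\<close> to \<open>u\<close>. This remains true
          when both endpoints share a dyadic cell.\<close>
        have "S (Ind gu w) N x = S (Ind gu u) N x + S (Ind u w) N x" using d uw by (intro psum_Ind_add) auto
        moreover have "S (Ind gu w) N x = S (Ind gu gw) N x + S (Ind gw w) N x" using d gg by (intro psum_Ind_add) auto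
        ultimately have "\<bar>S (Ind u w) N x\<bar> \<le> \<bar>S (Ind gu gw) N x\<bar> + \<bar>S (Ind gw w) N x\<bar> + \<bar>S (Ind gu u) N x\<bar>" by linarith
        also have "\<dots> \<le> (1/2 + \<epsilon> / 3) * psi N + 2 * (C * 2 powr (- real R / 8) * psi N) + 20 * sqrt (real N)"
          using 1 2 by linarith
        also have "\<dots> \<le> (1/2 + \<epsilon> / 3) * psi N + 2 * (\<epsilon> / 6 * psi N) + \<epsilon> / 3 * psi N"
          using elim(2,3) R by (intro add_mono mult_left_mono mult_right_mono) auto
        also have "\<dots> = (1/2 + \<epsilon>) * psi N" by (simp add: algebra_simps)
        finally show "\<bar>S (Ind u w) N x\<bar> \<le> (1/2 + \<epsilon>) * psi N" .
      qed
    qed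
  qed
qed

lemma discrepancy_limsup:
  "AE x in U. limsup (\<lambda>N. ereal (real N * discrepancy N (\<lambda>k. real (a (\<sigma> k)) * x) / psi N)) = ereal (1/2)"
proof (rule AE_limsup_eqI)
  fix \<epsilon> :: real assume eps: "\<epsilon> > 0"
  from discrepancy_upper[OF eps]
  show "AE x in U. eventually (\<lambda>N. real N * discrepancy N (\<lambda>k. real (a (\<sigma> k)) * x) / psi N \<le> 1/2 + \<epsilon>) sequentially"
  proof eventually_elim
    case (elim x)
    from elim show ?case
      using psi_pos by eventually_elim (simp add: divide_le_eq)
  qed
  have b: "(0::real) \<le> 0" "(0::real) \<le> 1/2" "1/2 \<le> (1::real)" by auto
  have sq: "sqrt ((1/2 - 0) * (1 - (1/2 - 0))) = (1/2 :: real)"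
    by (rule real_sqrt_unique) (auto simp: power2_eq_square)
  \<comment> \<open>An interval of length \<open>1/2\<close> has the maximal variance
    \<open>1/4\<close>, so it alone attains the constant.\<close>
  have "lil_lower (Ind 0 (1/2)) (1/2)"
    using lil_bvc(2)[OF bvc_Ind[OF b]] unfolding integral_Ind(2)[OF b] sq by simp
  then have "AE x in U. frequently (\<lambda>N. S (Ind 0 (1/2)) N x \<ge> (1/2 - \<epsilon>) * psi N) sequentially"
    using eps unfolding lil_lower_def by blast
  then show "AE x in U. frequently (\<lambda>N. real N * discrepancy N (\<lambda>k. real (a (\<sigma> k)) * x) / psi N \<ge> 1/2 - \<epsilon>) sequentially"
  proof eventually_elim
    case (elim x)
    from elim show ?case
    proof (rule frequently_rev_mp)
      show "eventually (\<lambda>N. S (Ind 0 (1/2)) N x \<ge> (1/2 - \<epsilon>) * psi N \<longrightarrow>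
          real N * discrepancy N (\<lambda>k. real (a (\<sigma> k)) * x) / psi N \<ge> 1/2 - \<epsilon>) sequentially"
        using psi_pos eventually_ge_at_top[of 1]
      proof eventually_elim
        case (elim N)
        have "\<bar>S (Ind 0 (1/2)) N x\<bar> \<le> real N * discrepancy N (\<lambda>k. real (a (\<sigma> k)) * x)"
          by (rule discrepancy_bounds(2)[OF elim(2)]) auto
        then show ?case using elim(1) by (auto simp: le_divide_eq abs_le_iff intro: order_trans)
      qed
    qed
  qed
qed

end

section \<open>Return to Lebesgue measure on the open unit interval\<close>

lemma AE_U_imp_lborel: "AE x in U. P x \<Longrightarrow> AE x in lborel. x \<in> {0<..<1} \<longrightarrow> P x"
  unfolding AE_U by (erule AE_mp) auto

theorem theorem4:
  fixes n :: "nat \<Rightarrow> nat" and \<sigma> :: "nat \<Rightarrow> nat" and f :: "real \<Rightarrow> real"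
  assumes npos: "\<And>k. k \<ge> 1 \<Longrightarrow> n k > 0"
    and ngap: "filterlim (\<lambda>k. real (n (Suc k)) / real (n k)) at_top sequentially"
    and perm: "bij_betw \<sigma> {1..} {1..}"
    and fmeas: "f \<in> borel_measurable borel"
    and fper: "\<And>x. f (x + 1) = f x"
    and fmean: "(LBINT x=0..1. f x) = 0"
    and fvar: "total_variation f 0 1 < \<infinity>"
  shows "(AE x in lborel. x \<in> {0<..<1} \<longrightarrow>
           limsup (\<lambda>N. ereal ((\<Sum>k=1..N. f (real (n (\<sigma> k)) * x))
                     / sqrt (2 * real N * ln (ln (real N)))))
           = ereal (L2_norm01 f))
       \<and> (AE x in lborel. x \<in> {0<..<1} \<longrightarrow>
           limsup (\<lambda>N. ereal (real N * discrepancy N (\<lambda>k. real (n (\<sigma> k)) * x)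
                     / sqrt (2 * real N * ln (ln (real N)))))
           = ereal (1/2))"
proof -
  interpret permuted_lacunary n \<sigma> by unfold_locales (rule npos, assumption, rule ngap, rule perm)
  have mean: "(\<integral>x. f x \<partial>U) = 0" using fmean interval_integral_U[OF fmeas] by simp
  have norm: "L2_norm01 f = sqrt (\<integral>x. (f x)\<^sup>2 \<partial>U)"
    unfolding L2_norm01_def using fmeas by (subst interval_integral_U) auto
  have per: "periodic1 f" using fper by (simp add: periodic1_def)
  have "AE x in U. limsup (\<lambda>N. ereal ((\<Sum>k=1..N. f (real (n (\<sigma> k)) * x)) / sqrt (2 * real N * ln (ln (real N)))))
      = ereal (L2_norm01 f)"
    using lil_bounded_variation[OF fmeas per mean fvar] by (simp only: psum_def psi_def norm)
  moreover have "AE x in U. limsup (\<lambda>N. ereal (real N * discrepancy N (\<lambda>k. real (n (\<sigma> k)) * x) / sqrt (2 * real N * ln (ln (real N)))))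
      = ereal (1/2)"
    using discrepancy_limsup by (simp only: psi_def)
  ultimately show ?thesis by (intro conjI AE_U_imp_lborel)
qed

end
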